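(* Let $(M,g)$ be a smooth, closed, connected Riemannian manifold of dimension $n$, and let $E_\Lambda(x,y)$ be its spectral function. For every point $x\in M$ there exists a set $Z_x\subseteq M$ of full measure (i.e. $M\setminus Z_x$ has Riemannian measure zero) such that for every $y\in Z_x$ and every $\varepsilon>0$ there exist constants $C>0$ and $\Lambda_0$, depending only on $M,x,y,\varepsilon$, such that for every real $\Lambda\ge \Lambda_0$ $$|E_{\Lambda}(x,y)| \le C\,\Lambda^{n/2}(\log\Lambda)^{3/2}(\log\log\Lambda)^{1/2+\varepsilon}.$$
   Context: $\Delta$ denotes the non-negative Laplace-Beltrami operator of $(M,g)$. Let $\{\phi_j\}_{j\ge 0}$ be an orthonormal basis of $L^2(M)$ (with respect to the Riemannian measure) consisting of eigenfunctions, $\Delta\phi_j=\lambda_j^2\phi_j$, with $0=\lambda_0\le\lambda_1\le\lambda_2\le\cdots$. The spectral function is $$E_\Lambda(x,y)=\sum_{0<\lambda_j<\Lambda}\phi_j(x)\overline{\phi_j(y)},$$ the integral kernel of the spectral projection $\mathbf 1_{(0,\Lambda)}(\sqrt{\Delta})$. *)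

theory Defs
  imports "HOL-Analysis.Analysis"
begin

subsection \<open>Smooth functions on open subsets of Euclidean space\<close>

definition partial_deriv :: "'n::finite \<Rightarrow> (real^'n \<Rightarrow> 'b::real_normed_vector) \<Rightarrow> real^'n \<Rightarrow> 'b"
  where "partial_deriv i f x = frechet_derivative f (at x) (axis i 1)"

text \<open>Only meant for open \<open>S\<close>.\<close>

primrec Ck_on :: "nat \<Rightarrow> (real^'n) set \<Rightarrow> (real^'n::finite \<Rightarrow> 'b::real_normed_vector) \<Rightarrow> bool"
  where
    "Ck_on 0 S f \<longleftrightarrow> continuous_on S f"
  | "Ck_on (Suc k) S f \<longleftrightarrow>
       (\<forall>x\<in>S. f differentiable (at x)) \<and> (\<forall>i. Ck_on k S (partial_deriv i f))"

definition smooth_on :: "(real^'n::finite) set \<Rightarrow> (real^'n \<Rightarrow> 'b::real_normed_vector) \<Rightarrow> bool"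
  where "smooth_on S f \<longleftrightarrow> (\<forall>k. Ck_on k S f)"


subsection \<open>Smooth manifolds modelled on \<open>real^'n\<close>\<close>

text \<open>
  The points of the manifold are all elements of a Hausdorff, second countable type \<open>'a\<close>;
  its dimension is \<open>CARD('n)\<close>. A chart is a pair of its domain and its coordinate map,
  whose values outside the domain are irrelevant.
\<close>

type_synonym ('a, 'n) chart = "'a set \<times> ('a \<Rightarrow> real^'n)"

definition chart_image :: "('a, 'n::finite) chart \<Rightarrow> (real^'n) set"
  where "chart_image c = snd c ` fst c"

definition chart_inv :: "('a, 'n::finite) chart \<Rightarrow> real^'n \<Rightarrow> 'a"
  where "chart_inv c = inv_into (fst c) (snd c)"

definition is_chart :: "('a::topological_space, 'n::finite) chart \<Rightarrow> bool"
  where "is_chart c \<longleftrightarrow> open (fst c) \<and> open (chart_image c) \<and>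
           homeomorphism (fst c) (chart_image c) (snd c) (chart_inv c)"

definition transition_map :: "('a, 'n::finite) chart \<Rightarrow> ('a, 'n) chart \<Rightarrow> real^'n \<Rightarrow> real^'n"
  where "transition_map c d = snd d \<circ> chart_inv c"

definition smooth_atlas :: "('a::topological_space, 'n::finite) chart set \<Rightarrow> bool"
  where "smooth_atlas \<A> \<longleftrightarrow>
           (\<forall>c\<in>\<A>. is_chart c) \<and> (\<Union>c\<in>\<A>. fst c) = UNIV \<and>
           (\<forall>c\<in>\<A>. \<forall>d\<in>\<A>. smooth_on (snd c ` (fst c \<inter> fst d)) (transition_map c d))"

definition smooth_function ::
    "('a::topological_space, 'n::finite) chart set \<Rightarrow> ('a \<Rightarrow> 'b::real_normed_vector) \<Rightarrow> bool"
  where "smooth_function \<A> f \<longleftrightarrow> (\<forall>c\<in>\<A>. smooth_on (chart_image c) (f \<circ> chart_inv c))"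


subsection \<open>Riemannian metrics\<close>

text \<open>
  A metric is given by its matrix \<open>g c x = (g\<^sub>i\<^sub>j(x))\<close> in every chart \<open>c\<close> of the atlas, as a
  function of the coordinates \<open>x\<close>; the last clause is the transformation law of a covariant
  2-tensor, \<open>g\<^sub>c(v,w) = g\<^sub>d(D\<tau> v, D\<tau> w)\<close> for the transition map \<open>\<tau>\<close> from \<open>c\<close> to \<open>d\<close>.
\<close>

definition riemannian_metric ::
    "('a::topological_space, 'n::finite) chart set \<Rightarrow> (('a, 'n) chart \<Rightarrow> real^'n \<Rightarrow> real^'n^'n) \<Rightarrow> bool"
  where "riemannian_metric \<A> g \<longleftrightarrow>
     (\<forall>c\<in>\<A>. smooth_on (chart_image c) (g c) \<and>
        (\<forall>x\<in>chart_image c. transpose (g c x) = g c x \<and> (\<forall>v. v \<noteq> 0 \<longrightarrow> v \<bullet> (g c x *v v) > 0))) \<and>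
     (\<forall>c\<in>\<A>. \<forall>d\<in>\<A>. \<forall>p\<in>fst c \<inter> fst d. \<forall>v w.
        let D = frechet_derivative (transition_map c d) (at (snd c p))
        in v \<bullet> (g c (snd c p) *v w) = D v \<bullet> (g d (snd d p) *v D w))"

definition closed_connected_riemannian_manifold ::
    "('a::{t2_space, second_countable_topology}, 'n::finite) chart set \<Rightarrow>
     (('a, 'n) chart \<Rightarrow> real^'n \<Rightarrow> real^'n^'n) \<Rightarrow> bool"
  where "closed_connected_riemannian_manifold \<A> g \<longleftrightarrow>
           compact (UNIV :: 'a set) \<and> connected (UNIV :: 'a set) \<and>
           smooth_atlas \<A> \<and> riemannian_metric \<A> g"


subsection \<open>The Riemannian measure\<close>

definition volume_density ::
    "(('a, 'n::finite) chart \<Rightarrow> real^'n \<Rightarrow> real^'n^'n) \<Rightarrow> ('a, 'n) chart \<Rightarrow> real^'n \<Rightarrow> real"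
  where "volume_density g c x = sqrt (det (g c x))"

definition chart_measure ::
    "(('a::topological_space, 'n::finite) chart \<Rightarrow> real^'n \<Rightarrow> real^'n^'n) \<Rightarrow> ('a, 'n) chart \<Rightarrow> 'a measure"
  where "chart_measure g c =
     distr (density lborel (\<lambda>x. indicator (chart_image c) x * ennreal (volume_density g c x)))
           borel (chart_inv c)"

text \<open>
  \<open>chart_measure g c\<close> is \<open>\<surd>det g dx\<close> on the domain of \<open>c\<close>, extended by zero to the whole manifold.
  On overlaps of chart domains these measures agree, so their supremum in the lattice of
  measures is the unique Borel measure that restricts to \<open>\<surd>det g dx\<close> on each chart domain.
\<close>

definition riemannian_measure ::
    "('a::topological_space, 'n::finite) chart set \<Rightarrow>
     (('a, 'n) chart \<Rightarrow> real^'n \<Rightarrow> real^'n^'n) \<Rightarrow> 'a measure"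
  where "riemannian_measure \<A> g = (SUP c\<in>\<A>. chart_measure g c)"


subsection \<open>The Laplace-Beltrami operator\<close>

text \<open>\<open>- 1/\<surd>|g| \<Sum>\<^sub>i \<partial>\<^sub>i (\<surd>|g| \<Sum>\<^sub>j g\<^sup>i\<^sup>j \<partial>\<^sub>j f)\<close>, evaluated at the point \<open>p\<close> in the domain of \<open>c\<close>\<close>

definition chart_laplacian ::
    "(('a, 'n::finite) chart \<Rightarrow> real^'n \<Rightarrow> real^'n^'n) \<Rightarrow> ('a, 'n) chart \<Rightarrow> ('a \<Rightarrow> complex) \<Rightarrow> 'a \<Rightarrow> complex"
  where "chart_laplacian g c f p =
     - ((1 / volume_density g c (snd c p)) *\<^sub>R
        (\<Sum>i\<in>UNIV. partial_deriv i
           (\<lambda>x. \<Sum>j\<in>UNIV. (volume_density g c x * matrix_inv (g c x) $ i $ j) *\<^sub>R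
                  partial_deriv j (f \<circ> chart_inv c) x) (snd c p)))"

text \<open>\<open>h = \<Delta>f\<close> for smooth \<open>f\<close>\<close>

definition has_laplacian ::
    "('a::topological_space, 'n::finite) chart set \<Rightarrow> (('a, 'n) chart \<Rightarrow> real^'n \<Rightarrow> real^'n^'n) \<Rightarrow>
     ('a \<Rightarrow> complex) \<Rightarrow> ('a \<Rightarrow> complex) \<Rightarrow> bool"
  where "has_laplacian \<A> g f h \<longleftrightarrow>
           smooth_function \<A> f \<and> (\<forall>c\<in>\<A>. \<forall>p\<in>fst c. h p = chart_laplacian g c f p)"


subsection \<open>Orthonormal bases of \<open>L\<^sup>2\<close> and the spectral function\<close>

definition square_integrable :: "'a measure \<Rightarrow> ('a \<Rightarrow> complex) \<Rightarrow> bool"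
  where "square_integrable M f \<longleftrightarrow>
           f \<in> borel_measurable M \<and> integrable M (\<lambda>x. (cmod (f x))\<^sup>2)"

definition L2_inner :: "'a measure \<Rightarrow> ('a \<Rightarrow> complex) \<Rightarrow> ('a \<Rightarrow> complex) \<Rightarrow> complex"
  where "L2_inner M f h = (LINT x|M. f x * cnj (h x))"

definition L2_orthonormal_basis :: "'a measure \<Rightarrow> (nat \<Rightarrow> 'a \<Rightarrow> complex) \<Rightarrow> bool"
  where "L2_orthonormal_basis M \<phi> \<longleftrightarrow>
     (\<forall>j. square_integrable M (\<phi> j)) \<and>
     (\<forall>i j. L2_inner M (\<phi> i) (\<phi> j) = (if i = j then 1 else 0)) \<and>
     (\<forall>f. square_integrable M f \<longrightarrow>
        (\<lambda>N. LINT x|M. (cmod (f x - (\<Sum>j<N. L2_inner M f (\<phi> j) * \<phi> j x)))\<^sup>2) \<longlonglongrightarrow> 0)"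

definition laplace_eigenbasis ::
    "('a::topological_space, 'n::finite) chart set \<Rightarrow> (('a, 'n) chart \<Rightarrow> real^'n \<Rightarrow> real^'n^'n) \<Rightarrow>
     (nat \<Rightarrow> 'a \<Rightarrow> complex) \<Rightarrow> (nat \<Rightarrow> real) \<Rightarrow> bool"
  where "laplace_eigenbasis \<A> g \<phi> \<nu> \<longleftrightarrow>
     L2_orthonormal_basis (riemannian_measure \<A> g) \<phi> \<and>
     (\<forall>j. has_laplacian \<A> g (\<phi> j) (\<lambda>p. complex_of_real ((\<nu> j)\<^sup>2) * \<phi> j p)) \<and>
     \<nu> 0 = 0 \<and> incseq \<nu>"

text \<open>
  The index set is finite because the spectrum of a closed manifold is discrete.
\<close>

definition spectral_function ::
    "(nat \<Rightarrow> 'a \<Rightarrow> complex) \<Rightarrow> (nat \<Rightarrow> real) \<Rightarrow> real \<Rightarrow> 'a \<Rightarrow> 'a \<Rightarrow> complex"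
  where "spectral_function \<phi> \<nu> \<Lambda> x y =
           (\<Sum>j | 0 < \<nu> j \<and> \<nu> j < \<Lambda>. \<phi> j x * cnj (\<phi> j y))"


text \<open>
  \<open>chart_inv c\<close> is measurable: it is continuous on the open set \<open>chart_image c\<close> and constant
  (a \<open>SOME\<close> over the empty predicate) outside.
\<close>

lemma measurable_chart_inv:
  assumes "is_chart c"
  shows "chart_inv c \<in> borel_measurable borel"
proof -
  have op: "open (chart_image c)" and ct: "continuous_on (chart_image c) (chart_inv c)"
    using assms by (auto simp: is_chart_def homeomorphism_def)
  have "chart_inv c = (\<lambda>x. if x \<in> chart_image c then chart_inv c x else (SOME y. False))"
    by (auto simp: fun_eq_iff chart_inv_def chart_image_def inv_into_def image_iff
        intro!: arg_cong[where f = Eps])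
  also have "\<dots> \<in> borel_measurable borel"
    using op ct by (intro borel_measurable_continuous_on_if) auto
  finally show ?thesis .
qed

lemma emeasure_chart_measure:
  fixes c :: "('a::topological_space, 'n::finite) chart"
  assumes c: "is_chart c" and g: "continuous_on (chart_image c) (g c)" and B: "B \<in> sets borel"
  shows "emeasure (chart_measure g c) B =
    (\<integral>\<^sup>+ x. indicator (snd c ` (B \<inter> fst c)) x * ennreal (volume_density g c x) \<partial>lborel)"
proof -
  let ?\<rho> = "\<lambda>x. indicator (chart_image c) x * ennreal (volume_density g c x)"
  have op: "chart_image c \<in> sets borel" using c by (auto simp: is_chart_def)
  have "continuous_on (chart_image c) (volume_density g c)"
    unfolding volume_density_def det_def by (intro continuous_intros g)
  then have "(\<lambda>x. if x \<in> chart_image c then volume_density g c x else 0) \<in> borel_measurable borel"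
    using op by (intro borel_measurable_continuous_on_if) auto
  then have "(\<lambda>x. ennreal (if x \<in> chart_image c then volume_density g c x else 0)) \<in> borel_measurable borel"
    by measurable
  moreover have "?\<rho> = (\<lambda>x. ennreal (if x \<in> chart_image c then volume_density g c x else 0))"
    by (auto simp: indicator_def)
  ultimately have \<rho>: "?\<rho> \<in> borel_measurable lborel" by simp
  have m: "chart_inv c \<in> borel_measurable lborel" using measurable_chart_inv[OF c] by simp
  have "emeasure (chart_measure g c) B =
     (\<integral>\<^sup>+ x. ?\<rho> x * indicator (chart_inv c -` B) x \<partial>lborel)"
    unfolding chart_measure_def using \<rho> m B measurable_sets[OF m B]
    by (simp add: emeasure_distr emeasure_density)
  also have "\<dots> = (\<integral>\<^sup>+ x. indicator (snd c ` (B \<inter> fst c)) x * ennreal (volume_density g c x) \<partial>lborel)"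
  proof (intro nn_integral_cong)
    fix x
    have h: "homeomorphism (fst c) (chart_image c) (snd c) (chart_inv c)"
      using c by (simp add: is_chart_def)
    have "x \<in> snd c ` (B \<inter> fst c) \<longleftrightarrow> x \<in> chart_image c \<and> chart_inv c x \<in> B"
    proof
      assume "x \<in> snd c ` (B \<inter> fst c)"
      then show "x \<in> chart_image c \<and> chart_inv c x \<in> B"
        using homeomorphism_apply1[OF h] by (auto simp: chart_image_def)
    next
      assume "x \<in> chart_image c \<and> chart_inv c x \<in> B"
      then show "x \<in> snd c ` (B \<inter> fst c)"
        using homeomorphism_apply2[OF h] homeomorphism_image2[OF h] by (metis IntI image_eqI)
    qed
    then show "?\<rho> x * indicator (chart_inv c -` B) x =
      indicator (snd c ` (B \<inter> fst c)) x * ennreal (volume_density g c x)"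
      by (auto simp: indicator_def)
  qed
  finally show ?thesis .
qed

lemma sets_riemannian_measure:
  assumes "smooth_atlas \<A>"
  shows "sets (riemannian_measure \<A> g) = sets borel"
proof -
  have "\<A> \<noteq> {}" using assms by (auto simp: smooth_atlas_def)
  then show ?thesis unfolding riemannian_measure_def
    by (intro sets_SUP) (simp_all add: chart_measure_def)
qed

lemma chart_measure_le_riemannian_measure:
  "c \<in> \<A> \<Longrightarrow> chart_measure g c \<le> riemannian_measure \<A> g"
  unfolding riemannian_measure_def by (rule SUP_upper)

end

theory Submission
  imports Defs
begin

text \<open>
  Fix \<open>x\<close>. Two ingredients give the bound for almost every \<open>y\<close>.

  \<^item> The local Weyl bound \<open>\<Sum>\<^bsub>\<nu>\<^sub>j < \<Lambda>\<^esub> |\<phi>\<^sub>j(x)|\<^sup>2 \<le> C\<^sub>x \<Lambda>\<^sup>n\<close>. For \<open>v(p,t) = Re \<Sum>\<^sub>j cnj (\<phi>\<^sub>j(x)) \<phi>\<^sub>j(p) e\<^bsup>\<nu>\<^sub>j t\<^esup>\<close> one has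
    \<open>(\<Delta> - \<partial>\<^sub>t\<^sup>2) v = 0\<close> on \<open>M \<times> \<real>\<close>, so \<open>v\<^sup>2\<close> is a subsolution of an elliptic equation in \<open>n + 1\<close> variables. The mean
    value inequality for \<open>v\<^sup>2\<close> on a ball of radius \<open>R \<sim> 1/\<Lambda>\<close> about \<open>(x,0)\<close>, where \<open>v(x,0)\<close> is the sum \<open>S\<close> to be
    estimated, reads \<open>S\<^sup>2 \<le> C R\<^bsup>-(n+1)\<^esup> \<cdot> R S\<close>.

  \<^item> The Rademacher-Menshov inequality for the orthogonal series \<open>\<Sum>\<^sub>j \<phi>\<^sub>j(x) cnj (\<phi>\<^sub>j(y))\<close>, in a form that needs no
    bound for the number of terms: the series is cut where the mass \<open>\<Sum>\<^sub>j |\<phi>\<^sub>j(x)|\<^sup>2\<close> passes an integer, and the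
    pieces of mass at most \<open>1\<close> that are left are bounded by Cauchy-Schwarz and the local Weyl bound at \<open>y\<close>. The
    squared maximal function up to \<open>\<Lambda> = 2\<^sup>k\<close> has integral \<open>O(k\<^sup>2 2\<^bsup>kn\<^esup>)\<close>; divided by
    \<open>2\<^bsup>kn\<^esup> k\<^sup>3 (log k)\<^bsup>1+\<delta>\<^esup>\<close> these integrals are summable in \<open>k\<close>.
\<close>

section \<open>Maximal inequalities for orthonormal sums\<close>

text \<open>This is the obstacle behind measuring the orthogonal series by its mass: the mass up to
  \<open>\<Lambda>\<close> is controlled at the single point \<open>x\<close>, and its logarithm
  replaces the logarithm of the number of terms.

  The variable \<open>t\<close> turns a sum of eigenfunctions with different eigenvalues into one
  solution of one equation. The radius is fixed by the demand that the exponential factors stay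
  bounded for the times that occur. The mean value inequality is proved for the centre alone, by
  testing with a function of the squared distance whose metric is frozen there; continuously
  differentiable coefficients suffice for this and no iteration is involved.

  The exponents in the result are halves, because squares are estimated: of \<open>n\<close>; of
  \<open>3 = 2 + 1\<close>, with \<open>2\<close> from the squared number of dyadic levels and
  \<open>1\<close> from the convergence of the series over \<open>k\<close>; and of
  \<open>1 + \<delta>\<close>, which makes that series converge.\<close>

lemma cmod_add_squared_le: "(cmod (a + b))\<^sup>2 \<le> 2 * (cmod a)\<^sup>2 + 2 * (cmod b)\<^sup>2"
proof -
  have "(cmod (a + b))\<^sup>2 \<le> (cmod a + cmod b)\<^sup>2"
    by (intro power_mono norm_triangle_ineq) simp
  also have "\<dots> \<le> 2 * (cmod a)\<^sup>2 + 2 * (cmod b)\<^sup>2"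
    using sum_squares_bound[of "cmod a" "cmod b"] by (simp add: power2_sum)
  finally show ?thesis .
qed

lemma cmod_sum_squared_le:
  "(cmod (\<Sum>l\<in>I. f l))\<^sup>2 \<le> real (card I) * (\<Sum>l\<in>I. (cmod (f l))\<^sup>2)"
proof -
  have "(cmod (\<Sum>l\<in>I. f l))\<^sup>2 \<le> (\<Sum>l\<in>I. 1 * cmod (f l))\<^sup>2"
    using norm_sum[of f I] by (intro power_mono) auto
  also have "\<dots> \<le> (\<Sum>l\<in>I. 1\<^sup>2) * (\<Sum>l\<in>I. (cmod (f l))\<^sup>2)"
    by (rule Cauchy_Schwarz_ineq_sum)
  finally show ?thesis by simp
qed

text \<open>Clearing the last binary digits of \<open>i\<close> one after another leads from
  \<open>i\<close> to \<open>0\<close> in \<open>L\<close> steps, each of which is trivial or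
  crosses a single dyadic block. Cauchy-Schwarz over the steps costs the factor \<open>L\<close>;
  bounding a step by the sum over its whole level makes the right side independent of
  \<open>i\<close>.\<close>

lemma dyadic_chaining:
  fixes S :: "nat \<Rightarrow> complex"
  assumes "i < 2 ^ L"
  shows "(cmod (S i - S 0))\<^sup>2
    \<le> L * (\<Sum>l<L. \<Sum>m<2^L. (cmod (S ((m + 1) * 2 ^ l) - S (m * 2 ^ l)))\<^sup>2)"
proof -
  define r where "r l = i div 2 ^ l * 2 ^ l" for l
  define V where "V l = (\<Sum>m<2^L. (cmod (S ((m + 1) * 2 ^ l) - S (m * 2 ^ l)))\<^sup>2)" for l
  have V0: "V l \<ge> 0" for l unfolding V_def by (intro sum_nonneg) simp
  have step: "(cmod (S (r l) - S (r (Suc l))))\<^sup>2 \<le> V l" for l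
  proof -
    define k where "k = i div 2 ^ l"
    have rl: "r l = k * 2 ^ l" and rS: "r (Suc l) = k div 2 * 2 * 2 ^ l"
      unfolding r_def k_def power_Suc2 div_mult2_eq by (simp_all add: ac_simps)
    show ?thesis
    proof (cases "even k")
      case True
      then have "r l = r (Suc l)" using rl rS by simp
      then show ?thesis using V0 by simp
    next
      \<comment> \<open>The cleared digit is \<open>1\<close>: the step crosses block number
        \<open>m = k - 1\<close> of level \<open>l\<close>.\<close>
      case False
      define m where "m = k div 2 * 2"
      have km: "k = m + 1" using False unfolding m_def by (metis add.commute odd_two_times_div_two_succ mult.commute)
      have "k \<le> i" by (simp add: k_def)
      then have "m < 2 ^ L" using km assms by linarith
      then have "(cmod (S ((m + 1) * 2 ^ l) - S (m * 2 ^ l)))\<^sup>2 \<le> V l"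
        unfolding V_def by (intro member_le_sum) auto
      moreover have "r l = (m + 1) * 2 ^ l" "r (Suc l) = m * 2 ^ l"
        using km rl rS m_def by auto
      ultimately show ?thesis by simp
    qed
  qed
  have "r 0 = i" "r L = 0" using assms by (simp_all add: r_def)
  then have "S i - S 0 = (\<Sum>l<L. S (r l) - S (r (Suc l)))"
    using sum_lessThan_telescope'[of "\<lambda>l. S (r l)" L] by simp
  then have "(cmod (S i - S 0))\<^sup>2 \<le> L * (\<Sum>l<L. (cmod (S (r l) - S (r (Suc l))))\<^sup>2)"
    using cmod_sum_squared_le[of "\<lambda>l. S (r l) - S (r (Suc l))" "{..<L}"] by simp
  also have "\<dots> \<le> L * (\<Sum>l<L. V l)"
    by (intro mult_left_mono sum_mono step) simp
  finally show ?thesis by (simp add: V_def)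
qed

lemma integrable_mult_cnj:
  assumes "square_integrable M f" "square_integrable M h"
  shows "integrable M (\<lambda>x. f x * cnj (h x))"
proof (rule Bochner_Integration.integrable_bound)
  show "integrable M (\<lambda>x. (cmod (f x))\<^sup>2 + (cmod (h x))\<^sup>2)"
    using assms by (auto simp: square_integrable_def)
  have "(\<lambda>x. cnj (h x)) \<in> borel_measurable M"
    using assms by (intro measurable_compose[OF _ borel_measurable_continuous_onI[of cnj]] continuous_intros)
      (auto simp: square_integrable_def)
  then show "(\<lambda>x. f x * cnj (h x)) \<in> borel_measurable M"
    using assms by (auto simp: square_integrable_def)
  show "AE x in M. norm (f x * cnj (h x)) \<le> norm ((cmod (f x))\<^sup>2 + (cmod (h x))\<^sup>2)"
  proof (rule AE_I2)
    fix x
    have "2 * (cmod (f x) * cmod (h x)) \<le> (cmod (f x))\<^sup>2 + (cmod (h x))\<^sup>2"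
      using sum_squares_bound[of "cmod (f x)" "cmod (h x)"] by simp
    moreover have "0 \<le> cmod (f x) * cmod (h x)" by simp
    ultimately have "cmod (f x) * cmod (h x) \<le> (cmod (f x))\<^sup>2 + (cmod (h x))\<^sup>2"
      by linarith
    then show "norm (f x * cnj (h x)) \<le> norm ((cmod (f x))\<^sup>2 + (cmod (h x))\<^sup>2)"
      by (simp add: norm_mult)
  qed
qed

lemma cmod_squared_integral_orthonormal_sum:
  assumes sq: "\<And>j. square_integrable M (\<phi> j)"
    and on: "\<And>i j. L2_inner M (\<phi> i) (\<phi> j) = (if i = j then 1 else 0)"
    and J: "finite J"
  shows "integrable M (\<lambda>y. (cmod (\<Sum>j\<in>J. c j * \<phi> j y))\<^sup>2)"
    and "(LINT y|M. (cmod (\<Sum>j\<in>J. c j * \<phi> j y))\<^sup>2) = (\<Sum>j\<in>J. (cmod (c j))\<^sup>2)"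
proof -
  define F where "F y = (\<Sum>i\<in>J. \<Sum>j\<in>J. c i * cnj (c j) * (\<phi> i y * cnj (\<phi> j y)))" for y
  have F: "complex_of_real ((cmod (\<Sum>j\<in>J. c j * \<phi> j y))\<^sup>2) = F y" for y
    unfolding F_def complex_norm_square cnj_sum sum_product
    by (intro sum.cong refl) (simp add: algebra_simps)
  have int: "integrable M (\<lambda>y. \<phi> i y * cnj (\<phi> j y))" for i j
    by (intro integrable_mult_cnj sq)
  have iF: "integrable M F" unfolding F_def by (intro Bochner_Integration.integrable_sum integrable_mult_right int)
  have "integrable M (\<lambda>y. Re (F y))" using iF by (rule integrable_Re)
  then show i: "integrable M (\<lambda>y. (cmod (\<Sum>j\<in>J. c j * \<phi> j y))\<^sup>2)"
    by (simp flip: F)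
  have "(LINT y|M. F y) = (\<Sum>i\<in>J. \<Sum>j\<in>J. c i * cnj (c j) * L2_inner M (\<phi> i) (\<phi> j))"
    unfolding F_def L2_inner_def
    by (simp add: Bochner_Integration.integral_sum Bochner_Integration.integrable_sum int)
  also have "\<dots> = (\<Sum>i\<in>J. c i * cnj (c i))"
    using J by (intro sum.cong refl) (simp add: on if_distrib cong: if_cong)
  also have "\<dots> = complex_of_real (\<Sum>i\<in>J. (cmod (c i))\<^sup>2)"
    by (simp add: complex_norm_square flip: of_real_power)
  finally have "(LINT y|M. F y) = complex_of_real (\<Sum>i\<in>J. (cmod (c i))\<^sup>2)" .
  then have "(LINT y|M. complex_of_real ((cmod (\<Sum>j\<in>J. c j * \<phi> j y))\<^sup>2))
      = complex_of_real (\<Sum>i\<in>J. (cmod (c i))\<^sup>2)" by (simp only: F)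
  then have "complex_of_real (LINT y|M. (cmod (\<Sum>j\<in>J. c j * \<phi> j y))\<^sup>2)
      = complex_of_real (\<Sum>i\<in>J. (cmod (c i))\<^sup>2)" by (simp only: integral_complex_of_real)
  then show "(LINT y|M. (cmod (\<Sum>j\<in>J. c j * \<phi> j y))\<^sup>2) = (\<Sum>j\<in>J. (cmod (c j))\<^sup>2)"
    by (simp only: of_real_eq_iff)
qed

text \<open>Chaining runs over the indices at which the mass \<open>s\<close> first reaches an
  integer. There are fewer than \<open>2 ^ L\<close> such levels, however many terms lie between
  them, and on each dyadic scale orthogonality makes the integrals of the blocks telescope to at
  most \<open>Q\<close>. The terms after the last integer level carry mass at most \<open>1\<close>,
  so Cauchy-Schwarz leaves only the sum over \<open>\<phi> j y\<close>. The predicate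
  \<open>P\<close> stands for an initial segment that may be infinite, hence the absence of a
  largest \<open>N\<close>.\<close>

lemma rademacher_menshov_by_mass:
  fixes c :: "nat \<Rightarrow> complex" and \<phi> :: "nat \<Rightarrow> 'a \<Rightarrow> complex"
  defines "s \<equiv> \<lambda>N. \<Sum>j<N. (cmod (c j))\<^sup>2"
    and "S \<equiv> \<lambda>N y. \<Sum>j<N. c j * \<phi> j y"
  assumes sq: "\<And>j. square_integrable M (\<phi> j)"
    and on: "\<And>i j. L2_inner M (\<phi> i) (\<phi> j) = (if i = j then 1 else 0)"
    and P: "\<And>m N. P N \<Longrightarrow> m \<le> N \<Longrightarrow> P m"
    and sP: "\<And>N. P N \<Longrightarrow> s N \<le> Q" and Q: "Q < 2 ^ L" "0 \<le> Q"
  shows "\<exists>H. integrable M H \<and> (\<forall>y. 0 \<le> H y) \<and> (LINT y|M. H y) \<le> (real L)\<^sup>2 * Q \<and>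
    (\<forall>N y. P N \<longrightarrow> (cmod (S N y))\<^sup>2 \<le> 2 * H y + 2 * (\<Sum>j<N. (cmod (\<phi> j y))\<^sup>2))"
proof (cases "P 0")
  case False
  then have "\<not> P N" for N using P by blast
  then show ?thesis using Q by (intro exI[of _ "\<lambda>_. 0"]) auto
next
  case P0: True
  have s_mono: "s a \<le> s b" if "a \<le> b" for a b
    unfolding s_def using that by (intro sum_mono2) auto
  have s_nonneg: "0 \<le> s a" for a unfolding s_def by (intro sum_nonneg) auto
  \<comment> \<open>The integer levels reached by admissible \<open>N\<close>; finite because the
    mass stays below \<open>Q\<close>.\<close>
  define I where "I = {i. \<exists>N. P N \<and> real i \<le> s N}"
  have I0: "0 \<in> I" using P0 s_nonneg by (auto simp: I_def)
  have I_le: "real i \<le> Q" if "i \<in> I" for i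
    using that sP by (force simp: I_def)
  have "I \<subseteq> {..nat \<lfloor>Q\<rfloor>}" using I_le by (force simp: le_nat_floor)
  then have finI: "finite I" using finite_subset by blast
  \<comment> \<open>The cap at \<open>Max I\<close> makes the set under \<open>LEAST\<close>
    nonempty for every \<open>i\<close> and keeps \<open>p i\<close> admissible. Beyond the top
    level \<open>p\<close> is constant, so surplus dyadic blocks contribute nothing.\<close>
  define p where "p i = (LEAST N. real (min i (Max I)) \<le> s N)" for i
  have min_I: "min i (Max I) \<in> I" for i
  proof -
    have "Max I \<in> I" using finI I0 by (intro Max_in) auto
    then obtain N where "P N" "real (Max I) \<le> s N" unfolding I_def by blast
    then have "real (min i (Max I)) \<le> s N" by linarith
    with \<open>P N\<close> show ?thesis unfolding I_def by blast
  qed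
  have p_ex: "\<exists>N. P N \<and> real (min i (Max I)) \<le> s N" for i
    using min_I[of i] unfolding I_def by blast
  have p_ge: "real (min i (Max I)) \<le> s (p i)" for i
    unfolding p_def by (rule LeastI_ex) (use p_ex in blast)
  have p_P: "P (p i)" for i
    using p_ex[of i] P unfolding p_def by (metis Least_le)
  have p_mono: "p a \<le> p b" if "a \<le> b" for a b
  proof -
    have "real (min a (Max I)) \<le> real (min b (Max I))" using that by (simp add: min_def)
    also have "\<dots> \<le> s (p b)" by (rule p_ge)
    finally show ?thesis by (subst p_def) (rule Least_le)
  qed
  have p0: "p 0 = 0" unfolding p_def using s_nonneg by (intro Least_equality) auto
  have diff: "S b y - S a y = (\<Sum>j\<in>{a..<b}. c j * \<phi> j y)" if "a \<le> b" for a b y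
    unfolding S_def using that by (simp add: sum_diff_nat_ivl flip: atLeast0LessThan)
  have sdiff: "s b - s a = (\<Sum>j\<in>{a..<b}. (cmod (c j))\<^sup>2)" if "a \<le> b" for a b
    unfolding s_def using that by (simp add: sum_diff_nat_ivl flip: atLeast0LessThan)
  define D where "D l m y = (cmod (S (p ((m + 1) * 2 ^ l)) y - S (p (m * 2 ^ l)) y))\<^sup>2" for l m y
  have D: "integrable M (D l m)"
    "(LINT y|M. D l m y) = s (p ((m + 1) * 2 ^ l)) - s (p (m * 2 ^ l))" for l m
  proof -
    have le: "p (m * 2 ^ l) \<le> p ((m + 1) * 2 ^ l)" by (intro p_mono) simp
    show "integrable M (D l m)" "(LINT y|M. D l m y) = s (p ((m + 1) * 2 ^ l)) - s (p (m * 2 ^ l))"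
      unfolding D_def diff[OF le] sdiff[OF le]
      using cmod_squared_integral_orthonormal_sum[OF sq on, of "{p (m * 2 ^ l)..<p ((m + 1) * 2 ^ l)}" c]
      by simp_all
  qed
  define H where "H y = L * (\<Sum>l<L. \<Sum>m<2^L. D l m y)" for y
  have "integrable M H" unfolding H_def
    by (intro integrable_mult_right Bochner_Integration.integrable_sum D)
  moreover have "\<forall>y. 0 \<le> H y" unfolding H_def D_def by (auto intro!: mult_nonneg_nonneg sum_nonneg)
  moreover have "(LINT y|M. H y) \<le> (real L)\<^sup>2 * Q"
  proof -
    have "(LINT y|M. H y) = L * (\<Sum>l<L. \<Sum>m<2^L. s (p (Suc m * 2 ^ l)) - s (p (m * 2 ^ l)))"
      unfolding H_def using D
      by (simp add: Bochner_Integration.integral_sum Bochner_Integration.integrable_sum)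
    \<comment> \<open>For fixed \<open>l\<close> the sum over \<open>m\<close> telescopes. One
      factor \<open>L\<close> comes from the chaining, the other from the number of scales.\<close>
    also have "\<dots> = L * (\<Sum>l<L. s (p (2^L * 2 ^ l)) - s 0)"
      using sum_lessThan_telescope[of "\<lambda>m. s (p (m * 2 ^ l))" for l]
      by (simp add: p0)
    also have "\<dots> \<le> L * (\<Sum>l<L. Q)"
      using sP[OF p_P] by (intro mult_left_mono sum_mono) (auto simp: s_def)
    finally show ?thesis by (simp add: power2_eq_square)
  qed
  moreover have "(cmod (S N y))\<^sup>2 \<le> 2 * H y + 2 * (\<Sum>j<N. (cmod (\<phi> j y))\<^sup>2)" if N: "P N" for N y
  proof -
    define i where "i = nat \<lfloor>s N\<rfloor>"
    have i: "real i \<le> s N" "s N < real i + 1"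
      using s_nonneg[of N] unfolding i_def by linarith+
    have iI: "i \<in> I" using N i(1) unfolding I_def by blast
    then have min: "min i (Max I) = i" using finI by (simp add: min_absorb1)
    have "real i < 2 ^ L" using I_le[OF iI] Q by linarith
    then have iL: "i < 2 ^ L" by simp
    have "(cmod (S (p i) y - S (p 0) y))\<^sup>2 \<le> H y"
      unfolding H_def D_def using dyadic_chaining[OF iL, of "\<lambda>i. S (p i) y"] by simp
    then have 1: "(cmod (S (p i) y))\<^sup>2 \<le> H y" by (simp add: p0 S_def)
    have pN: "p i \<le> N" unfolding p_def min using i(1) by (rule Least_le)
    \<comment> \<open>Here \<open>i\<close> is the integer part of \<open>s N\<close>, and the mass
      at \<open>p i\<close> is already at least \<open>i\<close>.\<close>
    have "s N - s (p i) \<le> 1" using p_ge[of i] i unfolding min by linarith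
    have "(cmod (S N y - S (p i) y))\<^sup>2 \<le> (\<Sum>j\<in>{p i..<N}. cmod (c j) * cmod (\<phi> j y))\<^sup>2"
      unfolding diff[OF pN] by (intro power_mono order_trans[OF norm_sum]) (auto simp: norm_mult)
    also have "\<dots> \<le> (\<Sum>j\<in>{p i..<N}. (cmod (c j))\<^sup>2) * (\<Sum>j\<in>{p i..<N}. (cmod (\<phi> j y))\<^sup>2)"
      by (rule Cauchy_Schwarz_ineq_sum)
    also have "\<dots> \<le> 1 * (\<Sum>j<N. (cmod (\<phi> j y))\<^sup>2)"
      using \<open>s N - s (p i) \<le> 1\<close> unfolding sdiff[OF pN]
      by (intro mult_mono sum_mono2) (auto intro: sum_nonneg)
    finally have 2: "(cmod (S N y - S (p i) y))\<^sup>2 \<le> (\<Sum>j<N. (cmod (\<phi> j y))\<^sup>2)" by simp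
    show ?thesis using cmod_add_squared_le[of "S (p i) y" "S N y - S (p i) y"] 1 2 by simp
  qed
  ultimately show ?thesis by blast
qed

text \<open>Cauchy condensation turns the series into that of \<open>n powr -(1 + \<delta>)\<close>.
  Replacing \<open>k\<close> by \<open>max 2 k\<close> inside the logarithm makes the terms
  decreasing from the start; otherwise the term at \<open>k = 1\<close> would be \<open>0\<close>,
  by division by zero.\<close>

lemma summable_bertrand:
  fixes \<delta> :: real assumes "\<delta> > 0"
  shows "summable (\<lambda>k. 1 / (real k * ln (real k) powr (1 + \<delta>)))" (is "summable ?f")
proof -
  define f where "f k = 1 / (real k * ln (max 2 (real k)) powr (1 + \<delta>))" for k :: nat
  have "summable (\<lambda>n. 2^n * f (2^n))"
  proof (rule summable_cong[THEN iffD2])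
    show "\<forall>\<^sub>F n in sequentially. 2^n * f (2^n) = ln 2 powr (-(1 + \<delta>)) * real n powr (-(1 + \<delta>))"
      using eventually_ge_at_top[of 1]
    proof eventually_elim
      case (elim n)
      then have "max 2 ((2::real) ^ n) = 2 ^ n"
        using power_increasing[of 1 n "2::real"] by simp
      then show ?case
        unfolding f_def powr_minus by (simp add: ln_realpow powr_mult field_simps)
    qed
    show "summable (\<lambda>n. ln 2 powr (-(1 + \<delta>)) * real n powr (-(1 + \<delta>)))"
      using assms by (intro summable_mult) (subst summable_real_powr_iff, simp)
  qed
  moreover have "summable f \<longleftrightarrow> summable (\<lambda>n. 2^n * f (2^n))"
  proof (rule condensation_test)
    fix m :: nat assume m: "0 < m"
    have "ln (max 2 (real m)) \<le> ln (max 2 (real (Suc m)))" by (subst ln_le_cancel_iff) auto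
    then have "ln (max 2 (real m)) powr (1 + \<delta>) \<le> ln (max 2 (real (Suc m))) powr (1 + \<delta>)"
      using assms by (intro powr_mono2) auto
    moreover have "0 < ln (max 2 (real m))" by simp
    ultimately show "f (Suc m) \<le> f m"
      unfolding f_def using m by (intro divide_left_mono mult_mono mult_pos_pos) auto
  qed (simp add: f_def)
  ultimately have "summable f" by simp
  moreover have "\<forall>\<^sub>F k in sequentially. ?f k = f k"
    using eventually_ge_at_top[of 2] by eventually_elim (simp add: f_def max_def)
  ultimately show ?thesis by (simp add: summable_cong)
qed

text \<open>The functions \<open>H k\<close> divided by the weights have integrals that are summable
  in \<open>k\<close>, so their sum is finite almost everywhere and each \<open>H k y\<close> is at
  most a constant, depending on \<open>y\<close>, times its weight. Taking the weights for the
  countably many \<open>\<delta> = 1 / Suc m\<close> gives one null set for all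
  \<open>\<epsilon>\<close>. A general \<open>\<Lambda>\<close> is compared with the next power of
  two.\<close>

lemma orthonormal_sums_ae_bound:
  fixes c :: "nat \<Rightarrow> complex" and \<phi> :: "nat \<Rightarrow> 'a \<Rightarrow> complex" and \<nu> :: "nat \<Rightarrow> real"
  assumes sq: "\<And>j. square_integrable M (\<phi> j)"
    and on: "\<And>i j. L2_inner M (\<phi> i) (\<phi> j) = (if i = j then 1 else 0)"
    and d: "0 \<le> d"
    and cb: "\<And>\<Lambda> J. 1 \<le> \<Lambda> \<Longrightarrow> finite J \<Longrightarrow> J \<subseteq> {j. \<nu> j < \<Lambda>} \<Longrightarrow> (\<Sum>j\<in>J. (cmod (c j))\<^sup>2) \<le> A * \<Lambda> powr d"
    and pb: "\<And>y. \<exists>C. \<forall>\<Lambda> J. 1 \<le> \<Lambda> \<longrightarrow> finite J \<longrightarrow> J \<subseteq> {j. \<nu> j < \<Lambda>} \<longrightarrow> (\<Sum>j\<in>J. (cmod (\<phi> j y))\<^sup>2) \<le> C * \<Lambda> powr d"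
  shows "AE y in M. \<forall>\<epsilon>>0. \<exists>C>0. \<exists>\<Lambda>0. \<forall>\<Lambda>\<ge>\<Lambda>0. \<forall>N. (\<forall>j<N. \<nu> j < \<Lambda>) \<longrightarrow>
     cmod (\<Sum>j<N. c j * \<phi> j y) \<le> C * \<Lambda> powr (d / 2) * (ln \<Lambda>) powr (3/2) * (ln (ln \<Lambda>)) powr (1/2 + \<epsilon>)"
proof -
  define A' where "A' = max A 1"
  have A': "1 \<le> A'" "A \<le> A'" by (auto simp: A'_def)
  define B where "B = log 2 A' + d + 2"
  have "0 \<le> log 2 A'" using A' by simp
  \<comment> \<open>The number of dyadic scales: large enough for \<open>A' * W k < 2 ^ L k\<close>,
    yet linear in \<open>k\<close>.\<close>
  define L where "L k = nat \<lceil>log 2 A' + k * d\<rceil> + 1" for k :: nat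
  define W where "W k = 2 powr (k * d)" for k :: nat
  have LB: "real (L k) \<le> B * k" if "1 \<le> k" for k
  proof -
    have "0 \<le> log 2 A' + k * d" using d \<open>0 \<le> log 2 A'\<close> by simp
    then have "real (L k) \<le> log 2 A' + k * d + 2" unfolding L_def by linarith
    also have "\<dots> \<le> log 2 A' * k + k * d + 2 * k"
      using that \<open>0 \<le> log 2 A'\<close> mult_left_mono[of 1 "real k" "log 2 A'"] by simp
    finally show ?thesis by (simp add: B_def algebra_simps)
  qed
  have W_eq: "W k = (2 ^ k) powr d" for k
    unfolding W_def by (simp add: powr_powr flip: powr_realpow)
  have W0: "0 < W k" for k by (simp add: W_def)
  define P where "P k N \<longleftrightarrow> (\<forall>j<N. \<nu> j < 2 ^ k)" for k N :: nat
  define good where "good k H \<longleftrightarrow> integrable M H \<and> (\<forall>y. 0 \<le> H y) \<and> (LINT y|M. H y) \<le> (real (L k))\<^sup>2 * (A' * W k) \<and>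
    (\<forall>N y. P k N \<longrightarrow> (cmod (\<Sum>j<N. c j * \<phi> j y))\<^sup>2 \<le> 2 * H y + 2 * (\<Sum>j<N. (cmod (\<phi> j y))\<^sup>2))" for k H
  have "\<exists>H. good k H" for k unfolding good_def
  proof (rule rademacher_menshov_by_mass[OF sq on])
    show "P k m" if "P k N" "m \<le> N" for m N using that by (auto simp: P_def)
    show "(\<Sum>j<N. (cmod (c j))\<^sup>2) \<le> A' * W k" if "P k N" for N
    proof -
      have "(\<Sum>j<N. (cmod (c j))\<^sup>2) \<le> A * (2 ^ k) powr d"
        using that by (intro cb) (auto simp: P_def)
      also have "\<dots> \<le> A' * W k" unfolding W_eq using A' by (intro mult_right_mono) auto
      finally show ?thesis .
    qed
    have "A' * W k = 2 powr (log 2 A' + k * d)" using A' by (simp add: W_def powr_add)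
    also have "\<dots> < 2 powr (real (L k))"
      unfolding L_def by (intro powr_less_mono) linarith+
    finally show "A' * W k < 2 ^ L k" by (simp add: powr_realpow)
    show "0 \<le> A' * W k" using A' W0[of k] by simp
  qed
  then obtain H' where "\<And>k. good k (H' k)" by metis
  then obtain H where H: "\<And>k. integrable M (H k)" "\<And>k y. 0 \<le> H k y"
    "\<And>k. (LINT y|M. H k y) \<le> (real (L k))\<^sup>2 * (A' * W k)"
    "\<And>k N y. P k N \<Longrightarrow> (cmod (\<Sum>j<N. c j * \<phi> j y))\<^sup>2 \<le> 2 * H k y + 2 * (\<Sum>j<N. (cmod (\<phi> j y))\<^sup>2)"
    unfolding good_def by blast
  have ae: "AE y in M. \<exists>K. \<forall>k\<ge>2. H k y \<le> K * (W k * real k ^ 3 * ln k powr (1 + \<delta>))" if \<delta>: "\<delta> > 0" for \<delta>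
  proof -
    define w where "w k = W k * real k ^ 3 * ln k powr (1 + \<delta>)" for k :: nat
    have w0: "0 < w k" if "2 \<le> k" for k using that W0 by (simp add: w_def)
    have w_nn: "0 \<le> w k" for k using W0[of k] by (simp add: w_def)
    have Hm [measurable]: "H k \<in> borel_measurable M" for k using H(1) by blast
    have I: "(\<integral>\<^sup>+ y. ennreal (H k y / w k) \<partial>M) \<le> ennreal (B\<^sup>2 * A' * (1 / (real k * ln (real k) powr (1 + \<delta>))))" for k
    proof (cases "2 \<le> k")
      case False
      \<comment> \<open>For these \<open>k\<close> the weight is \<open>0\<close>, since
        \<open>0 ^ 3 = 0\<close> and \<open>ln 1 = 0\<close>, and the quotient is \<open>0\<close>
        by convention.\<close>
      then have "k = 0 \<or> k = 1" by linarith
      then have "w k = 0" by (auto simp: w_def)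
      then show ?thesis by simp
    next
      case True
      have "(\<integral>\<^sup>+ y. ennreal (H k y / w k) \<partial>M) = ennreal (LINT y|M. H k y / w k)"
        using H w_nn by (intro nn_integral_eq_integral) auto
      also have "(LINT y|M. H k y / w k) = (LINT y|M. H k y) / w k" by simp
      also have "\<dots> \<le> (B * k)\<^sup>2 * (A' * W k) / w k"
        using LB[of k] True A' W0[of k] w_nn[of k]
        by (intro divide_right_mono order_trans[OF H(3)] mult_right_mono power_mono) auto
      also have "\<dots> = B\<^sup>2 * A' * (1 / (real k * ln (real k) powr (1 + \<delta>)))"
        using True W0[of k] by (simp add: w_def field_simps power2_eq_square power3_eq_cube)
      finally show ?thesis by (auto intro: ennreal_leI)
    qed
    have sm: "summable (\<lambda>k. B\<^sup>2 * A' * (1 / (real k * ln (real k) powr (1 + \<delta>))))"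
      by (intro summable_mult summable_bertrand \<delta>)
    have "(\<integral>\<^sup>+ y. (\<Sum>k. ennreal (H k y / w k)) \<partial>M) = (\<Sum>k. \<integral>\<^sup>+ y. ennreal (H k y / w k) \<partial>M)"
      by (intro nn_integral_suminf) measurable
    also have "\<dots> \<le> (\<Sum>k. ennreal (B\<^sup>2 * A' * (1 / (real k * ln (real k) powr (1 + \<delta>)))))"
      by (intro suminf_le I) auto
    also have "\<dots> < \<infinity>"
      using sm A' by (subst suminf_ennreal2) auto
    finally have "AE y in M. (\<Sum>k. ennreal (H k y / w k)) \<noteq> \<infinity>"
      by (intro nn_integral_PInf_AE) auto
    then show ?thesis
    proof eventually_elim
      case (elim y)
      then obtain K where K: "(\<Sum>k. ennreal (H k y / w k)) = ennreal K" "0 \<le> K"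
        by (cases "\<Sum>k. ennreal (H k y / w k)") auto
      have "H k y \<le> K * w k" if "2 \<le> k" for k
      proof -
        have "ennreal (H k y / w k) \<le> ennreal K"
          using sum_le_suminf[of "\<lambda>k. ennreal (H k y / w k)" "{k}"] K(1) by simp
        then have "H k y / w k \<le> K" using K(2) by simp
        then show ?thesis using w0[OF that] by (simp add: field_simps)
      qed
      then have "\<forall>k\<ge>2. H k y \<le> K * w k" by simp
      then show ?case unfolding w_def by (rule exI)
    qed
  qed
  have "AE y in M. \<forall>m::nat. \<exists>K. \<forall>k\<ge>2. H k y \<le> K * (W k * real k ^ 3 * ln k powr (1 + 1 / Suc m))"
    unfolding AE_all_countable by (intro allI ae) simp
  then show ?thesis
  proof (rule AE_mp, intro AE_I2 impI allI)
    fix y and \<epsilon> :: real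
    assume *: "\<forall>m::nat. \<exists>K. \<forall>k\<ge>2. H k y \<le> K * (W k * real k ^ 3 * ln k powr (1 + 1 / Suc m))" and \<epsilon>: "0 < \<epsilon>"
    \<comment> \<open>The square root halves the exponent \<open>1 + \<delta>\<close>, so
      \<open>\<delta> < 2 * \<epsilon>\<close> is what \<open>1/2 + \<epsilon>\<close>
      requires.\<close>
    obtain m :: nat where m: "1 / Suc m < 2 * \<epsilon>"
      using reals_Archimedean[of "2 * \<epsilon>"] \<epsilon> by (auto simp: inverse_eq_divide)
    define \<delta> :: real where "\<delta> = 1 / Suc m"
    have \<delta>: "0 < \<delta>" "\<delta> \<le> 1" "\<delta> < 2 * \<epsilon>" using m by (auto simp: \<delta>_def)
    obtain K0 where K0: "\<And>k. 2 \<le> k \<Longrightarrow> H k y \<le> K0 * (W k * real k ^ 3 * ln k powr (1 + \<delta>))"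
      using * unfolding \<delta>_def by blast
    define K where "K = max K0 0"
    have K: "0 \<le> K" "H k y \<le> K * (W k * real k ^ 3 * ln k powr (1 + \<delta>))" if "2 \<le> k" for k
    proof -
      show "0 \<le> K" by (simp add: K_def)
      have "K0 * (W k * real k ^ 3 * ln k powr (1 + \<delta>)) \<le> K * (W k * real k ^ 3 * ln k powr (1 + \<delta>))"
        using W0[of k] by (intro mult_right_mono) (auto simp: K_def)
      then show "H k y \<le> K * (W k * real k ^ 3 * ln k powr (1 + \<delta>))" using K0[OF that] by linarith
    qed
    obtain Y0 where Y0: "\<And>\<Lambda> J. 1 \<le> \<Lambda> \<Longrightarrow> finite J \<Longrightarrow> J \<subseteq> {j. \<nu> j < \<Lambda>} \<Longrightarrow>
        (\<Sum>j\<in>J. (cmod (\<phi> j y))\<^sup>2) \<le> Y0 * \<Lambda> powr d" using pb[of y] by blast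
    define Y where "Y = max Y0 0"
    \<comment> \<open>With \<open>k\<close> the rounded-up binary logarithm of
      \<open>\<Lambda>\<close>: \<open>27\<close> comes from \<open>k \<le> 3 ln \<Lambda>\<close>
      cubed, \<open>9\<close> from \<open>ln k \<le> 3 ln (ln \<Lambda>)\<close> with exponent at
      most \<open>2\<close>, and \<open>2 powr d\<close> from
      \<open>2 ^ k \<le> 2 * \<Lambda>\<close>.\<close>
    define C where "C = (2 * K * 27 * 9 + 2 * Y) * 2 powr d"
    have C0: "0 \<le> C" unfolding C_def Y_def K_def by (intro mult_nonneg_nonneg add_nonneg_nonneg) auto
    have main: "cmod (\<Sum>j<N. c j * \<phi> j y) \<le> (sqrt C + 1) * \<Lambda> powr (d / 2) * (ln \<Lambda>) powr (3/2) * (ln (ln \<Lambda>)) powr (1/2 + \<epsilon>)"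
      \<comment> \<open>This threshold makes \<open>ln (ln \<Lambda>)\<close> at least
        \<open>1\<close>, so the logarithmic factors only enlarge a bound and their powers increase
        with the exponent.\<close>
      if \<Lambda>: "exp (exp 1) \<le> \<Lambda>" and N: "\<forall>j<N. \<nu> j < \<Lambda>" for \<Lambda> N
    proof -
      have "0 < \<Lambda>" using \<Lambda> exp_gt_zero[of "exp (1::real)"] by linarith
      define l where "l = ln \<Lambda>"
      define ll where "ll = ln l"
      have l: "exp 1 \<le> l" using \<Lambda> \<open>0 < \<Lambda>\<close> by (simp add: l_def ln_ge_iff)
      then have "2 \<le> l" using exp_ge_add_one_self[of 1] by linarith
      then have ll: "1 \<le> ll" using l by (simp add: ll_def ln_ge_iff)
      define k where "k = nat \<lceil>log 2 \<Lambda>\<rceil>"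
      have l2: "2/3 \<le> ln (2::real)" "ln (2::real) \<le> 1" using ln2_ge_two_thirds ln_2_less_1 by auto
      have log: "log 2 \<Lambda> = l / ln 2" by (simp add: log_def l_def)
      have log2: "2 \<le> log 2 \<Lambda>" "log 2 \<Lambda> \<le> 3/2 * l"
      proof -
        have "2 * ln 2 \<le> l" using \<open>2 \<le> l\<close> l2 by linarith
        then show "2 \<le> log 2 \<Lambda>" unfolding log using l2 by (simp add: field_simps)
        have "2/3 * l \<le> ln 2 * l" using l2 \<open>2 \<le> l\<close> by (intro mult_right_mono) auto
        then show "log 2 \<Lambda> \<le> 3/2 * l" unfolding log using l2 by (simp add: field_simps)
      qed
      have k: "log 2 \<Lambda> \<le> k" "k \<le> log 2 \<Lambda> + 1" using log2 unfolding k_def by linarith+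
      have "2 \<le> k" using k log2 by linarith
      have k3: "k \<le> 3 * l" using k log2 \<open>2 \<le> l\<close> by linarith
      have "\<Lambda> = 2 powr (log 2 \<Lambda>)" using \<open>0 < \<Lambda>\<close> by simp
      also have "\<dots> \<le> 2 powr k" using k by (intro powr_mono) auto
      finally have \<Lambda>k: "\<Lambda> \<le> 2 ^ k" by (simp add: powr_realpow)
      have "2 ^ k = 2 powr (real k)" by (simp add: powr_realpow)
      also have "\<dots> \<le> 2 powr (log 2 \<Lambda> + 1)" using k by (intro powr_mono) auto
      also have "\<dots> = 2 * \<Lambda>" using \<open>0 < \<Lambda>\<close> by (simp add: powr_add)
      finally have k\<Lambda>: "2 ^ k \<le> 2 * \<Lambda>" .
      have Wk: "W k \<le> 2 powr d * \<Lambda> powr d"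
        unfolding W_eq using k\<Lambda> d \<open>0 < \<Lambda>\<close> powr_mono2[of d "2 ^ k" "2 * \<Lambda>"]
        by (simp add: powr_mult)
      have "ln k \<le> ln (3 * l)" using k3 \<open>2 \<le> k\<close> \<open>2 \<le> l\<close> by (subst ln_le_cancel_iff) auto
      also have "\<dots> = ln 3 + ll" using \<open>2 \<le> l\<close> by (simp add: ln_mult ll_def)
      also have "\<dots> \<le> 3 * ll" using ll ln_le_minus_one[of 3] by simp
      finally have lnk: "ln k \<le> 3 * ll" .
      have "ln k powr (1 + \<delta>) \<le> (3 * ll) powr (1 + \<delta>)"
        using lnk \<open>2 \<le> k\<close> \<delta> by (intro powr_mono2) auto
      also have "\<dots> = 3 powr (1 + \<delta>) * ll powr (1 + \<delta>)" using ll by (simp add: powr_mult)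
      also have "\<dots> \<le> 3 powr 2 * ll powr (1 + 2 * \<epsilon>)"
        using \<delta> ll by (intro mult_mono powr_mono) auto
      finally have lnk': "ln k powr (1 + \<delta>) \<le> 9 * ll powr (1 + 2 * \<epsilon>)" by simp
      have "real k ^ 3 \<le> (3 * l) ^ 3" using k3 by (intro power_mono) auto
      then have k3': "real k ^ 3 \<le> 27 * l ^ 3" by (simp add: power_mult_distrib)
      have PN: "P k N" using N \<Lambda>k unfolding P_def by force
      have "(\<Sum>j<N. (cmod (\<phi> j y))\<^sup>2) \<le> Y0 * (2 ^ k) powr d"
        using PN by (intro Y0) (auto simp: P_def)
      also have "\<dots> \<le> Y * W k" unfolding W_eq by (intro mult_right_mono) (auto simp: Y_def)
      also have "\<dots> \<le> Y * (2 powr d * \<Lambda> powr d)" by (intro mult_left_mono Wk) (auto simp: Y_def)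
      also have "\<dots> \<le> Y * (2 powr d * \<Lambda> powr d) * (l ^ 3 * ll powr (1 + 2 * \<epsilon>))"
      proof -
        have "1 * 1 \<le> l ^ 3 * ll powr (1 + 2 * \<epsilon>)"
          using \<open>2 \<le> l\<close> ll \<epsilon> by (intro mult_mono one_le_power ge_one_powr_ge_zero) auto
        then show ?thesis using mult_left_mono[of 1 "l ^ 3 * ll powr (1 + 2 * \<epsilon>)" "Y * (2 powr d * \<Lambda> powr d)"]
          by (simp add: Y_def)
      qed
      finally have Y: "(\<Sum>j<N. (cmod (\<phi> j y))\<^sup>2) \<le> Y * (2 powr d * \<Lambda> powr d) * (l ^ 3 * ll powr (1 + 2 * \<epsilon>))" .
      have "H k y \<le> K * (W k * real k ^ 3 * ln k powr (1 + \<delta>))" using K \<open>2 \<le> k\<close> by blast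
      also have "\<dots> \<le> K * ((2 powr d * \<Lambda> powr d) * (27 * l ^ 3) * (9 * ll powr (1 + 2 * \<epsilon>)))"
        using W0[of k] \<open>2 \<le> l\<close> K(1)[OF \<open>2 \<le> k\<close>]
        by (intro mult_left_mono mult_mono Wk k3' lnk') auto
      finally have "(cmod (\<Sum>j<N. c j * \<phi> j y))\<^sup>2 \<le> C * \<Lambda> powr d * l ^ 3 * ll powr (1 + 2 * \<epsilon>)"
        using H(4)[OF PN, of y] Y unfolding C_def by (simp add: algebra_simps)
      then have "cmod (\<Sum>j<N. c j * \<phi> j y) \<le> sqrt (C * \<Lambda> powr d * l ^ 3 * ll powr (1 + 2 * \<epsilon>))"
        by (rule real_le_rsqrt)
      also have "\<dots> = sqrt C * \<Lambda> powr (d / 2) * l powr (3/2) * ll powr (1/2 + \<epsilon>)"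
      proof -
        have "l ^ 3 = l powr 3" using \<open>2 \<le> l\<close> by simp
        moreover have "1/2 + \<epsilon> = (1 + 2 * \<epsilon>) / 2" by (simp add: field_simps)
        ultimately show ?thesis
          using \<open>2 \<le> l\<close> ll \<open>0 < \<Lambda>\<close> by (simp only: real_sqrt_mult powr_half_sqrt_powr)
      qed
      also have "\<dots> \<le> (sqrt C + 1) * \<Lambda> powr (d / 2) * l powr (3/2) * ll powr (1/2 + \<epsilon>)"
        by (intro mult_right_mono) auto
      finally show ?thesis by (simp add: l_def ll_def)
    qed
    show "\<exists>C>0. \<exists>\<Lambda>0. \<forall>\<Lambda>\<ge>\<Lambda>0. \<forall>N. (\<forall>j<N. \<nu> j < \<Lambda>) \<longrightarrow>
     cmod (\<Sum>j<N. c j * \<phi> j y) \<le> C * \<Lambda> powr (d / 2) * (ln \<Lambda>) powr (3/2) * (ln (ln \<Lambda>)) powr (1/2 + \<epsilon>)"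
      using main C0 by (intro exI[of _ "sqrt C + 1"] conjI exI[of _ "exp (exp 1)"]) (auto intro: add_nonneg_pos)
  qed
qed

section \<open>A mean value inequality for divergence form equations\<close>

text \<open>By translation invariance the difference quotients of \<open>f\<close> have integral
  \<open>0\<close>, and they converge to \<open>f'\<close> under a common integrable bound. Only the
  derivative along the one direction \<open>b\<close> has to exist.\<close>

lemma integral_directional_derivative_eq_0:
  fixes f f' :: "'a::euclidean_space \<Rightarrow> real"
  assumes cf: "continuous_on UNIV f" and cf': "continuous_on UNIV f'"
    and der: "\<And>x. ((\<lambda>s. f (x + s *\<^sub>R b)) has_real_derivative f' x) (at 0)"
    and K: "compact K" "\<And>x. x \<notin> K \<Longrightarrow> f x = 0" "\<And>x. x \<notin> K \<Longrightarrow> f' x = 0"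
  shows "integrable lborel f'" "integral\<^sup>L lborel f' = 0"
proof -
  have der_s: "((\<lambda>s. f (x + s *\<^sub>R b)) has_real_derivative f' (x + s *\<^sub>R b)) (at s)" for x s
    using der[of "x + s *\<^sub>R b"] DERIV_shift[of "\<lambda>s. f (x + s *\<^sub>R b)" "f' (x + s *\<^sub>R b)" 0 s]
    by (simp add: algebra_simps)
  obtain B where B: "\<And>x. x \<in> K \<Longrightarrow> \<bar>f' x\<bar> \<le> B"
    using compact_imp_bounded[OF compact_continuous_image[OF continuous_on_subset[OF cf'] K(1)]]
    unfolding bounded_iff by auto
  define B' where "B' = max B 0"
  have B': "\<bar>f' x\<bar> \<le> B'" for x using B[of x] K(3)[of x] by (cases "x \<in> K") (auto simp: B'_def)
  obtain r where r: "\<And>x. x \<in> K \<Longrightarrow> norm x \<le> r"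
    using compact_imp_bounded[OF K(1)] unfolding bounded_iff by auto
  define h where "h n = 1 / real (Suc n)" for n
  have h: "0 < h n" "h n \<le> 1" for n by (auto simp: h_def)
  define D where "D n x = (f (x + h n *\<^sub>R b) - f x) / h n" for n x
  have intK: "integrable lborel u" if "continuous_on UNIV u" "\<And>x. x \<notin> K \<Longrightarrow> u x = 0" for u :: "'a \<Rightarrow> real"
  proof -
    have "integrable lborel (\<lambda>x. indicator K x *\<^sub>R u x)"
      using continuous_on_subset[OF that(1)] K(1) by (intro borel_integrable_compact) auto
    also have "(\<lambda>x. indicator K x *\<^sub>R u x) = u" using that(2) by (auto simp: indicator_def fun_eq_iff)
    finally show ?thesis .
  qed
  have fi: "integrable lborel f" by (rule intK[OF cf K(2)])
  show "integrable lborel f'" by (rule intK[OF cf' K(3)])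
  have bm: "(\<lambda>x. c + x) \<in> lborel \<rightarrow>\<^sub>M borel" for c :: 'a by simp
  have trans: "integrable lborel (\<lambda>x. f (x + c))" "(LINT x|lborel. f (x + c)) = (LINT x|lborel. f x)" for c
  proof -
    have fm: "f \<in> borel_measurable borel" using cf by (rule borel_measurable_continuous_onI)
    have "integrable (distr lborel borel ((+) c)) f" using fi by (simp add: lborel_distr_plus)
    then show "integrable lborel (\<lambda>x. f (x + c))"
      using integrable_distr_eq[OF bm fm, of c] by (simp add: add.commute)
    show "(LINT x|lborel. f (x + c)) = (LINT x|lborel. f x)"
      using integral_distr[OF bm fm, of c] unfolding lborel_distr_plus by (simp add: add.commute)
  qed
  have D0: "(LINT x|lborel. D n x) = 0" for n
    unfolding D_def by (simp add: trans fi)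
  have lim: "(\<lambda>n. D n x) \<longlonglongrightarrow> f' x" for x
  proof -
    have "((\<lambda>s. (f (x + s *\<^sub>R b) - f x) / s) \<longlongrightarrow> f' x) (at 0)"
      using der[of x] unfolding DERIV_def by simp
    moreover have "filterlim h (at 0) sequentially"
      unfolding h_def filterlim_at using LIMSEQ_inverse_real_of_nat by (auto simp: inverse_eq_divide)
    ultimately show ?thesis unfolding D_def by (rule filterlim_compose)
  qed
  \<comment> \<open>By the mean value theorem a difference quotient is a value of \<open>f'\<close>
    at a point no further away than \<open>norm b\<close>, because \<open>h n \<le> 1\<close>; this
    also locates its support.\<close>
  have bound: "norm (D n x) \<le> indicator (cball 0 (r + norm b)) x *\<^sub>R B'" for n x
  proof -
    obtain s where s: "0 < s" "s < h n" "f (x + h n *\<^sub>R b) - f (x + 0 *\<^sub>R b) = (h n - 0) * f' (x + s *\<^sub>R b)"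
      using MVT2[of 0 "h n" "\<lambda>s. f (x + s *\<^sub>R b)" "\<lambda>s. f' (x + s *\<^sub>R b)"] h der_s by blast
    then have D: "D n x = f' (x + s *\<^sub>R b)" using h[of n] by (simp add: D_def)
    show ?thesis
    proof (cases "x + s *\<^sub>R b \<in> K")
      case True
      have "norm x \<le> norm (x + s *\<^sub>R b) + norm (s *\<^sub>R b)"
        using norm_triangle_ineq4[of "x + s *\<^sub>R b" "s *\<^sub>R b"] by simp
      also have "s * norm b \<le> 1 * norm b" using s h[of n] by (intro mult_right_mono) auto
      then have "norm (x + s *\<^sub>R b) + norm (s *\<^sub>R b) \<le> r + norm b"
        using r[OF True] s by simp
      finally show ?thesis using B' by (simp add: D)
    next
      case False
      then show ?thesis using K(3) by (simp add: D B'_def)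
    qed
  qed
  have dom: "integrable lborel (\<lambda>x. indicator (cball 0 (r + norm b)) x *\<^sub>R B' :: real)"
    by (intro borel_integrable_compact) auto
  have "(\<lambda>n. LINT x|lborel. D n x) \<longlonglongrightarrow> integral\<^sup>L lborel f'"
  proof (rule integral_dominated_convergence[OF _ _ dom])
    show "f' \<in> borel_measurable lborel" using cf' by (simp add: borel_measurable_continuous_onI)
    show "D n \<in> borel_measurable lborel" for n unfolding D_def
      using trans(1) fi by (intro borel_measurable_divide borel_measurable_diff borel_measurable_integrable) auto
  qed (use lim bound in auto)
  then show "integral\<^sup>L lborel f' = 0" unfolding D0 using LIMSEQ_unique tendsto_const by blast
qed

text \<open>The function is the integral of \<open>h\<close> from \<open>x\<close> to
  \<open>b\<close>. An antiderivative is taken up to \<open>b + 1\<close> so that \<open>b\<close>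
  is an interior point of the interval.\<close>

lemma antiderivative_vanishing_above:
  fixes h :: "real \<Rightarrow> real"
  assumes "a < b" and h: "continuous_on {a..} h" "\<And>x. a \<le> x \<Longrightarrow> 0 \<le> h x" "\<And>x. b \<le> x \<Longrightarrow> h x = 0"
  shows "\<exists>F. (\<forall>x>a. (F has_real_derivative - h x) (at x)) \<and> (\<forall>x>a. 0 \<le> F x) \<and> (\<forall>x\<ge>b. F x = 0)"
proof -
  have "continuous_on {a..b+1} h" using h(1) by (rule continuous_on_subset) auto
  then obtain G where "\<And>x. x \<in> {a..b+1} \<Longrightarrow> (G has_vector_derivative h x) (at x within {a..b+1})"
    using antiderivative_continuous by metis
  then have G: "(G has_real_derivative h x) (at x within {a..b+1})" if "x \<in> {a..b+1}" for x
    using that by (simp add: has_real_derivative_iff_has_vector_derivative)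
  have G_at: "(G has_real_derivative h x) (at x)" if "a < x" "x < b + 1" for x
    using G[of x] that at_within_interior[of x "{a..b+1}"] by auto
  have G_mono: "G x \<le> G y" if "a < x" "x \<le> y" "y < b + 1" for x y
    using that(2)
  proof (rule DERIV_nonneg_imp_nondecreasing)
    fix u assume "x \<le> u" "u \<le> y"
    then show "\<exists>y. DERIV G u :> y \<and> 0 \<le> y" using G_at[of u] h(2)[of u] that by auto
  qed
  have G_const: "G x = G b" if "b \<le> x" "x < b + 1" for x
  proof (cases "x = b")
    case False
    have "continuous_on {b..x} G"
    proof (rule DERIV_atLeastAtMost_imp_continuous_on)
      fix u assume "b \<le> u" "u \<le> x"
      then show "\<exists>y. DERIV G u :> y" using G_at[of u] that \<open>a < b\<close> by auto
    qed
    moreover have "DERIV G u :> 0" if "b < u" "u < x" for u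
      using G_at[of u] h(3)[of u] that \<open>x < b + 1\<close> \<open>a < b\<close> by simp
    ultimately show ?thesis using False that DERIV_isconst_end[of b x G] by simp
  qed simp
  define F where "F x = (if x \<le> b then G b - G x else 0)" for x
  show ?thesis
  proof (intro exI[of _ F] conjI allI impI)
    show "F x = 0" if "b \<le> x" for x using that by (auto simp: F_def)
    show "0 \<le> F x" if "a < x" for x using G_mono[of x b] that by (auto simp: F_def)
    show "(F has_real_derivative - h x) (at x)" if "a < x" for x
    proof (cases "x < b + 1/2")
      case True
      have "((\<lambda>x. G b - G x) has_real_derivative - h x) (at x)"
        using G_at[of x] that True by (auto intro!: derivative_eq_intros)
      moreover have "open {..<b + 1}" "x \<in> {..<b + 1}" using True by auto
      moreover have "G b - G y = F y" if "y \<in> {..<b + 1}" for y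
        using G_const[of y] that by (cases "y \<le> b") (simp_all add: F_def)
      ultimately show ?thesis by (rule has_field_derivative_transform_within_open)
    next
      case False
      have "((\<lambda>_. 0) has_real_derivative - h x) (at x)" using h(3)[of x] False by simp
      moreover have "open {b<..}" by simp
      ultimately show ?thesis
        by (rule has_field_derivative_transform_within_open) (use False in \<open>auto simp: F_def\<close>)
    qed
  qed
qed

section \<open>Cutoff functions and the radial weight\<close>

lemma has_real_derivative_pos_part_squared:
  fixes x :: real
  shows "((\<lambda>x. (max 0 x)\<^sup>2) has_real_derivative 2 * max 0 x) (at x)"
proof -
  consider "x < 0" | "x > 0" | "x = 0" by linarith
  then show ?thesis
  proof cases
    case 1
    have "((\<lambda>_. 0) has_real_derivative 2 * max 0 x) (at x)" using 1 by simp
    moreover have "open {..<0::real}" by simp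
    ultimately show ?thesis
      by (rule has_field_derivative_transform_within_open) (use 1 in auto)
  next
    case 2
    have "((\<lambda>x. x\<^sup>2) has_real_derivative 2 * max 0 x) (at x)"
      using 2 by (auto intro!: derivative_eq_intros)
    moreover have "open {0::real<..}" by simp
    ultimately show ?thesis
      by (rule has_field_derivative_transform_within_open) (use 2 in auto)
  next
    case 3
    have "((\<lambda>h. (max 0 h)\<^sup>2 / h) \<longlongrightarrow> (0::real)) (at 0)"
    proof (rule Lim_null_comparison)
      show "\<forall>\<^sub>F h in at (0::real). norm ((max 0 h)\<^sup>2 / h) \<le> (\<bar>h\<bar>)"
        by (intro always_eventually allI) (auto simp: max_def power2_eq_square)
      show "((\<lambda>h. (\<bar>h\<bar>)) \<longlongrightarrow> (0::real)) (at 0)" using tendsto_rabs[OF tendsto_ident_at, of 0] by simp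
    qed
    then show ?thesis using 3 by (simp add: DERIV_def)
  qed
qed

text \<open>The argument stands for a squared distance, whence the scale \<open>R\<^sup>2\<close>.
  One continuous derivative is enough, so the squared positive part \<open>p\<close> can play the
  role of a bump function: \<open>p (1 - p s)\<close> with \<open>s = 2 * x / R\<^sup>2 - 1\<close>
  falls from \<open>1\<close> to \<open>0\<close> as \<open>s\<close> runs from \<open>0\<close> to
  \<open>1\<close>. The chain rule gives \<open>8 = 2 * 2 * 2\<close>.\<close>

lemma cutoff_exists:
  fixes R :: real
  assumes "0 < R"
  obtains \<zeta> \<zeta>' where "\<And>x. (\<zeta> has_real_derivative \<zeta>' x) (at x)" "continuous_on UNIV \<zeta>'"
    "\<And>x. 0 \<le> \<zeta> x" "\<And>x. x \<le> R\<^sup>2 / 2 \<Longrightarrow> \<zeta> x = 1 \<and> \<zeta>' x = 0" "\<And>x. R\<^sup>2 \<le> x \<Longrightarrow> \<zeta> x = 0 \<and> \<zeta>' x = 0"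
    "\<And>x. x \<le> R\<^sup>2 \<Longrightarrow> \<bar>\<zeta>' x\<bar> \<le> 8 / R\<^sup>2"
proof -
  define p :: "real \<Rightarrow> real" where "p = (\<lambda>x. (max 0 x)\<^sup>2)"
  have p': "(p has_real_derivative 2 * max 0 x) (at x)" for x
    unfolding p_def by (rule has_real_derivative_pos_part_squared)
  have p'': "((\<lambda>x. p (u x)) has_real_derivative 2 * max 0 (u x) * u') (at x)"
    if "(u has_real_derivative u') (at x)" for u u' x
    by (rule DERIV_chain2[OF p' that])
  define \<zeta> where "\<zeta> x = p (1 - p (2 * x / R\<^sup>2 - 1))" for x
  define \<zeta>' where "\<zeta>' x = - 8 / R\<^sup>2 * max 0 (1 - p (2 * x / R\<^sup>2 - 1)) * max 0 (2 * x / R\<^sup>2 - 1)" for x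
  show ?thesis
  proof
    show "(\<zeta> has_real_derivative \<zeta>' x) (at x)" for x
    proof -
      have "((\<lambda>x. 2 * x / R\<^sup>2 - 1) has_real_derivative 2 / R\<^sup>2) (at x)"
        using assms by (auto intro!: derivative_eq_intros simp: field_simps power2_eq_square power4_eq_xxxx)
      from DERIV_diff[OF DERIV_const[of 1] p''[OF this]] show ?thesis
        unfolding \<zeta>_def \<zeta>'_def by (intro DERIV_cong[OF p'']) auto
    qed
    show "continuous_on UNIV \<zeta>'" unfolding \<zeta>'_def p_def
      using assms by (auto intro!: continuous_intros)
    show "0 \<le> \<zeta> x" for x by (simp add: \<zeta>_def p_def)
    show "\<zeta> x = 1 \<and> \<zeta>' x = 0" if "x \<le> R\<^sup>2 / 2" for x
    proof -
      have "2 * x / R\<^sup>2 - 1 \<le> 0" using that assms by (simp add: field_simps)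
      then show ?thesis by (simp add: \<zeta>_def \<zeta>'_def p_def max_def)
    qed
    show "\<zeta> x = 0 \<and> \<zeta>' x = 0" if "R\<^sup>2 \<le> x" for x
    proof -
      have "1 \<le> 2 * x / R\<^sup>2 - 1" using that assms by (simp add: field_simps)
      moreover from this have "1 \<le> (2 * x / R\<^sup>2 - 1)\<^sup>2" by (rule one_le_power)
      ultimately have "max 0 (1 - p (2 * x / R\<^sup>2 - 1)) = 0" by (simp add: p_def)
      moreover have "\<zeta> x = (max 0 (1 - p (2 * x / R\<^sup>2 - 1)))\<^sup>2" by (simp add: \<zeta>_def p_def)
      ultimately show ?thesis by (simp add: \<zeta>'_def)
    qed
    show "\<bar>\<zeta>' x\<bar> \<le> 8 / R\<^sup>2" if "x \<le> R\<^sup>2" for x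
    proof -
      have "2 * x / R\<^sup>2 - 1 \<le> 1" using that assms by (simp add: field_simps)
      then have "max 0 (1 - p (2 * x / R\<^sup>2 - 1)) * max 0 (2 * x / R\<^sup>2 - 1) \<le> 1 * 1"
        by (intro mult_mono) (auto simp: p_def)
      moreover have "0 \<le> max 0 (1 - p (2 * x / R\<^sup>2 - 1)) * max 0 (2 * x / R\<^sup>2 - 1)" by simp
      ultimately show ?thesis
        using mult_left_mono[of "max 0 (1 - p (2 * x / R\<^sup>2 - 1)) * max 0 (2 * x / R\<^sup>2 - 1)" 1 "8 / R\<^sup>2"]
        by (simp add: \<zeta>'_def abs_mult mult.assoc)
    qed
  qed
qed

text \<open>
  In \<open>d = n + 1\<close> dimensions \<open>(\<tau> + \<epsilon>\<^sup>2)\<^bsup>-d/2\<^esup>\<close> is minus the radial derivative of a regularized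
  fundamental solution; the additional term \<open>M (\<tau> + \<epsilon>\<^sup>2)\<^bsup>-n/2\<^esup>\<close> absorbs the errors of relative size
  \<open>K \<surd>\<tau>\<close> caused by variable coefficients.
\<close>

lemma radial_weight_exists:
  fixes n :: nat and K \<rho> :: real
  assumes K: "0 \<le> K" and \<rho>: "0 < \<rho>"
  shows "\<exists>R0 c C. 0 < R0 \<and> R0 \<le> 1 \<and> 0 < c \<and> 0 \<le> C \<and>
    (\<forall>R \<epsilon>. 0 < R \<longrightarrow> R \<le> R0 \<longrightarrow> 0 < \<epsilon> \<longrightarrow> 2 * \<epsilon>\<^sup>2 \<le> R\<^sup>2 \<longrightarrow>
      (\<exists>h h'. (\<forall>\<tau>>-\<epsilon>\<^sup>2. (h has_real_derivative h' \<tau>) (at \<tau>)) \<and> continuous_on {-\<epsilon>\<^sup>2<..} h' \<and>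
        (\<forall>\<tau>>-\<epsilon>\<^sup>2. 0 \<le> h \<tau>) \<and> (\<forall>\<tau>\<ge>R\<^sup>2. h \<tau> = 0 \<and> h' \<tau> = 0) \<and>
        (\<forall>\<tau> D P. 0 \<le> \<tau> \<longrightarrow> \<tau> \<le> R\<^sup>2 \<longrightarrow> \<bar>D - (n + 1) * \<rho>\<bar> \<le> K * sqrt \<tau> \<longrightarrow>
            \<bar>P - \<rho> * \<tau>\<bar> \<le> K * \<tau> * sqrt \<tau> \<longrightarrow>
          h \<tau> * D + 2 * h' \<tau> * P \<ge> (if \<tau> \<le> \<epsilon>\<^sup>2 then c / \<epsilon> ^ (n + 1) else 0) - C / R ^ (n + 1))))"
proof -
  \<comment> \<open>Chosen so that \<open>K * (n + 2)\<close> is half of \<open>\<rho> * M\<close>.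
    The extra term of the weight produces \<open>\<rho> * M * U ^ n\<close>: one half absorbs the
    error of the singular term, using \<open>r * U \<le> 1\<close>, the other the error of the extra
    term itself, using \<open>R0\<close>.\<close>
  define M where "M = 2 * K * (n + 2) / \<rho>"
  have M0: "0 \<le> M" using K \<rho> by (simp add: M_def)
  have KM: "K * (n + 2) = \<rho> * M / 2" using \<rho> by (simp add: M_def)
  \<comment> \<open>\<open>K + 1\<close> instead of \<open>K\<close> keeps the denominator positive
    when the coefficients are constant.\<close>
  define R0 where "R0 = min 1 (\<rho> / (2 * ((K + 1) * (n + 1))))"
  have R0: "0 < R0" "R0 \<le> 1" using K \<rho> by (auto simp: R0_def intro!: divide_pos_pos mult_pos_pos)
  have KR0: "K * (n + 1) * r \<le> \<rho> / 2" if "r \<le> R0" "0 \<le> r" for r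
  proof -
    have "K * (n + 1) * r \<le> ((K + 1) * (n + 1)) * (\<rho> / (2 * ((K + 1) * (n + 1))))"
      using that K \<rho> by (intro mult_mono) (auto simp: R0_def)
    also have "\<dots> = \<rho> / 2"
    proof -
      have "(K + 1) * (n + 1) \<noteq> 0" using K by simp
      then show ?thesis by (metis nonzero_mult_divide_mult_cancel_right2 times_divide_eq_right mult.commute)
    qed
    finally show ?thesis .
  qed
  \<comment> \<open>\<open>c\<close> comes from
    \<open>\<rho> * (n + 1) * \<epsilon>\<^sup>2 * U ^ (n + 3)\<close> with
    \<open>U \<ge> 1 / (2 * \<epsilon>)\<close> on the core. \<open>C\<close> multiplies the bounds
    for \<open>2 * k\<close>, \<open>\<zeta>'\<close> and \<open>P\<close> in the region where the
    cutoff varies.\<close>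
  define c where "c = \<rho> * (n + 1) / 2 ^ (n + 3)"
  define C where "C = 2 * (2 ^ n * (2 + M)) * 8 * (\<rho> + K)"
  have c: "0 < c" and C: "0 \<le> C" using \<rho> M0 K by (auto simp: c_def C_def)
  show ?thesis
  proof (rule exI[of _ R0], rule exI[of _ c], rule exI[of _ C], intro conjI allI impI R0 c C)
    fix R \<epsilon> :: real
    assume R: "0 < R" "R \<le> R0" and \<epsilon>: "0 < \<epsilon>" "2 * \<epsilon>\<^sup>2 \<le> R\<^sup>2"
    obtain \<zeta> \<zeta>' where \<zeta>: "\<And>x. (\<zeta> has_real_derivative \<zeta>' x) (at x)" "continuous_on UNIV \<zeta>'"
      "\<And>x. 0 \<le> \<zeta> x" "\<And>x. x \<le> R\<^sup>2 / 2 \<Longrightarrow> \<zeta> x = 1 \<and> \<zeta>' x = 0" "\<And>x. R\<^sup>2 \<le> x \<Longrightarrow> \<zeta> x = 0 \<and> \<zeta>' x = 0"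
      "\<And>x. x \<le> R\<^sup>2 \<Longrightarrow> \<bar>\<zeta>' x\<bar> \<le> 8 / R\<^sup>2" using cutoff_exists[OF R(1)] by metis
    have c\<zeta>: "continuous_on UNIV \<zeta>"
      using \<zeta>(1) by (meson DERIV_isCont continuous_at_imp_continuous_on)
    define u where "u \<tau> = 1 / sqrt (\<tau> + \<epsilon>\<^sup>2)" for \<tau>
    have u0: "0 < u \<tau>" if "-\<epsilon>\<^sup>2 < \<tau>" for \<tau> using that by (simp add: u_def)
    have u2: "(u \<tau>)\<^sup>2 * (\<tau> + \<epsilon>\<^sup>2) = 1" if "-\<epsilon>\<^sup>2 < \<tau>" for \<tau>
      using that by (simp add: u_def power_divide)
    have u': "(u has_real_derivative (- (u \<tau> ^ 3) / 2)) (at \<tau>)" if "-\<epsilon>\<^sup>2 < \<tau>" for \<tau>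
      unfolding u_def using that
      by (auto intro!: derivative_eq_intros simp: power3_eq_cube field_simps)
    have cu: "continuous_on {-\<epsilon>\<^sup>2<..} u"
      unfolding u_def by (intro continuous_intros) auto
    define k where "k \<tau> = u \<tau> ^ n * (u \<tau> + M)" for \<tau>
    define k' where "k' \<tau> = - ((n + 1) * u \<tau> ^ (n + 3) + M * n * u \<tau> ^ (n + 2)) / 2" for \<tau>
    have k': "(k has_real_derivative k' \<tau>) (at \<tau>)" if "-\<epsilon>\<^sup>2 < \<tau>" for \<tau>
    proof -
      have "(k has_real_derivative real n * (u \<tau> ^ (n - 1)) * (- (u \<tau> ^ 3) / 2) * (u \<tau> + M) + (- (u \<tau> ^ 3) / 2) * u \<tau> ^ n) (at \<tau>)"
        unfolding k_def using u'[OF that] by (auto intro!: derivative_eq_intros)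
      moreover have "real n * (u \<tau> ^ (n - 1)) * (- (u \<tau> ^ 3) / 2) * (u \<tau> + M) + (- (u \<tau> ^ 3) / 2) * u \<tau> ^ n = k' \<tau>"
        unfolding k'_def by (cases n) (simp_all add: power_add power2_eq_square power3_eq_cube power4_eq_xxxx field_simps)
      ultimately show ?thesis by simp
    qed
    have k_nn: "0 \<le> k \<tau>" and k'_np: "k' \<tau> \<le> 0" if "-\<epsilon>\<^sup>2 < \<tau>" for \<tau>
    proof -
      show "0 \<le> k \<tau>" using u0[OF that] M0 by (simp add: k_def)
      have "0 \<le> (n + 1) * u \<tau> ^ (n + 3) + M * n * u \<tau> ^ (n + 2)"
        using u0[OF that] M0 by (intro add_nonneg_nonneg mult_nonneg_nonneg) auto
      then show "k' \<tau> \<le> 0" by (simp add: k'_def)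
    qed
    have ck: "continuous_on {-\<epsilon>\<^sup>2<..} k" "continuous_on {-\<epsilon>\<^sup>2<..} k'"
      unfolding k_def k'_def by (intro continuous_intros cu; simp)+
    define h where "h \<tau> = k \<tau> * \<zeta> \<tau>" for \<tau>
    define h' where "h' \<tau> = k' \<tau> * \<zeta> \<tau> + k \<tau> * \<zeta>' \<tau>" for \<tau>
    have ineq: "h \<tau> * D + 2 * h' \<tau> * P \<ge> (if \<tau> \<le> \<epsilon>\<^sup>2 then c / \<epsilon> ^ (n + 1) else 0) - C / R ^ (n + 1)"
      if \<tau>: "0 \<le> \<tau>" "\<tau> \<le> R\<^sup>2" and D: "\<bar>D - (n + 1) * \<rho>\<bar> \<le> K * sqrt \<tau>"
        and P: "\<bar>P - \<rho> * \<tau>\<bar> \<le> K * \<tau> * sqrt \<tau>" for \<tau> D P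
    proof -
      define r where "r = sqrt \<tau>"
      have "0 < \<epsilon>\<^sup>2" using \<epsilon> by simp
      then have \<tau>': "-\<epsilon>\<^sup>2 < \<tau>" using \<tau> by linarith
      define U where "U = u \<tau>"
      have U0: "0 < U" using u0[OF \<tau>'] by (simp add: U_def)
      have U2: "U\<^sup>2 * \<tau> = 1 - U\<^sup>2 * \<epsilon>\<^sup>2" using u2[OF \<tau>'] by (simp add: U_def algebra_simps)
      have r: "0 \<le> r" "r\<^sup>2 = \<tau>" using \<tau> by (auto simp: r_def)
      have "(r * U)\<^sup>2 \<le> 1\<^sup>2" using U2 r by (simp add: power_mult_distrib mult.commute)
      then have rU: "r * U \<le> 1" using r U0 by (subst (asm) power_mono_iff) auto
      have rR: "r \<le> R" using \<tau> R unfolding r_def by (intro real_le_lsqrt) auto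
      \<comment> \<open>The signs of \<open>k\<close> and \<open>k'\<close> make the smallest
        \<open>D\<close> and the largest \<open>P\<close> the worst case. Substituting
        \<open>U2\<close> cancels the leading powers \<open>U ^ (n + 1)\<close> except for a term
        with \<open>\<epsilon>\<^sup>2\<close>, which is the gain kept; the surplus
        \<open>\<rho> * M * U ^ n\<close> pays for the error
        \<open>K * r * (k \<tau> + T)\<close>.\<close>
      have main: "k \<tau> * D + 2 * k' \<tau> * P \<ge> \<rho> * (n + 1) * \<epsilon>\<^sup>2 * U ^ (n + 3)"
      proof -
        have "k \<tau> * D \<ge> k \<tau> * ((n + 1) * \<rho> - K * r)"
          using k_nn[OF \<tau>'] D by (intro mult_left_mono) (auto simp: r_def abs_le_iff)
        moreover have "2 * k' \<tau> * P \<ge> 2 * k' \<tau> * (\<rho> * \<tau> + K * \<tau> * r)"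
          using k'_np[OF \<tau>'] P by (intro mult_left_mono_neg) (auto simp: r_def abs_le_iff)
        ultimately have 1: "k \<tau> * D + 2 * k' \<tau> * P \<ge>
          k \<tau> * ((n + 1) * \<rho> - K * r) + 2 * k' \<tau> * (\<rho> * \<tau> + K * \<tau> * r)" by linarith
        have "2 * k' \<tau> * \<tau> = - (((n + 1) * U ^ (n + 1) + M * n * U ^ n) * (U\<^sup>2 * \<tau>))"
        proof -
          have k2: "2 * k' \<tau> = - ((n + 1) * U ^ (n + 3) + M * n * U ^ (n + 2))"
            by (simp add: k'_def U_def)
          show ?thesis unfolding k2 by (simp add: algebra_simps power_add power2_eq_square power3_eq_cube)
        qed
        also have "\<dots> = - ((n + 1) * U ^ (n + 1) + M * n * U ^ n) + ((n + 1) * U ^ (n + 1) + M * n * U ^ n) * (U\<^sup>2 * \<epsilon>\<^sup>2)"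
          unfolding U2 by (simp add: algebra_simps)
        finally have k'\<tau>: "2 * k' \<tau> * \<tau> = \<dots>" .
        define T where "T = ((n + 1) * U ^ (n + 1) + M * n * U ^ n)"
        define \<eta> where "\<eta> = U\<^sup>2 * \<epsilon>\<^sup>2"
        have \<eta>: "0 \<le> \<eta>" "\<eta> \<le> 1" using U2 \<tau> unfolding \<eta>_def by (auto simp: algebra_simps) (smt (verit) mult_nonneg_nonneg zero_le_power2)
        have T0: "0 \<le> T" using U0 M0 by (simp add: T_def)
        have "2 * k' \<tau> * (\<rho> * \<tau> + K * \<tau> * r) = (2 * k' \<tau> * \<tau>) * (\<rho> + K * r)" by (simp add: algebra_simps)
        also have "\<dots> = (- T + T * \<eta>) * (\<rho> + K * r)" unfolding k'\<tau> T_def \<eta>_def by simp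
        also have "\<dots> = - T * \<rho> + T * \<eta> * \<rho> - T * K * r * (1 - \<eta>)" by (simp add: algebra_simps)
        also have "\<dots> \<ge> - T * \<rho> + T * \<eta> * \<rho> - T * K * r"
          using T0 K r \<eta> mult_left_mono[of "1 - \<eta>" 1 "T * K * r"] by simp
        finally have 2: "2 * k' \<tau> * (\<rho> * \<tau> + K * \<tau> * r) \<ge> - T * \<rho> + T * \<eta> * \<rho> - T * K * r" .
        have kU: "k \<tau> = U ^ (n + 1) + M * U ^ n" by (simp add: k_def U_def algebra_simps)
        have 3: "k \<tau> * (n + 1) - T = M * U ^ n" unfolding kU T_def by (simp add: algebra_simps)
        have "k \<tau> + T = (n + 2) * U ^ (n + 1) + M * (n + 1) * U ^ n"
          unfolding kU T_def by (simp add: algebra_simps)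
        then have "K * r * (k \<tau> + T) = K * (n + 2) * U ^ n * (r * U) + K * (n + 1) * r * (M * U ^ n)"
          by (simp add: algebra_simps)
        also have "\<dots> \<le> K * (n + 2) * U ^ n * 1 + \<rho> / 2 * (M * U ^ n)"
          using U0 M0 K R rR r by (intro add_mono mult_left_mono mult_right_mono rU KR0) auto
        also have "\<dots> = \<rho> * (M * U ^ n)" unfolding KM by simp
        finally have 4: "K * r * (k \<tau> + T) \<le> \<rho> * (k \<tau> * (n + 1) - T)" unfolding 3 .
        have "\<rho> * (n + 1) * \<epsilon>\<^sup>2 * U ^ (n + 3) = (n + 1) * U ^ (n + 1) * \<eta> * \<rho>"
          by (simp add: \<eta>_def power_add power2_eq_square power3_eq_cube)
        also have "\<dots> \<le> T * \<eta> * \<rho>" using \<eta> \<rho> M0 U0 unfolding T_def by (intro mult_right_mono) auto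
        finally show ?thesis using 1 2 4 by (simp add: algebra_simps)
      qed
      show ?thesis
      proof (cases "\<tau> \<le> R\<^sup>2 / 2")
        case True
        then have "h \<tau> * D + 2 * h' \<tau> * P = k \<tau> * D + 2 * k' \<tau> * P" using \<zeta>(4)[OF True] by (simp add: h_def h'_def)
        moreover have "(if \<tau> \<le> \<epsilon>\<^sup>2 then c / \<epsilon> ^ (n + 1) else 0) \<le> \<rho> * (n + 1) * \<epsilon>\<^sup>2 * U ^ (n + 3)"
        proof (cases "\<tau> \<le> \<epsilon>\<^sup>2")
          case True
          have "\<tau> + \<epsilon>\<^sup>2 \<le> 4 * \<epsilon>\<^sup>2" using True \<open>0 < \<epsilon>\<^sup>2\<close> by linarith
          then have "\<tau> + \<epsilon>\<^sup>2 \<le> (2 * \<epsilon>)\<^sup>2" by simp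
          then have "sqrt (\<tau> + \<epsilon>\<^sup>2) \<le> 2 * \<epsilon>" using \<epsilon> by (intro real_le_lsqrt) auto
          then have "1 / (2 * \<epsilon>) \<le> U" unfolding U_def u_def using \<tau>' \<epsilon> by (intro divide_left_mono) auto
          then have "(1 / (2 * \<epsilon>)) ^ (n + 3) \<le> U ^ (n + 3)" using \<epsilon> by (intro power_mono) auto
          then have "\<rho> * (n + 1) * \<epsilon>\<^sup>2 * (1 / (2 * \<epsilon>)) ^ (n + 3) \<le> \<rho> * (n + 1) * \<epsilon>\<^sup>2 * U ^ (n + 3)"
            using \<rho> by (intro mult_left_mono) auto
          moreover have "\<rho> * (n + 1) * \<epsilon>\<^sup>2 * (1 / (2 * \<epsilon>)) ^ (n + 3) = c / \<epsilon> ^ (n + 1)"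
            using \<epsilon> by (simp add: c_def power_divide power_mult_distrib power_add power2_eq_square power3_eq_cube)
          ultimately show ?thesis using True by simp
        next
          case False
          then show ?thesis using \<rho> U0 by simp
        qed
        moreover have "0 \<le> C / R ^ (n + 1)" using C R by simp
        ultimately show ?thesis using main by linarith
      next
        case False
        \<comment> \<open>Because of \<open>2 * \<epsilon>\<^sup>2 \<le> R\<^sup>2\<close> the core
          lies where the cutoff is \<open>1\<close>. Outside that region only nonnegativity of the
          main term is used, and the term with \<open>\<zeta>'\<close> is the loss.\<close>
        then have n\<epsilon>: "\<not> \<tau> \<le> \<epsilon>\<^sup>2" using \<epsilon> by linarith
        have "R\<^sup>2 / 4 \<le> \<tau> + \<epsilon>\<^sup>2" using False \<tau> \<open>0 < \<epsilon>\<^sup>2\<close> by linarith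
        then have "(R / 2)\<^sup>2 \<le> \<tau> + \<epsilon>\<^sup>2" by (simp add: power_divide)
        then have "R / 2 \<le> sqrt (\<tau> + \<epsilon>\<^sup>2)" by (rule real_le_rsqrt)
        then have "U \<le> 1 / (R / 2)" unfolding U_def u_def using \<tau>' R by (intro divide_left_mono) auto
        then have UR: "U \<le> 2 / R" by simp
        have "M \<le> M / R" using M0 R R0 by (simp add: field_simps mult_left_le)
        then have "U + M \<le> (2 + M) / R" using UR by (simp add: add_divide_distrib)
        then have "k \<tau> \<le> (2 / R) ^ n * ((2 + M) / R)"
          unfolding k_def U_def[symmetric] using U0 M0 R UR by (intro mult_mono power_mono) auto
        then have kR: "k \<tau> \<le> 2 ^ n * (2 + M) / R ^ (n + 1)"
          by (simp add: power_divide mult.commute)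
        have "K * \<tau> * r \<le> K * R\<^sup>2 * 1" using K \<tau> r rR R R0 by (intro mult_mono) auto
        moreover have "\<rho> * \<tau> \<le> \<rho> * R\<^sup>2" using \<rho> \<tau> by simp
        moreover have "0 \<le> \<rho> * \<tau>" using \<rho> \<tau> by simp
        ultimately have PR: "\<bar>P\<bar> \<le> (\<rho> + K) * R\<^sup>2" using P unfolding r_def by (simp add: algebra_simps abs_le_iff)
        have "\<bar>2 * k \<tau> * \<zeta>' \<tau> * P\<bar> = 2 * k \<tau> * \<bar>\<zeta>' \<tau>\<bar> * \<bar>P\<bar>"
          using k_nn[OF \<tau>'] by (simp add: abs_mult)
        also have "\<dots> \<le> 2 * (2 ^ n * (2 + M) / R ^ (n + 1)) * (8 / R\<^sup>2) * ((\<rho> + K) * R\<^sup>2)"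
          using k_nn[OF \<tau>'] M0 R by (intro mult_mono mult_left_mono kR \<zeta>(6) \<tau> PR) auto
        also have "\<dots> = C / R ^ (n + 1)" using R by (simp add: C_def)
        finally have "2 * k \<tau> * \<zeta>' \<tau> * P \<ge> - (C / R ^ (n + 1))" by linarith
        moreover have "\<zeta> \<tau> * (k \<tau> * D + 2 * k' \<tau> * P) \<ge> 0"
          using \<zeta>(3) \<rho> U0 by (intro mult_nonneg_nonneg order_trans[OF _ main]) auto
        moreover have "h \<tau> * D + 2 * h' \<tau> * P = \<zeta> \<tau> * (k \<tau> * D + 2 * k' \<tau> * P) + 2 * k \<tau> * \<zeta>' \<tau> * P"
          by (simp add: h_def h'_def algebra_simps)
        ultimately show ?thesis using n\<epsilon> by simp
      qed
    qed
    show "\<exists>h h'. (\<forall>\<tau>>-\<epsilon>\<^sup>2. (h has_real_derivative h' \<tau>) (at \<tau>)) \<and> continuous_on {-\<epsilon>\<^sup>2<..} h' \<and>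
        (\<forall>\<tau>>-\<epsilon>\<^sup>2. 0 \<le> h \<tau>) \<and> (\<forall>\<tau>\<ge>R\<^sup>2. h \<tau> = 0 \<and> h' \<tau> = 0) \<and>
        (\<forall>\<tau> D P. 0 \<le> \<tau> \<longrightarrow> \<tau> \<le> R\<^sup>2 \<longrightarrow> \<bar>D - (n + 1) * \<rho>\<bar> \<le> K * sqrt \<tau> \<longrightarrow>
            \<bar>P - \<rho> * \<tau>\<bar> \<le> K * \<tau> * sqrt \<tau> \<longrightarrow>
          h \<tau> * D + 2 * h' \<tau> * P \<ge> (if \<tau> \<le> \<epsilon>\<^sup>2 then c / \<epsilon> ^ (n + 1) else 0) - C / R ^ (n + 1))"
    proof (intro exI conjI allI impI)
      show "(h has_real_derivative h' \<tau>) (at \<tau>)" if "-\<epsilon>\<^sup>2 < \<tau>" for \<tau>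
        unfolding h_def h'_def using k'[OF that] \<zeta>(1) by (auto intro!: derivative_eq_intros)
      show "continuous_on {-\<epsilon>\<^sup>2<..} h'" unfolding h'_def
        using c\<zeta> \<zeta>(2) by (intro continuous_intros ck) (auto intro: continuous_on_subset)
      show "0 \<le> h \<tau>" if "-\<epsilon>\<^sup>2 < \<tau>" for \<tau> using k_nn[OF that] \<zeta>(3) by (simp add: h_def)
      show "h \<tau> = 0" "h' \<tau> = 0" if "R\<^sup>2 \<le> \<tau>" for \<tau> using \<zeta>(5)[OF that] by (auto simp: h_def h'_def)
      show "h \<tau> * D + 2 * h' \<tau> * P \<ge> (if \<tau> \<le> \<epsilon>\<^sup>2 then c / \<epsilon> ^ (n + 1) else 0) - C / R ^ (n + 1)"
        if "0 \<le> \<tau>" "\<tau> \<le> R\<^sup>2" "\<bar>D - (n + 1) * \<rho>\<bar> \<le> K * sqrt \<tau>"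
          "\<bar>P - \<rho> * \<tau>\<bar> \<le> K * \<tau> * sqrt \<tau>" for \<tau> D P
        using that by (rule ineq)
    qed
  qed
qed

text \<open>Extension by zero reduces this to the whole space: \<open>W\<close> and the complement
  of \<open>K\<close> are open, cover everything, and the extension is regular on each.\<close>

lemma integral_directional_derivative_open:
  fixes f f' :: "'a::euclidean_space \<Rightarrow> real"
  assumes W: "open W" and K: "compact K" "K \<subseteq> W"
    and cf: "continuous_on W f" and cf': "continuous_on W f'"
    and der: "\<And>x. x \<in> W \<Longrightarrow> ((\<lambda>s. f (x + s *\<^sub>R b)) has_real_derivative f' x) (at 0)"
    and zero: "\<And>x. x \<in> W - K \<Longrightarrow> f x = 0 \<and> f' x = 0"
  shows "integrable lborel (\<lambda>x. if x \<in> W then f' x else 0)"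
    "(LINT x|lborel. (if x \<in> W then f' x else 0)) = 0"
proof -
  have Un: "W \<union> - K = UNIV" and op: "open (- K)"
    using K by (auto simp: compact_imp_closed open_Compl)
  have ext: "continuous_on UNIV (\<lambda>x. if x \<in> W then u x else 0)"
    if "continuous_on W u" "\<And>x. x \<in> W - K \<Longrightarrow> u x = 0" for u :: "'a \<Rightarrow> real"
  proof -
    have "continuous_on W (\<lambda>x. if x \<in> W then u x else 0)"
      using that(1) by (simp cong: continuous_on_cong)
    moreover have "continuous_on (- K) (\<lambda>x. if x \<in> W then u x else 0)"
    proof (rule continuous_on_eq)
      show "continuous_on (- K) (\<lambda>_. 0)" by simp
    qed (use that(2) in auto)
    ultimately show ?thesis using continuous_on_open_Un[OF W op] unfolding Un by blast
  qed
  have der': "((\<lambda>s. if x + s *\<^sub>R b \<in> W then f (x + s *\<^sub>R b) else 0) has_real_derivative (if x \<in> W then f' x else 0)) (at 0)" for x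
  proof (cases "x \<in> W")
    case True
    let ?S = "(\<lambda>s. x + s *\<^sub>R b) -` W"
    have "open ?S" "0 \<in> ?S" using True by (auto intro!: open_vimage W continuous_intros)
    from has_field_derivative_transform_within_open[OF der[OF True] this]
    show ?thesis using True by simp
  next
    case False
    let ?S = "(\<lambda>s. x + s *\<^sub>R b) -` (- K)"
    have S: "open ?S" "0 \<in> ?S" using False K(2) by (auto intro!: open_vimage op continuous_intros)
    have "((\<lambda>s. if x + s *\<^sub>R b \<in> W then f (x + s *\<^sub>R b) else 0) has_real_derivative 0) (at 0)"
      by (rule has_field_derivative_transform_within_open[OF DERIV_const S]) (use zero in auto)
    then show ?thesis using False by simp
  qed
  show "integrable lborel (\<lambda>x. if x \<in> W then f' x else 0)"
    "(LINT x|lborel. (if x \<in> W then f' x else 0)) = 0"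
    using integral_directional_derivative_eq_0[OF ext[OF cf] ext[OF cf'] der' K(1)] zero K(2)
    by auto
qed

section \<open>The squared distance frozen at the centre and its errors\<close>

lemma differentiable_imp_eventually_lipschitz:
  fixes f :: "'a::real_normed_vector \<Rightarrow> real"
  assumes "f differentiable (at z)"
  shows "\<exists>L\<ge>0. \<forall>\<^sub>F x in nhds z. \<bar>f x - f z\<bar> \<le> L * norm (x - z)"
proof -
  obtain f' where f': "(f has_derivative f') (at z)" using assms by (auto simp: differentiable_def)
  then have bl: "bounded_linear f'" by (rule has_derivative_bounded_linear)
  obtain d where d: "d > 0" "\<And>y. norm (y - z) < d \<Longrightarrow> norm (f y - f z - f' (y - z)) \<le> 1 * norm (y - z)"
    using f' unfolding has_derivative_at_alt by (meson zero_less_one)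
  have "\<bar>f x - f z\<bar> \<le> (onorm f' + 1) * norm (x - z)" if "norm (x - z) < d" for x
  proof -
    have "\<bar>f x - f z\<bar> \<le> \<bar>f x - f z - f' (x - z)\<bar> + \<bar>f' (x - z)\<bar>" by linarith
    then show ?thesis using d(2)[OF that] onorm[OF bl, of "x - z"] by (simp add: algebra_simps)
  qed
  then have "\<forall>\<^sub>F x in nhds z. \<bar>f x - f z\<bar> \<le> (onorm f' + 1) * norm (x - z)"
    unfolding eventually_nhds_metric using d(1) by (auto simp: dist_norm)
  moreover have "0 \<le> onorm f' + 1" using onorm_pos_le[OF bl] by simp
  ultimately show ?thesis by blast
qed

lemma pos_def_coercive:
  fixes B :: "real^'n^'n"
  assumes "\<And>y. y \<noteq> 0 \<Longrightarrow> 0 < y \<bullet> (B *v y)"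
  obtains b where "0 < b" "\<And>y. b * (norm y)\<^sup>2 \<le> y \<bullet> (B *v y)"
proof -
  let ?S = "sphere (0::real^'n) 1"
  have ne: "?S \<noteq> {}" using norm_axis_1[of undefined] by (metis dist_0_norm empty_iff mem_sphere)
  have "continuous_on ?S (\<lambda>y. y \<bullet> (B *v y))"
    by (intro continuous_intros linear_continuous_on matrix_vector_mul_bounded_linear)
  then obtain y0 where y0: "y0 \<in> ?S" "\<And>y. y \<in> ?S \<Longrightarrow> y0 \<bullet> (B *v y0) \<le> y \<bullet> (B *v y)"
    using continuous_attains_inf[OF compact_sphere ne] by blast
  show ?thesis
  proof
    show "0 < y0 \<bullet> (B *v y0)" using y0(1) by (intro assms) auto
    show "y0 \<bullet> (B *v y0) * (norm y)\<^sup>2 \<le> y \<bullet> (B *v y)" for y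
    proof (cases "y = 0")
      case False
      define w where "w = y /\<^sub>R norm y"
      have "w \<in> ?S" using False by (simp add: w_def)
      moreover have y: "y = norm y *\<^sub>R w" using False by (simp add: w_def)
      have "y \<bullet> (B *v y) = (norm y)\<^sup>2 * (w \<bullet> (B *v w))"
        by (subst (1 2) y) (simp add: matrix_vector_mult_scaleR power2_eq_square)
      ultimately show ?thesis using y0(2)[of w] by (simp add: mult.commute mult_right_mono)
    qed simp
  qed
qed

text \<open>
  In local coordinates \<open>\<alpha> = \<surd>g g\<^sup>i\<^sup>j\<close>, \<open>\<rho> = \<surd>g\<close>, and \<open>B\<close> is the metric at the centre \<open>z\<close>. Only the
  derivatives \<open>d\<alpha> i k = \<partial>\<^sub>i \<alpha>\<^sub>i\<^sub>k\<close> occur.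
\<close>

locale elliptic_coefficients =
  fixes \<Omega> :: "(real^'n::finite) set" and z :: "real^'n"
    and \<alpha> d\<alpha> :: "'n \<Rightarrow> 'n \<Rightarrow> real^'n \<Rightarrow> real" and \<rho> :: "real^'n \<Rightarrow> real" and B :: "real^'n^'n"
  assumes \<Omega>: "open \<Omega>" "z \<in> \<Omega>"
    and \<alpha>_sym: "\<And>x i k. x \<in> \<Omega> \<Longrightarrow> \<alpha> i k x = \<alpha> k i x"
    and \<alpha>_pos: "\<And>x u. x \<in> \<Omega> \<Longrightarrow> 0 \<le> (\<Sum>i\<in>UNIV. \<Sum>k\<in>UNIV. \<alpha> i k x * u i * u k)"
    and \<alpha>_diff: "\<And>x i k. x \<in> \<Omega> \<Longrightarrow> \<alpha> i k differentiable (at x)"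
    and \<alpha>_deriv: "\<And>x i k. x \<in> \<Omega> \<Longrightarrow> ((\<lambda>s. \<alpha> i k (x + s *\<^sub>R axis i 1)) has_real_derivative d\<alpha> i k x) (at 0)"
    and d\<alpha>_cont: "\<And>i k. continuous_on \<Omega> (d\<alpha> i k)"
    and \<rho>_diff: "\<And>x. x \<in> \<Omega> \<Longrightarrow> \<rho> differentiable (at x)" and \<rho>_pos: "\<And>x. x \<in> \<Omega> \<Longrightarrow> 0 < \<rho> x"
    and B_sym: "transpose B = B" and B_pos: "\<And>y. y \<noteq> 0 \<Longrightarrow> 0 < y \<bullet> (B *v y)"
    and frozen: "\<And>i l. (\<Sum>k\<in>UNIV. \<alpha> i k z * B $ k $ l) = (if i = l then \<rho> z else 0)"
begin

text \<open>
  Writing \<open>L = \<Sum>\<^sub>i\<^sub>k \<partial>\<^sub>i \<alpha>\<^sub>i\<^sub>k \<partial>\<^sub>k + \<rho> \<partial>\<^sub>t\<^sup>2\<close>, one has \<open>L (F \<circ> q) = - 2 (h(q) (D + \<rho>) + 2 h'(q) P)\<close> if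
  \<open>F' = - h\<close>; constant coefficients would give \<open>D + \<rho> = (n + 1) \<rho>\<close> and \<open>P = \<rho> q\<close>.
\<close>

definition q :: "(real^'n) \<times> real \<Rightarrow> real"
  where "q p = (fst p - z) \<bullet> (B *v (fst p - z)) + (snd p)\<^sup>2"

text \<open>Half the spatial gradient of \<open>q\<close>, by the symmetry of \<open>B\<close>.
  Accordingly \<open>D\<close> is half the spatial part of \<open>L q\<close>, and \<open>P\<close>
  is a quarter of the energy density of \<open>q\<close> for the matrix
  \<open>diag (\<alpha>, \<rho>)\<close>.\<close>

definition By :: "'n \<Rightarrow> real^'n \<Rightarrow> real"
  where "By i x = (B *v (x - z)) $ i"

definition D :: "real^'n \<Rightarrow> real"
  where "D x = (\<Sum>i\<in>UNIV. \<Sum>k\<in>UNIV. d\<alpha> i k x * By k x + \<alpha> i k x * B $ k $ i)"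

definition P :: "(real^'n) \<times> real \<Rightarrow> real"
  where "P p = (\<Sum>i\<in>UNIV. \<Sum>k\<in>UNIV. \<alpha> i k (fst p) * By i (fst p) * By k (fst p)) + \<rho> (fst p) * (snd p)\<^sup>2"

lemma q_nonneg: "0 \<le> q p"
proof -
  have "0 \<le> (fst p - z) \<bullet> (B *v (fst p - z))"
    using B_pos[of "fst p - z"] by (cases "fst p = z") (simp_all add: less_imp_le)
  then show ?thesis by (simp add: q_def)
qed

text \<open>With coefficients frozen at \<open>z\<close> both differences vanish, by the assumption
  \<open>frozen\<close>. What remains are the derivatives of \<open>\<alpha>\<close> and the
  Lipschitz differences of \<open>\<alpha>\<close> and \<open>\<rho>\<close>, each with one factor
  \<open>norm (x - z)\<close> more than the leading term; coercivity of \<open>B\<close> converts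
  that factor into \<open>sqrt (q p)\<close>.\<close>

lemma error_bounds:
  "\<exists>R0 K. 0 < R0 \<and> 0 \<le> K \<and> (\<forall>p. q p \<le> R0\<^sup>2 \<longrightarrow> fst p \<in> \<Omega> \<and>
    \<bar>D (fst p) + \<rho> (fst p) - (CARD('n) + 1) * \<rho> z\<bar> \<le> K * sqrt (q p) \<and>
    \<bar>P p - \<rho> z * q p\<bar> \<le> K * q p * sqrt (q p))"
proof -
  obtain b where b: "0 < b" "\<And>y. b * (norm y)\<^sup>2 \<le> y \<bullet> (B *v y)" using pos_def_coercive[OF B_pos] by metis
  obtain \<beta>0 where \<beta>0: "0 < \<beta>0" "\<And>y. norm (B *v y) \<le> \<beta>0 * norm y"
    using bounded_linear.pos_bounded[OF matrix_vector_mul_bounded_linear[of B]] by (metis mult.commute)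
  have By_le: "\<bar>By k x\<bar> \<le> \<beta>0 * norm (x - z)" for k x
    unfolding By_def by (rule order_trans[OF component_le_norm_cart \<beta>0(2)])
  have B_le: "\<bar>B $ k $ i\<bar> \<le> \<beta>0" for k i
  proof -
    have "B $ k $ i = (B *v axis i 1) $ k" by (simp add: matrix_vector_mul_component inner_axis)
    then show ?thesis using component_le_norm_cart[of "B *v axis i 1" k] \<beta>0(2)[of "axis i 1"] by (simp add: norm_axis_1)
  qed
  \<comment> \<open>One Lipschitz constant for each of the finitely many entries; their sum with the
    constant for \<open>\<rho>\<close> serves for all of them.\<close>
  define L1 where "L1 i k = (SOME L. 0 \<le> L \<and> (\<forall>\<^sub>F x in nhds z. \<bar>\<alpha> i k x - \<alpha> i k z\<bar> \<le> L * norm (x - z)))" for i k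
  have L1': "0 \<le> L1 i k \<and> (\<forall>\<^sub>F x in nhds z. \<bar>\<alpha> i k x - \<alpha> i k z\<bar> \<le> L1 i k * norm (x - z))" for i k
    unfolding L1_def
    by (rule someI_ex) (use differentiable_imp_eventually_lipschitz[OF \<alpha>_diff[OF \<Omega>(2)], of i k] in blast)
  have L1: "0 \<le> L1 i k" "\<forall>\<^sub>F x in nhds z. \<bar>\<alpha> i k x - \<alpha> i k z\<bar> \<le> L1 i k * norm (x - z)" for i k
    using L1'[of i k] by auto
  obtain L2 where L2: "0 \<le> L2" "\<forall>\<^sub>F x in nhds z. \<bar>\<rho> x - \<rho> z\<bar> \<le> L2 * norm (x - z)"
    using differentiable_imp_eventually_lipschitz[OF \<rho>_diff[OF \<Omega>(2)]] by blast
  define L where "L = (\<Sum>i\<in>UNIV. \<Sum>k\<in>UNIV. L1 i k) + L2"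
  have S0: "0 \<le> (\<Sum>i\<in>UNIV. \<Sum>k\<in>UNIV. L1 i k)" by (intro sum_nonneg L1)
  have L1_le: "L1 i k \<le> L" for i k
  proof -
    have "L1 i k \<le> (\<Sum>k\<in>UNIV. L1 i k)" by (intro member_le_sum L1) auto
    also have "\<dots> \<le> (\<Sum>i\<in>UNIV. \<Sum>k\<in>UNIV. L1 i k)"
      by (rule member_le_sum[of i UNIV "\<lambda>i. \<Sum>k\<in>UNIV. L1 i k"]) (auto intro: sum_nonneg L1)
    finally show ?thesis using L2 by (simp add: L_def)
  qed
  have L2_le: "L2 \<le> L" and L0: "0 \<le> L" using S0 L2 by (auto simp: L_def)
  define A where "A = (\<Sum>i\<in>UNIV. \<Sum>k\<in>UNIV. \<bar>d\<alpha> i k z\<bar>) + 1"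
  have A_le: "\<bar>d\<alpha> i k z\<bar> + 1 \<le> A" for i k
  proof -
    have "\<bar>d\<alpha> i k z\<bar> \<le> (\<Sum>k\<in>UNIV. \<bar>d\<alpha> i k z\<bar>)"
      by (rule member_le_sum[of k UNIV "\<lambda>k. \<bar>d\<alpha> i k z\<bar>"]) auto
    also have "\<dots> \<le> (\<Sum>i\<in>UNIV. \<Sum>k\<in>UNIV. \<bar>d\<alpha> i k z\<bar>)"
      by (rule member_le_sum[of i UNIV "\<lambda>i. \<Sum>k\<in>UNIV. \<bar>d\<alpha> i k z\<bar>"]) (auto intro: sum_nonneg)
    finally show ?thesis by (simp add: A_def)
  qed
  have A0: "0 \<le> A" by (simp add: A_def sum_nonneg)
  have ev_d: "\<forall>\<^sub>F x in nhds z. \<bar>d\<alpha> i k x\<bar> \<le> \<bar>d\<alpha> i k z\<bar> + 1" for i k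
  proof -
    have "isCont (d\<alpha> i k) z" using d\<alpha>_cont \<Omega> by (simp add: continuous_on_eq_continuous_at)
    then have "((\<lambda>x. \<bar>d\<alpha> i k x\<bar>) \<longlongrightarrow> \<bar>d\<alpha> i k z\<bar>) (nhds z)"
      by (intro tendsto_rabs) (simp add: isCont_def tendsto_at_iff_tendsto_nhds)
    then have "\<forall>\<^sub>F x in nhds z. \<bar>d\<alpha> i k x\<bar> < \<bar>d\<alpha> i k z\<bar> + 1" by (rule order_tendstoD) simp
    then show ?thesis by (rule eventually_mono) simp
  qed
  define good where "good x \<longleftrightarrow> x \<in> \<Omega> \<and> \<bar>\<rho> x - \<rho> z\<bar> \<le> L2 * norm (x - z) \<and>
    (\<forall>i k. \<bar>\<alpha> i k x - \<alpha> i k z\<bar> \<le> L1 i k * norm (x - z) \<and> \<bar>d\<alpha> i k x\<bar> \<le> \<bar>d\<alpha> i k z\<bar> + 1)" for x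
  have "\<forall>\<^sub>F x in nhds z. good x"
    unfolding good_def by (intro eventually_conj eventually_all_finite L1 L2 ev_d eventually_nhds_in_open \<Omega>)
  then obtain r where r: "0 < r" "\<And>x. norm (x - z) < r \<Longrightarrow> good x"
    unfolding eventually_nhds_metric dist_norm by blast
  define R0 where "R0 = r * sqrt b / 2"
  define N where "N = real (CARD('n) * CARD('n))"
  \<comment> \<open>The two entries are the constants for \<open>D\<close> and for \<open>P\<close>
    in terms of \<open>norm (x - z)\<close>; the division by \<open>sqrt b\<close> passes to
    \<open>sqrt (q p)\<close>.\<close>
  define K where "K = max (N * (A * \<beta>0 + L * \<beta>0) + L) (N * (L * \<beta>0 * \<beta>0 / b) + L) / sqrt b"
  have y_le: "norm (fst p - z) \<le> sqrt (q p) / sqrt b" for p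
  proof -
    have "b * (norm (fst p - z))\<^sup>2 \<le> q p" using b(2)[of "fst p - z"] by (simp add: q_def add_increasing2)
    then have "sqrt (b * (norm (fst p - z))\<^sup>2) \<le> sqrt (q p)" by simp
    then show ?thesis using b(1) by (simp add: real_sqrt_mult field_simps)
  qed
  have good: "good (fst p)" if "q p \<le> R0\<^sup>2" for p
  proof (rule r(2))
    have "sqrt (q p) \<le> R0" using that r b by (intro real_le_lsqrt) (auto simp: R0_def)
    then have "norm (fst p - z) \<le> R0 / sqrt b" using y_le[of p] b(1) by (meson divide_right_mono order_trans real_sqrt_ge_zero less_imp_le)
    also have "\<dots> < r" using r b by (simp add: R0_def)
    finally show "norm (fst p - z) < r" .
  qed
  have \<alpha>_le: "\<bar>\<alpha> i k x - \<alpha> i k z\<bar> \<le> L * norm (x - z)" if "good x" for i k x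
    using that L1_le[of i k] unfolding good_def by (meson mult_right_mono norm_ge_zero order_trans)
  have \<rho>_le: "\<bar>\<rho> x - \<rho> z\<bar> \<le> L * norm (x - z)" if "good x" for x
    using that L2_le unfolding good_def by (meson mult_right_mono norm_ge_zero order_trans)
  have d\<alpha>_le: "\<bar>d\<alpha> i k x\<bar> \<le> A" if "good x" for i k x
    using that A_le[of i k] unfolding good_def by (meson order_trans)
  have sum_le: "\<bar>\<Sum>i\<in>UNIV. \<Sum>k\<in>UNIV. s i k\<bar> \<le> N * c" if "\<And>i k. \<bar>s i k\<bar> \<le> c" for s :: "'n \<Rightarrow> 'n \<Rightarrow> real" and c
  proof -
    have "\<bar>\<Sum>i\<in>UNIV. \<Sum>k\<in>UNIV. s i k\<bar> \<le> (\<Sum>i\<in>(UNIV::'n set). \<Sum>k\<in>(UNIV::'n set). c)"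
      by (intro order_trans[OF sum_abs] sum_mono that)
    then show ?thesis by (simp add: N_def)
  qed
  show ?thesis
  proof (rule exI[of _ R0], rule exI[of _ K], intro conjI allI impI)
    show "0 < R0" using r b by (simp add: R0_def)
    have "0 \<le> N * (A * \<beta>0 + L * \<beta>0) + L" using A0 L0 \<beta>0 by (simp add: N_def)
    then show "0 \<le> K" using b by (simp add: K_def)
    fix p assume qp: "q p \<le> R0\<^sup>2"
    define x y where "x = fst p" and "y = fst p - z"
    have g: "good x" using good[OF qp] by (simp add: x_def)
    then show "fst p \<in> \<Omega>" by (simp add: good_def x_def)
    have Kr: "c * norm y \<le> K * sqrt (q p)"
      if "0 \<le> c" "c \<le> max (N * (A * \<beta>0 + L * \<beta>0) + L) (N * (L * \<beta>0 * \<beta>0 / b) + L)" for c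
    proof -
      have "c * norm y \<le> max (N * (A * \<beta>0 + L * \<beta>0) + L) (N * (L * \<beta>0 * \<beta>0 / b) + L) * (sqrt (q p) / sqrt b)"
        using that y_le[of p] by (intro mult_mono) (auto simp: y_def)
      then show ?thesis by (simp add: K_def)
    qed
    have "(\<Sum>i\<in>UNIV. \<Sum>k\<in>UNIV. \<alpha> i k z * B $ k $ i) = CARD('n) * \<rho> z" by (simp add: frozen)
    then have "D x + \<rho> x - (CARD('n) + 1) * \<rho> z
      = (\<Sum>i\<in>UNIV. \<Sum>k\<in>UNIV. d\<alpha> i k x * By k x + (\<alpha> i k x - \<alpha> i k z) * B $ k $ i) + (\<rho> x - \<rho> z)"
      by (simp add: D_def algebra_simps sum.distrib sum_subtractf)
    also have "\<bar>\<dots>\<bar> \<le> N * ((A * \<beta>0 + L * \<beta>0) * norm y) + L * norm y"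
    proof (rule order_trans[OF abs_triangle_ineq add_mono[OF sum_le]])
      show "\<bar>\<rho> x - \<rho> z\<bar> \<le> L * norm y" using \<rho>_le[OF g] by (simp add: x_def y_def)
      fix i k
      have "\<bar>d\<alpha> i k x * By k x\<bar> \<le> A * (\<beta>0 * norm y)"
        unfolding abs_mult using d\<alpha>_le[OF g] By_le[of k x] A0 by (intro mult_mono) (auto simp: x_def y_def)
      moreover have "\<bar>(\<alpha> i k x - \<alpha> i k z) * B $ k $ i\<bar> \<le> (L * norm y) * \<beta>0"
        unfolding abs_mult using \<alpha>_le[OF g] B_le[of k i] L0 by (intro mult_mono) (auto simp: x_def y_def)
      ultimately show "\<bar>d\<alpha> i k x * By k x + (\<alpha> i k x - \<alpha> i k z) * B $ k $ i\<bar> \<le> (A * \<beta>0 + L * \<beta>0) * norm y"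
        by (simp add: algebra_simps)
    qed
    also have "\<dots> = (N * (A * \<beta>0 + L * \<beta>0) + L) * norm y" by (simp add: algebra_simps)
    also have "\<dots> \<le> K * sqrt (q p)"
      using A0 L0 \<beta>0 by (intro Kr) (auto simp: N_def)
    finally show "\<bar>D (fst p) + \<rho> (fst p) - (CARD('n) + 1) * \<rho> z\<bar> \<le> K * sqrt (q p)" by (simp add: x_def)
    have \<alpha>B: "(\<Sum>k\<in>UNIV. \<alpha> i k z * By k x) = \<rho> z * y $ i" for i
    proof -
      have "(\<Sum>k\<in>UNIV. \<alpha> i k z * By k x) = (\<Sum>k\<in>UNIV. \<Sum>l\<in>UNIV. \<alpha> i k z * B $ k $ l * y $ l)"
        by (simp add: By_def matrix_vector_mult_def sum_distrib_left mult.assoc x_def y_def)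
      also have "\<dots> = (\<Sum>l\<in>UNIV. (\<Sum>k\<in>UNIV. \<alpha> i k z * B $ k $ l) * y $ l)"
        by (subst sum.swap) (simp add: sum_distrib_right)
      also have "\<dots> = \<rho> z * y $ i" by (simp add: frozen if_distrib[of "\<lambda>u. u * _"] cong: if_cong)
      finally show ?thesis .
    qed
    have "(\<Sum>i\<in>UNIV. \<Sum>k\<in>UNIV. \<alpha> i k z * By i x * By k x) = (\<Sum>i\<in>UNIV. By i x * (\<Sum>k\<in>UNIV. \<alpha> i k z * By k x))"
      by (simp add: sum_distrib_left algebra_simps)
    also have "\<dots> = \<rho> z * (y \<bullet> (B *v y))"
      unfolding \<alpha>B by (simp add: inner_vec_def sum_distrib_left By_def x_def y_def algebra_simps)
    finally have "P p - \<rho> z * q p = (\<Sum>i\<in>UNIV. \<Sum>k\<in>UNIV. (\<alpha> i k x - \<alpha> i k z) * By i x * By k x) + (\<rho> x - \<rho> z) * (snd p)\<^sup>2"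
      by (simp add: P_def q_def x_def y_def algebra_simps sum.distrib sum_subtractf)
    also have "\<bar>\<dots>\<bar> \<le> N * ((L * \<beta>0 * \<beta>0 / b) * norm y * q p) + L * norm y * q p"
    proof (rule order_trans[OF abs_triangle_ineq add_mono[OF sum_le]])
      have "(snd p)\<^sup>2 \<le> q p" using b(1) b(2)[of "fst p - z"] by (simp add: q_def) (smt (verit) mult_nonneg_nonneg zero_le_power2)
      then show "\<bar>(\<rho> x - \<rho> z) * (snd p)\<^sup>2\<bar> \<le> L * norm y * q p"
        unfolding abs_mult using \<rho>_le[OF g] L0 by (intro mult_mono) (auto simp: x_def y_def)
      fix i k
      have "b * (norm y)\<^sup>2 \<le> q p" using b(2)[of y] by (simp add: q_def y_def add_increasing2)
      then have yq: "(norm y)\<^sup>2 \<le> q p / b" using b(1) by (simp add: field_simps)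
      have "\<bar>(\<alpha> i k x - \<alpha> i k z) * By i x * By k x\<bar> \<le> (L * norm y) * (\<beta>0 * norm y) * (\<beta>0 * norm y)"
        unfolding abs_mult using \<alpha>_le[OF g] By_le[of _ x] L0 \<beta>0(1)
        by (intro mult_mono) (auto simp: x_def y_def)
      also have "\<dots> = (L * \<beta>0 * \<beta>0 * norm y) * (norm y)\<^sup>2" by (simp add: power2_eq_square)
      also have "\<dots> \<le> (L * \<beta>0 * \<beta>0 * norm y) * (q p / b)" using L0 \<beta>0(1) by (intro mult_left_mono yq) auto
      finally show "\<bar>(\<alpha> i k x - \<alpha> i k z) * By i x * By k x\<bar> \<le> (L * \<beta>0 * \<beta>0 / b) * norm y * q p" by simp
    qed
    also have "\<dots> = ((N * (L * \<beta>0 * \<beta>0 / b) + L) * norm y) * q p" by (simp add: algebra_simps)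
    also have "\<dots> \<le> (K * sqrt (q p)) * q p"
      using L0 \<beta>0 b q_nonneg by (intro mult_right_mono Kr) (auto simp: N_def)
    finally show "\<bar>P p - \<rho> z * q p\<bar> \<le> K * q p * sqrt (q p)" by (simp add: mult_ac)
  qed
qed

end

text \<open>
  \<open>vd i\<close> and \<open>vt\<close>, \<open>vtt\<close> are the derivatives of \<open>v\<close> in the space and time variables, and \<open>Yd i\<close> is the \<open>i\<close>-th
  derivative of the \<open>i\<close>-th component of the flux \<open>\<alpha> \<nabla>v\<close>.
\<close>

locale harmonic_function = elliptic_coefficients \<Omega> z \<alpha> d\<alpha> \<rho> B
  for \<Omega> :: "(real^'n::finite) set" and z \<alpha> d\<alpha> \<rho> B +
  fixes v vt vtt :: "(real^'n) \<times> real \<Rightarrow> real" and vd Yd :: "'n \<Rightarrow> (real^'n) \<times> real \<Rightarrow> real"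
  assumes v_cont: "continuous_on (\<Omega> \<times> UNIV) v" "continuous_on (\<Omega> \<times> UNIV) vt" "continuous_on (\<Omega> \<times> UNIV) vtt"
    "\<And>i. continuous_on (\<Omega> \<times> UNIV) (vd i)" "\<And>i. continuous_on (\<Omega> \<times> UNIV) (Yd i)"
    and v_x: "\<And>p i. fst p \<in> \<Omega> \<Longrightarrow> ((\<lambda>s. v (p + s *\<^sub>R (axis i 1, 0))) has_real_derivative vd i p) (at 0)"
    and v_t: "\<And>p. fst p \<in> \<Omega> \<Longrightarrow> ((\<lambda>s. v (p + s *\<^sub>R (0, 1))) has_real_derivative vt p) (at 0)"
    and vt_t: "\<And>p. fst p \<in> \<Omega> \<Longrightarrow> ((\<lambda>s. vt (p + s *\<^sub>R (0, 1))) has_real_derivative vtt p) (at 0)"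
    and Y_x: "\<And>p i. fst p \<in> \<Omega> \<Longrightarrow>
      ((\<lambda>s. \<Sum>k\<in>UNIV. \<alpha> i k (fst p + s *\<^sub>R axis i 1) * vd k (p + s *\<^sub>R (axis i 1, 0))) has_real_derivative Yd i p) (at 0)"
    and eq: "\<And>p. fst p \<in> \<Omega> \<Longrightarrow> (\<Sum>i\<in>UNIV. Yd i p) + \<rho> (fst p) * vtt p = 0"

section \<open>Testing the equation with a function of the squared distance\<close>

context elliptic_coefficients
begin

lemma continuous_q: "continuous_on S q"
  unfolding q_def
  by (intro continuous_intros bounded_linear.continuous_on[OF matrix_vector_mul_bounded_linear])

lemma continuous_By: "continuous_on S (By k)"
  unfolding By_def
  by (intro continuous_intros bounded_linear.continuous_on[OF matrix_vector_mul_bounded_linear])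

lemma By_x: "By k (x + s *\<^sub>R axis i 1) = By k x + s * B $ k $ i"
proof -
  have "x + s *\<^sub>R axis i 1 - z = (x - z) + s *\<^sub>R axis i 1" by simp
  then show ?thesis
    by (simp only: By_def matrix_vector_right_distrib matrix_vector_mult_scaleR)
       (simp add: matrix_vector_mul_component inner_axis)
qed

lemma q_x: "((\<lambda>s. q (p + s *\<^sub>R (axis i 1, 0))) has_real_derivative 2 * By i (fst p)) (at 0)"
proof -
  define y where "y = fst p - z"
  define e :: "real^'n" where "e = axis i 1"
  have 1: "e \<bullet> (B *v y) = By i (fst p)" by (simp add: e_def By_def y_def inner_axis')
  have "y \<bullet> (B *v e) = (y v* B) \<bullet> e" by (rule dot_lmul_matrix[symmetric])
  also have "y v* B = B *v y" using transpose_matrix_vector[of B y] by (simp add: B_sym)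
  finally have 2: "y \<bullet> (B *v e) = By i (fst p)" using 1 by (simp add: inner_commute)
  have "q (p + s *\<^sub>R (axis i 1, 0)) = y \<bullet> (B *v y) + 2 * s * By i (fst p) + s\<^sup>2 * (e \<bullet> (B *v e)) + (snd p)\<^sup>2" for s
  proof -
    have "fst (p + s *\<^sub>R (axis i 1, 0)) - z = y + s *\<^sub>R e" by (simp add: y_def e_def)
    then have "q (p + s *\<^sub>R (axis i 1, 0)) = (y + s *\<^sub>R e) \<bullet> (B *v (y + s *\<^sub>R e)) + (snd p)\<^sup>2"
      by (simp add: q_def)
    then show ?thesis
      by (simp add: matrix_vector_right_distrib matrix_vector_mult_scaleR inner_add_left inner_add_right 1 2 power2_eq_square algebra_simps)
  qed
  then show ?thesis by (auto intro!: derivative_eq_intros)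
qed

lemma q_t: "((\<lambda>s. q (p + s *\<^sub>R (0, 1))) has_real_derivative 2 * snd p) (at 0)"
proof -
  have "q (p + s *\<^sub>R (0, 1)) = (fst p - z) \<bullet> (B *v (fst p - z)) + (snd p + s)\<^sup>2" for s
    by (simp add: q_def)
  then show ?thesis by (auto intro!: derivative_eq_intros)
qed

lemma compact_sublevel: "compact {p. q p \<le> r}"
proof -
  obtain b where b: "0 < b" "\<And>y. b * (norm y)\<^sup>2 \<le> y \<bullet> (B *v y)" using pos_def_coercive[OF B_pos] by metis
  have "closed {p. q p \<le> r}"
    using continuous_closed_vimage[of "{..r}" q] continuous_q by (auto simp: vimage_def intro!: closed_Collect_le continuous_on_const)
  moreover have "norm p \<le> sqrt (\<bar>r\<bar> / b) + sqrt \<bar>r\<bar> + norm (z, 0::real)" if "q p \<le> r" for p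
  proof -
    have *: "b * (norm (fst p - z))\<^sup>2 + (snd p)\<^sup>2 \<le> \<bar>r\<bar>" using that b(2)[of "fst p - z"] by (simp add: q_def)
    have "0 \<le> b * (norm (fst p - z))\<^sup>2" using b(1) by simp
    then have "(snd p)\<^sup>2 \<le> \<bar>r\<bar>" using * by linarith
    then have 1: "\<bar>snd p\<bar> \<le> sqrt \<bar>r\<bar>" by (metis real_sqrt_abs real_sqrt_le_mono)
    have "b * (norm (fst p - z))\<^sup>2 \<le> \<bar>r\<bar>" using * zero_le_power2[of "snd p"] by linarith
    then have "(norm (fst p - z))\<^sup>2 \<le> \<bar>r\<bar> / b" using b(1) by (simp add: field_simps)
    then have 2: "norm (fst p - z) \<le> sqrt (\<bar>r\<bar> / b)" by (rule real_le_rsqrt)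
    have "norm (p - (z, 0)) \<le> norm (fst p - z) + norm (snd p)"
      using norm_Pair_le[of "fst p - z" "snd p"] by (cases p) simp
    moreover have "norm p \<le> norm (p - (z, 0)) + norm (z, 0::real)"
      using norm_triangle_ineq[of "p - (z, 0)" "(z, 0)"] by simp
    ultimately show "norm p \<le> sqrt (\<bar>r\<bar> / b) + sqrt \<bar>r\<bar> + norm (z, 0::real)" using 1 2 by simp
  qed
  ultimately show ?thesis unfolding compact_eq_bounded_closed bounded_iff by blast
qed

end

context harmonic_function
begin

definition Y :: "'n \<Rightarrow> (real^'n) \<times> real \<Rightarrow> real"
  where "Y i p = (\<Sum>k\<in>UNIV. \<alpha> i k (fst p) * vd k p)"

text \<open>Half the spatial flux of \<open>q\<close>, that is, \<open>\<alpha>\<close> applied to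
  half its gradient. The functions \<open>dg i\<close> below are the diagonal derivatives, whose sum
  is \<open>D\<close>.\<close>

definition g :: "'n \<Rightarrow> real^'n \<Rightarrow> real"
  where "g i x = (\<Sum>k\<in>UNIV. \<alpha> i k x * By k x)"

definition dg :: "'n \<Rightarrow> real^'n \<Rightarrow> real"
  where "dg i x = (\<Sum>k\<in>UNIV. d\<alpha> i k x * By k x + \<alpha> i k x * B $ k $ i)"

lemma g_x:
  assumes "x \<in> \<Omega>"
  shows "((\<lambda>s. g i (x + s *\<^sub>R axis i 1)) has_real_derivative dg i x) (at 0)"
  unfolding g_def dg_def
proof (rule DERIV_sum)
  fix k
  show "((\<lambda>s. \<alpha> i k (x + s *\<^sub>R axis i 1) * By k (x + s *\<^sub>R axis i 1)) has_real_derivative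
      d\<alpha> i k x * By k x + \<alpha> i k x * B $ k $ i) (at 0)"
    unfolding By_x by (rule derivative_eq_intros \<alpha>_deriv[OF assms] refl)+ simp
qed

text \<open>Symmetry of \<open>\<alpha>\<close>. This identity is what cancels the mixed terms,
  containing one gradient of \<open>v\<close> and one of \<open>q\<close>, in the divergence
  computed below.\<close>

lemma vd_g: "fst p \<in> \<Omega> \<Longrightarrow> (\<Sum>i\<in>UNIV. vd i p * g i (fst p)) = (\<Sum>i\<in>UNIV. By i (fst p) * Y i p)"
proof -
  assume p: "fst p \<in> \<Omega>"
  have "(\<Sum>i\<in>UNIV. vd i p * g i (fst p)) = (\<Sum>i\<in>UNIV. \<Sum>k\<in>UNIV. \<alpha> k i (fst p) * By k (fst p) * vd i p)"
    unfolding g_def sum_distrib_left by (intro sum.cong refl) (simp add: \<alpha>_sym[OF p] algebra_simps)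
  also have "\<dots> = (\<Sum>k\<in>UNIV. By k (fst p) * Y k p)"
    unfolding Y_def sum_distrib_left by (subst sum.swap) (intro sum.cong refl, simp add: algebra_simps)
  finally show ?thesis .
qed

text \<open>
  With \<open>F' = - h\<close> the function \<open>\<psi> = F \<circ> q\<close> is the test function: the vector field integrated here
  is, up to a factor, \<open>v\<^sup>2 A\<nabla>\<psi> - \<psi> A\<nabla>(v\<^sup>2)\<close> with the coefficient matrix \<open>A = diag (\<alpha>, \<rho>)\<close>, and
  \<open>div (A\<nabla>(v\<^sup>2)) = 2 A\<nabla>v\<cdot>\<nabla>v \<ge> 0\<close>.
\<close>

lemma weighted_integral_nonpos:
  assumes R: "0 < R" "R < R2" and \<Omega>R: "\<And>p. q p \<le> R2\<^sup>2 \<Longrightarrow> fst p \<in> \<Omega>"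
    and a: "0 < a" and h': "\<And>\<tau>. -a < \<tau> \<Longrightarrow> (h has_real_derivative h' \<tau>) (at \<tau>)"
    and ch': "continuous_on {-a<..} h'" and h_nn: "\<And>\<tau>. -a < \<tau> \<Longrightarrow> 0 \<le> h \<tau>"
    and h0: "\<And>\<tau>. R\<^sup>2 \<le> \<tau> \<Longrightarrow> h \<tau> = 0 \<and> h' \<tau> = 0"
    and lower: "\<And>p. q p \<le> R\<^sup>2 \<Longrightarrow> l p \<le> h (q p) * (D (fst p) + \<rho> (fst p)) + 2 * h' (q p) * P p"
    and l: "integrable lborel (\<lambda>p. indicator {p. q p \<le> R\<^sup>2} p * ((v p)\<^sup>2 * l p))"
  shows "(LINT p|lborel. indicator {p. q p \<le> R\<^sup>2} p * ((v p)\<^sup>2 * l p)) \<le> 0"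
proof -
  \<comment> \<open>An antiderivative needs continuity on a closed half-line; since \<open>q\<close>
    is nonnegative, halving \<open>a\<close> costs nothing.\<close>
  have "continuous_on {-a/2..} h"
    by (rule DERIV_continuous_on[OF has_field_derivative_at_within[OF h']]) (use a in auto)
  note ch = this
  have aR: "-a/2 < R\<^sup>2" using a zero_le_power2[of R] by linarith
  have nn: "0 \<le> h \<tau>" if "-a/2 \<le> \<tau>" for \<tau> using that a by (intro h_nn) auto
  have z: "h \<tau> = 0" if "R\<^sup>2 \<le> \<tau>" for \<tau> using h0[OF that] by simp
  obtain F where F: "\<And>\<tau>. -a/2 < \<tau> \<Longrightarrow> (F has_real_derivative - h \<tau>) (at \<tau>)"
    "\<And>\<tau>. -a/2 < \<tau> \<Longrightarrow> 0 \<le> F \<tau>" "\<And>\<tau>. R\<^sup>2 \<le> \<tau> \<Longrightarrow> F \<tau> = 0"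
    using antiderivative_vanishing_above[OF aR ch nn z] by auto
  \<comment> \<open>The strict inequality \<open>R < R2\<close> leaves room between the compact
    support \<open>K\<close> and the open set \<open>W\<close> on which all derivatives are
    available.\<close>
  define W where "W = {p. q p < R2\<^sup>2}"
  define K where "K = {p. q p \<le> R\<^sup>2}"
  have "R\<^sup>2 < R2\<^sup>2" using R by (intro power_strict_mono) auto
  then have KW: "K \<subseteq> W" by (auto simp: K_def W_def)
  have K: "compact K" unfolding K_def by (rule compact_sublevel)
  have W: "open W" unfolding W_def by (intro open_Collect_less continuous_q continuous_on_const)
  have W\<Omega>: "fst p \<in> \<Omega>" if "p \<in> W" for p using that \<Omega>R by (auto simp: W_def)
  then have W\<Omega>': "W \<subseteq> \<Omega> \<times> UNIV" by (auto simp: mem_Times_iff)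
  have qa: "-a < q p" "-a/2 < q p" for p using q_nonneg[of p] a by auto
  have q0: "h (q p) = 0" "h' (q p) = 0" "F (q p) = 0" if "p \<in> W - K" for p
    using that h0 F(3) by (auto simp: K_def)
  have h_q: "((\<lambda>s. h (q (p + s *\<^sub>R e))) has_real_derivative h' (q p) * d) (at 0)"
    if "((\<lambda>s. q (p + s *\<^sub>R e)) has_real_derivative d) (at 0)" for p e d
    using DERIV_chain2[of h "h' (q p)" "\<lambda>s. q (p + s *\<^sub>R e)" 0 d] h'[OF qa(1)] that by simp
  have F_q: "((\<lambda>s. F (q (p + s *\<^sub>R e))) has_real_derivative - h (q p) * d) (at 0)"
    if "((\<lambda>s. q (p + s *\<^sub>R e)) has_real_derivative d) (at 0)" for p e d
    using DERIV_chain2[of F "- h (q p)" "\<lambda>s. q (p + s *\<^sub>R e)" 0 d] F(1)[OF qa(2)] that by simp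
  have fstW: "continuous_on W (\<lambda>p. f (fst p))" if "continuous_on \<Omega> f" for f :: "real^'n \<Rightarrow> real"
    using W\<Omega> by (intro continuous_on_compose2[OF that] continuous_intros) auto
  have c\<alpha>: "continuous_on W (\<lambda>p. \<alpha> i k (fst p))" for i k
    using \<alpha>_diff by (intro fstW continuous_at_imp_continuous_on ballI differentiable_imp_continuous_within)
  have c\<rho>: "continuous_on W (\<lambda>p. \<rho> (fst p))"
    using \<rho>_diff by (intro fstW continuous_at_imp_continuous_on ballI differentiable_imp_continuous_within)
  have cd\<alpha>: "continuous_on W (\<lambda>p. d\<alpha> i k (fst p))" for i k by (intro fstW d\<alpha>_cont)
  have cBy: "continuous_on W (\<lambda>p. By k (fst p))" for k by (intro fstW continuous_By)
  have cv: "continuous_on W v" "continuous_on W vt" "continuous_on W vtt"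
     "\<And>i. continuous_on W (vd i)" "\<And>i. continuous_on W (Yd i)"
    using v_cont W\<Omega>' by (auto intro: continuous_on_subset)
  have "continuous_on {-a<..} h" by (rule DERIV_continuous_on[OF has_field_derivative_at_within[OF h']]) auto
  then have ch: "continuous_on W (\<lambda>p. h (q p))" "continuous_on W (\<lambda>p. h' (q p))"
    using qa ch' by (auto intro!: continuous_on_compose2[OF _ continuous_q])
  have "continuous_on {-a/2<..} F" by (rule DERIV_continuous_on[OF has_field_derivative_at_within[OF F(1)]]) auto
  then have cF: "continuous_on W (\<lambda>p. F (q p))"
    using qa by (auto intro!: continuous_on_compose2[OF _ continuous_q])
  have cY: "continuous_on W (Y i)" for i unfolding Y_def by (intro continuous_intros c\<alpha> cv)
  have cg: "continuous_on W (\<lambda>p. g i (fst p))" "continuous_on W (\<lambda>p. dg i (fst p))" for i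
    unfolding g_def dg_def by (intro continuous_intros c\<alpha> cd\<alpha> cBy)+
  \<comment> \<open>The spatial components of the field; \<open>X'\<close> is the time component,
    with \<open>\<rho>\<close> and \<open>snd p\<close> in place of \<open>\<alpha>\<close> and
    \<open>By\<close>. Each is differentiated only in its own direction, as the divergence
    requires.\<close>
  define X where "X i p = (v p)\<^sup>2 * h (q p) * g i (fst p) + F (q p) * v p * Y i p" for i p
  define dX where "dX i p = 2 * v p * vd i p * h (q p) * g i (fst p) + (v p)\<^sup>2 * (h' (q p) * (2 * By i (fst p))) * g i (fst p)
     + (v p)\<^sup>2 * h (q p) * dg i (fst p) - h (q p) * (2 * By i (fst p)) * v p * Y i p + F (q p) * vd i p * Y i p + F (q p) * v p * Yd i p" for i p
  define X' where "X' p = (v p)\<^sup>2 * h (q p) * (\<rho> (fst p) * snd p) + F (q p) * \<rho> (fst p) * v p * vt p" for p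
  define dX' where "dX' p = 2 * v p * vt p * h (q p) * (\<rho> (fst p) * snd p) + (v p)\<^sup>2 * (h' (q p) * (2 * snd p)) * (\<rho> (fst p) * snd p)
     + (v p)\<^sup>2 * h (q p) * \<rho> (fst p) - h (q p) * (2 * snd p) * \<rho> (fst p) * v p * vt p + F (q p) * \<rho> (fst p) * (vt p)\<^sup>2 + F (q p) * \<rho> (fst p) * v p * vtt p" for p
  have iX: "integrable lborel (\<lambda>p. if p \<in> W then dX i p else 0)" "(LINT p|lborel. (if p \<in> W then dX i p else 0)) = 0" for i
  proof -
    have 1: "continuous_on W (X i)" unfolding X_def by (intro continuous_intros cv ch cg cF cY)
    have 2: "continuous_on W (dX i)" unfolding dX_def by (intro continuous_intros cv ch cg cF cY cBy)
    have 3: "((\<lambda>s. X i (p + s *\<^sub>R (axis i 1, 0))) has_real_derivative dX i p) (at 0)" if "p \<in> W" for p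
    proof -
      have p: "fst p \<in> \<Omega>" by (rule W\<Omega>[OF that])
      have Y': "((\<lambda>s. Y i (p + s *\<^sub>R (axis i 1, 0))) has_real_derivative Yd i p) (at 0)"
        using Y_x[OF p, of i] unfolding Y_def by simp
      have g': "((\<lambda>s. g i (fst (p + s *\<^sub>R (axis i 1, 0)))) has_real_derivative dg i (fst p)) (at 0)"
        using g_x[OF p, of i] by simp
      show ?thesis unfolding X_def dX_def
        by (rule derivative_eq_intros v_x[OF p] h_q[OF q_x] F_q[OF q_x] Y' g' refl)+
          (simp add: algebra_simps power2_eq_square flip: zero_prod_def)
    qed
    have 4: "X i p = 0 \<and> dX i p = 0" if "p \<in> W - K" for p using q0[OF that] by (simp add: X_def dX_def)
    show "integrable lborel (\<lambda>p. if p \<in> W then dX i p else 0)" "(LINT p|lborel. (if p \<in> W then dX i p else 0)) = 0"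
      using integral_directional_derivative_open[OF W K KW 1 2 3 4] by auto
  qed
  have iX': "integrable lborel (\<lambda>p. if p \<in> W then dX' p else 0)" "(LINT p|lborel. (if p \<in> W then dX' p else 0)) = 0"
  proof -
    have 1: "continuous_on W X'" unfolding X'_def by (intro continuous_intros cv ch c\<rho> cF)
    have 2: "continuous_on W dX'" unfolding dX'_def by (intro continuous_intros cv ch c\<rho> cF)
    have 3: "((\<lambda>s. X' (p + s *\<^sub>R (0, 1))) has_real_derivative dX' p) (at 0)" if "p \<in> W" for p
    proof -
      have p: "fst p \<in> \<Omega>" by (rule W\<Omega>[OF that])
      have g': "((\<lambda>s. \<rho> (fst (p + s *\<^sub>R (0, 1)))) has_real_derivative 0) (at 0)" by simp
      have t': "((\<lambda>s. snd (p + s *\<^sub>R (0, 1))) has_real_derivative 1) (at 0)"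
        by (auto intro!: derivative_eq_intros)
      show ?thesis unfolding X'_def dX'_def
        by (rule derivative_eq_intros v_t[OF p] vt_t[OF p] h_q[OF q_t] F_q[OF q_t] g' t' refl)+
          (simp add: algebra_simps power2_eq_square flip: zero_prod_def)
    qed
    have 4: "X' p = 0 \<and> dX' p = 0" if "p \<in> W - K" for p using q0[OF that] by (simp add: X'_def dX'_def)
    show "integrable lborel (\<lambda>p. if p \<in> W then dX' p else 0)" "(LINT p|lborel. (if p \<in> W then dX' p else 0)) = 0"
      using integral_directional_derivative_open[OF W K KW 1 2 3 4] by auto
  qed
  define T where "T p = (\<Sum>i\<in>UNIV. if p \<in> W then dX i p else 0) + (if p \<in> W then dX' p else 0)" for p
  have iT: "integrable lborel T" "integral\<^sup>L lborel T = 0"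
    unfolding T_def using iX iX' by (simp_all add: Bochner_Integration.integral_sum Bochner_Integration.integrable_sum)
  \<comment> \<open>The mixed terms cancel, in space by \<open>vd_g\<close> and in time literally,
    and the terms with \<open>F (q p) * v p\<close> add up to zero by the equation for
    \<open>v\<close>. The energy of \<open>v\<close> is left with the nonnegative factor
    \<open>F (q p)\<close>.\<close>
  have T: "T p = (v p)\<^sup>2 * (h (q p) * (D (fst p) + \<rho> (fst p)) + 2 * h' (q p) * P p)
       + F (q p) * ((\<Sum>i\<in>UNIV. vd i p * Y i p) + \<rho> (fst p) * (vt p)\<^sup>2)" if "p \<in> W" for p
  proof -
    have p: "fst p \<in> \<Omega>" by (rule W\<Omega>[OF that])
    have D: "D (fst p) = (\<Sum>i\<in>UNIV. dg i (fst p))" by (simp add: D_def dg_def)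
    have P: "P p = (\<Sum>i\<in>UNIV. By i (fst p) * g i (fst p)) + \<rho> (fst p) * (snd p)\<^sup>2"
      by (simp add: P_def g_def sum_distrib_left algebra_simps)
    have "(\<Sum>i\<in>UNIV. dX i p) = 2 * v p * h (q p) * (\<Sum>i\<in>UNIV. vd i p * g i (fst p))
       + 2 * (v p)\<^sup>2 * h' (q p) * (\<Sum>i\<in>UNIV. By i (fst p) * g i (fst p))
       + (v p)\<^sup>2 * h (q p) * (\<Sum>i\<in>UNIV. dg i (fst p)) - 2 * v p * h (q p) * (\<Sum>i\<in>UNIV. By i (fst p) * Y i p)
       + F (q p) * (\<Sum>i\<in>UNIV. vd i p * Y i p) + F (q p) * v p * (\<Sum>i\<in>UNIV. Yd i p)"
      unfolding dX_def sum.distrib sum_subtractf sum_distrib_left by (simp add: algebra_simps)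
    also have "\<dots> = 2 * (v p)\<^sup>2 * h' (q p) * (\<Sum>i\<in>UNIV. By i (fst p) * g i (fst p))
       + (v p)\<^sup>2 * h (q p) * D (fst p) + F (q p) * (\<Sum>i\<in>UNIV. vd i p * Y i p) - F (q p) * v p * (\<rho> (fst p) * vtt p)"
      using eq[OF p] unfolding vd_g[OF p] D by (simp add: add_eq_0_iff2)
    finally show ?thesis using that unfolding T_def dX'_def P
      by (simp add: algebra_simps power2_eq_square flip: zero_prod_def)
  qed
  have le: "indicator {p. q p \<le> R\<^sup>2} p * ((v p)\<^sup>2 * l p) \<le> T p" for p
  proof (cases "p \<in> W")
    case False
    then have "p \<notin> K" using KW by auto
    with False show ?thesis by (simp add: T_def K_def)
  next
    case True
    have p: "fst p \<in> \<Omega>" by (rule W\<Omega>[OF True])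
    have "(\<Sum>i\<in>UNIV. vd i p * Y i p) = (\<Sum>i\<in>UNIV. \<Sum>k\<in>UNIV. \<alpha> i k (fst p) * vd i p * vd k p)"
      by (simp add: Y_def sum_distrib_left algebra_simps)
    then have "0 \<le> (\<Sum>i\<in>UNIV. vd i p * Y i p)" using \<alpha>_pos[OF p, of "\<lambda>i. vd i p"] by simp
    then have nn: "0 \<le> F (q p) * ((\<Sum>i\<in>UNIV. vd i p * Y i p) + \<rho> (fst p) * (vt p)\<^sup>2)"
      using F(2)[OF qa(2)[of p]] \<rho>_pos[OF p] by (intro mult_nonneg_nonneg add_nonneg_nonneg) auto
    show ?thesis
    proof (cases "p \<in> K")
      case True
      then have "(v p)\<^sup>2 * l p \<le> (v p)\<^sup>2 * (h (q p) * (D (fst p) + \<rho> (fst p)) + 2 * h' (q p) * P p)"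
        by (intro mult_left_mono lower) (auto simp: K_def)
      then show ?thesis using T[OF \<open>p \<in> W\<close>] nn True by (simp add: K_def)
    next
      case False
      then show ?thesis using q0[of p] T[OF True] True by (simp add: K_def)
    qed
  qed
  have "(LINT p|lborel. indicator {p. q p \<le> R\<^sup>2} p * ((v p)\<^sup>2 * l p)) \<le> integral\<^sup>L lborel T"
    by (intro integral_mono l iT le)
  then show ?thesis using iT by simp
qed

end

section \<open>The mean value inequality at the centre\<close>

context elliptic_coefficients
begin

text \<open>The upper bound places a ball of comparable radius inside a sublevel set of
  \<open>q\<close>; the lower bound makes small sublevel sets shrink to the centre.\<close>

lemma sublevel_bounds:
  "\<exists>\<kappa> b. 0 < \<kappa> \<and> 0 < b \<and> (\<forall>p. q p \<le> \<kappa> * (dist p (z, 0))\<^sup>2 \<and> (dist p (z, 0))\<^sup>2 \<le> b * q p)"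
proof -
  obtain b where b: "0 < b" "\<And>y. b * (norm y)\<^sup>2 \<le> y \<bullet> (B *v y)" using pos_def_coercive[OF B_pos] by metis
  obtain \<beta> where \<beta>: "0 < \<beta>" "\<And>y. norm (B *v y) \<le> \<beta> * norm y"
    using bounded_linear.pos_bounded[OF matrix_vector_mul_bounded_linear[of B]] by (metis mult.commute)
  have d: "(dist p (z, 0))\<^sup>2 = (norm (fst p - z))\<^sup>2 + (snd p)\<^sup>2" for p :: "(real^'n) \<times> real"
    by (simp add: dist_prod_def dist_norm)
  show ?thesis
  proof (rule exI[of _ "\<beta> + 1"], rule exI[of _ "1 / b + 1"], intro conjI allI)
    show "0 < \<beta> + 1" "0 < 1 / b + 1" using \<beta> b by (auto intro: add_pos_pos)
    fix p :: "(real^'n) \<times> real"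
    define y where "y = fst p - z"
    have "y \<bullet> (B *v y) \<le> norm y * norm (B *v y)" by (rule norm_cauchy_schwarz)
    also have "\<dots> \<le> norm y * (\<beta> * norm y)" by (intro mult_left_mono \<beta>) simp
    finally have "y \<bullet> (B *v y) \<le> \<beta> * (norm y)\<^sup>2"
      by (simp add: power2_eq_square mult.left_commute)
    moreover have "0 \<le> (norm y)\<^sup>2" "0 \<le> \<beta> * (snd p)\<^sup>2" using \<beta> by auto
    ultimately show "q p \<le> (\<beta> + 1) * (dist p (z, 0))\<^sup>2"
      unfolding d q_def y_def[symmetric] distrib_left distrib_right by linarith
    have "0 \<le> b * (norm y)\<^sup>2" using b by simp
    then have "(snd p)\<^sup>2 \<le> q p" "b * (norm y)\<^sup>2 \<le> q p" 
      using b(2)[of y] zero_le_power2[of "snd p"] unfolding q_def y_def[symmetric] by linarith+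
    then have "(snd p)\<^sup>2 \<le> q p" "(norm y)\<^sup>2 \<le> q p / b" using b(1) by (simp_all add: field_simps)
    then show "(dist p (z, 0))\<^sup>2 \<le> (1 / b + 1) * q p"
      unfolding d y_def[symmetric] by (simp add: distrib_right)
  qed
qed

text \<open>Inserting the radial weight bounds \<open>\<epsilon> ^ -(n + 1)\<close> times the
  integral of \<open>v\<^sup>2\<close> over the core by a constant times \<open>R ^ -(n + 1)\<close>
  times that over the large set. The core has volume at least a multiple of
  \<open>\<epsilon> ^ (n + 1)\<close>, so \<open>\<epsilon>\<close> cancels. No limit is taken: one
  \<open>\<epsilon>\<close>, small enough for \<open>v\<^sup>2\<close> to exceed half its central
  value on the core, loses only a factor \<open>2\<close>. It depends on \<open>v\<close>, the
  constants do not.\<close>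

lemma mean_value_inequality:
  "\<exists>R1 C. 0 < R1 \<and> R1 \<le> 1 \<and> 0 < C \<and> (\<forall>p. q p \<le> R1\<^sup>2 \<longrightarrow> fst p \<in> \<Omega>) \<and>
    (\<forall>R v vt vtt vd Yd. harmonic_function \<Omega> z \<alpha> d\<alpha> \<rho> B v vt vtt vd Yd \<longrightarrow> 0 < R \<longrightarrow> R \<le> R1 \<longrightarrow>
      (v (z, 0))\<^sup>2 \<le> C / R ^ (CARD('n) + 1) * (LINT p|lborel. indicator {p. q p \<le> R\<^sup>2} p * (v p)\<^sup>2))"
proof -
  obtain R0 K where R0: "0 < R0" and K: "0 \<le> K" and eb:
    "\<And>p. q p \<le> R0\<^sup>2 \<Longrightarrow> fst p \<in> \<Omega>"
    "\<And>p. q p \<le> R0\<^sup>2 \<Longrightarrow> \<bar>D (fst p) + \<rho> (fst p) - (CARD('n) + 1) * \<rho> z\<bar> \<le> K * sqrt (q p)"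
    "\<And>p. q p \<le> R0\<^sup>2 \<Longrightarrow> \<bar>P p - \<rho> z * q p\<bar> \<le> K * q p * sqrt (q p)"
    using error_bounds by blast
  define n where "n = CARD('n)"
  define rw where "rw R \<epsilon> c C h h' \<longleftrightarrow> (\<forall>\<tau>>-\<epsilon>\<^sup>2. (h has_real_derivative h' \<tau>) (at \<tau>)) \<and> continuous_on {-\<epsilon>\<^sup>2<..} h' \<and>
        (\<forall>\<tau>>-\<epsilon>\<^sup>2. 0 \<le> h \<tau>) \<and> (\<forall>\<tau>\<ge>R\<^sup>2. h \<tau> = 0 \<and> h' \<tau> = 0) \<and>
        (\<forall>\<tau> D P. 0 \<le> \<tau> \<longrightarrow> \<tau> \<le> R\<^sup>2 \<longrightarrow> \<bar>D - (n + 1) * \<rho> z\<bar> \<le> K * sqrt \<tau> \<longrightarrow>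
            \<bar>P - \<rho> z * \<tau>\<bar> \<le> K * \<tau> * sqrt \<tau> \<longrightarrow>
          h \<tau> * D + 2 * h' \<tau> * P \<ge> (if \<tau> \<le> \<epsilon>\<^sup>2 then c / \<epsilon> ^ (n + 1) else 0) - C / R ^ (n + 1))" for R \<epsilon> c C h h'
  have "\<exists>R0 c C. 0 < R0 \<and> R0 \<le> 1 \<and> 0 < c \<and> 0 \<le> C \<and>
    (\<forall>R \<epsilon>. 0 < R \<longrightarrow> R \<le> R0 \<longrightarrow> 0 < \<epsilon> \<longrightarrow> 2 * \<epsilon>\<^sup>2 \<le> R\<^sup>2 \<longrightarrow> (\<exists>h h'. rw R \<epsilon> c C h h'))"
    unfolding rw_def by (rule radial_weight_exists[OF K \<rho>_pos[OF \<Omega>(2)], of n])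
  then obtain R0' c C where R0': "0 < R0'" "R0' \<le> 1" and c: "0 < c" and C: "0 \<le> C"
    and rw: "\<And>R \<epsilon>. 0 < R \<Longrightarrow> R \<le> R0' \<Longrightarrow> 0 < \<epsilon> \<Longrightarrow> 2 * \<epsilon>\<^sup>2 \<le> R\<^sup>2 \<Longrightarrow> \<exists>h h'. rw R \<epsilon> c C h h'"
    by auto
  obtain \<kappa> b where \<kappa>b: "0 < \<kappa>" "0 < b"
    "\<And>p. q p \<le> \<kappa> * (dist p (z, 0))\<^sup>2" "\<And>p. (dist p (z, 0))\<^sup>2 \<le> b * q p" using sublevel_bounds by blast
  define V where "V = unit_ball_vol (real (n + 1))"
  have V: "0 < V" by (simp add: V_def)
  \<comment> \<open>The constant obtained by solving for the central value, plus \<open>1\<close>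
    because \<open>C\<close> may be \<open>0\<close>.\<close>
  define C' where "C' = 2 * C * sqrt \<kappa> ^ (n + 1) / (c * V) + 1"
  have C': "0 < C'" using C c V \<kappa>b(1,2) by (auto simp: C'_def intro!: add_nonneg_pos)
  \<comment> \<open>Half of \<open>R0\<close>, so that every \<open>R \<le> R1\<close> is strictly
    below \<open>R0\<close>.\<close>
  define R1 where "R1 = min (R0 / 2) R0'"
  have R1: "0 < R1" "R1 \<le> 1" "R1 < R0" "R1 \<le> R0'" using R0 R0' by (auto simp: R1_def)
  show ?thesis
  proof (rule exI[of _ R1], rule exI[of _ C'], intro conjI allI impI)
    show "0 < R1" "R1 \<le> 1" "0 < C'" by fact+
    have "R1\<^sup>2 \<le> R0\<^sup>2" using R1 by (intro power_mono) auto
    then show \<Omega>1: "fst p \<in> \<Omega>" if "q p \<le> R1\<^sup>2" for p using that eb(1)[of p] by linarith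
    fix R v vt vtt vd Yd
    assume v: "harmonic_function \<Omega> z \<alpha> d\<alpha> \<rho> B v vt vtt vd Yd" and R: "0 < R" "R \<le> R1"
    then interpret harmonic_function \<Omega> z \<alpha> d\<alpha> \<rho> B v vt vtt vd Yd by simp
    define I where "I r = (LINT p|lborel. indicator {p. q p \<le> r} p * (v p)\<^sup>2)" for r
    have R2: "R\<^sup>2 \<le> R1\<^sup>2" using R by (intro power_mono) auto
    have int: "integrable lborel (\<lambda>p. indicator {p. q p \<le> r} p * (v p)\<^sup>2)" if "r \<le> R\<^sup>2" for r
    proof -
      have "{p. q p \<le> r} \<subseteq> \<Omega> \<times> UNIV"
      proof
        fix p assume "p \<in> {p. q p \<le> r}"
        then have "q p \<le> R1\<^sup>2" using that R2 by simp
        then show "p \<in> \<Omega> \<times> UNIV" using \<Omega>1 by (simp add: mem_Times_iff)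
      qed
      then have "continuous_on {p. q p \<le> r} (\<lambda>p. (v p)\<^sup>2)"
        by (intro continuous_intros continuous_on_subset[OF v_cont(1)])
      from borel_integrable_compact[OF compact_sublevel this] show ?thesis by simp
    qed
    define v0 where "v0 = (v (z, 0))\<^sup>2"
    have "v0 * c * V / (2 * sqrt \<kappa> ^ (n + 1)) \<le> C / R ^ (n + 1) * I (R\<^sup>2)"
    proof (cases "v0 = 0")
      case True
      then show ?thesis using C R by (auto simp: I_def intro!: mult_nonneg_nonneg Bochner_Integration.integral_nonneg)
    next
      case False
      then have v0: "0 < v0" by (simp add: v0_def)
      have "open (\<Omega> \<times> (UNIV::real set))" using \<Omega>(1) by (simp add: open_Times)
      then have "isCont v (z, 0)" using v_cont(1) \<Omega>(2) by (simp add: continuous_on_eq_continuous_at)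
      then have "((\<lambda>p. (v p)\<^sup>2) \<longlongrightarrow> v0) (nhds (z, 0))"
        unfolding v0_def by (intro tendsto_power) (simp add: isCont_def tendsto_at_iff_tendsto_nhds)
      then have "\<forall>\<^sub>F p in nhds (z, 0). v0 / 2 < (v p)\<^sup>2" using v0 by (intro order_tendstoD) auto
      then obtain \<delta> where \<delta>: "0 < \<delta>" "\<And>p. dist p (z, 0) < \<delta> \<Longrightarrow> v0 / 2 < (v p)\<^sup>2"
        unfolding eventually_nhds_metric by blast
      \<comment> \<open>The first bound gives \<open>2 * \<epsilon>\<^sup>2 \<le> R\<^sup>2\<close>;
        the second keeps the core within distance \<open>\<delta> / 2\<close> of the centre.\<close>
      define \<epsilon> where "\<epsilon> = min (R / 2) (\<delta> / (2 * sqrt b))"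
      have \<epsilon>: "0 < \<epsilon>" "\<epsilon> \<le> R / 2" "\<epsilon> \<le> \<delta> / (2 * sqrt b)" using R \<delta> \<kappa>b(1,2) by (auto simp: \<epsilon>_def)
      have "\<epsilon>\<^sup>2 \<le> (R / 2)\<^sup>2" using \<epsilon> by (intro power_mono) auto
      then have "4 * \<epsilon>\<^sup>2 \<le> R\<^sup>2" by (simp add: power_divide)
      moreover have "0 \<le> \<epsilon>\<^sup>2" by simp
      ultimately have \<epsilon>R: "2 * \<epsilon>\<^sup>2 \<le> R\<^sup>2" "\<epsilon>\<^sup>2 \<le> R\<^sup>2" by linarith+
      obtain h h' where hh: "rw R \<epsilon> c C h h'" using rw[of R \<epsilon>] R R1 \<epsilon> \<epsilon>R by auto
      define l where "l p = (if q p \<le> \<epsilon>\<^sup>2 then c / \<epsilon> ^ (n + 1) else 0) - C / R ^ (n + 1)" for p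
      have l_eq: "indicator {p. q p \<le> R\<^sup>2} p * ((v p)\<^sup>2 * l p) =
          c / \<epsilon> ^ (n + 1) * (indicator {p. q p \<le> \<epsilon>\<^sup>2} p * (v p)\<^sup>2)
          - C / R ^ (n + 1) * (indicator {p. q p \<le> R\<^sup>2} p * (v p)\<^sup>2)" for p
        using \<epsilon>R by (auto simp: l_def indicator_def algebra_simps)
      have "(LINT p|lborel. indicator {p. q p \<le> R\<^sup>2} p * ((v p)\<^sup>2 * l p)) \<le> 0"
      proof (rule weighted_integral_nonpos[of R R0 "\<epsilon>\<^sup>2" h h'])
        show "0 < R" "R < R0" "0 < \<epsilon>\<^sup>2" using R R1 \<epsilon> by auto
        show "fst p \<in> \<Omega>" if "q p \<le> R0\<^sup>2" for p by (rule eb(1)[OF that])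
        show "integrable lborel (\<lambda>p. indicator {p. q p \<le> R\<^sup>2} p * ((v p)\<^sup>2 * l p))"
          unfolding l_eq by (intro Bochner_Integration.integrable_diff integrable_mult_right int \<epsilon>R) simp
        fix p assume p: "q p \<le> R\<^sup>2"
        then have "q p \<le> R0\<^sup>2" using R2 \<open>R1\<^sup>2 \<le> R0\<^sup>2\<close> by linarith
        then show "l p \<le> h (q p) * (D (fst p) + \<rho> (fst p)) + 2 * h' (q p) * P p"
          using hh p eb(2,3)[of p] q_nonneg[of p] unfolding rw_def l_def n_def by blast
      qed (use hh in \<open>auto simp: rw_def\<close>)
      also have "(LINT p|lborel. indicator {p. q p \<le> R\<^sup>2} p * ((v p)\<^sup>2 * l p)) =
          c / \<epsilon> ^ (n + 1) * I (\<epsilon>\<^sup>2) - C / R ^ (n + 1) * I (R\<^sup>2)"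
        unfolding l_eq I_def by (simp add: int \<epsilon>R)
      finally have 1: "c / \<epsilon> ^ (n + 1) * I (\<epsilon>\<^sup>2) \<le> C / R ^ (n + 1) * I (R\<^sup>2)" by simp
      define \<eta> where "\<eta> = \<epsilon> / sqrt \<kappa>"
      have \<eta>: "0 < \<eta>" using \<epsilon> \<kappa>b(1,2) by (simp add: \<eta>_def)
      have ball: "q p \<le> \<epsilon>\<^sup>2" if "p \<in> ball (z, 0) \<eta>" for p
      proof -
        have "(dist p (z, 0))\<^sup>2 \<le> \<eta>\<^sup>2" using that by (intro power_mono) (auto simp: dist_commute)
        then have "\<kappa> * (dist p (z, 0))\<^sup>2 \<le> \<kappa> * \<eta>\<^sup>2" using \<kappa>b(1,2) by simp
        also have "\<kappa> * \<eta>\<^sup>2 = \<epsilon>\<^sup>2" using \<kappa>b(1,2) by (simp add: \<eta>_def power_divide)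
        finally show ?thesis using \<kappa>b(3)[of p] by linarith
      qed
      have small: "v0 / 2 < (v p)\<^sup>2" if "q p \<le> \<epsilon>\<^sup>2" for p
      proof (rule \<delta>(2))
        have "(dist p (z, 0))\<^sup>2 \<le> b * \<epsilon>\<^sup>2" using that \<kappa>b(2) \<kappa>b(4)[of p] by (meson mult_left_mono less_imp_le order_trans)
        also have "\<dots> = (sqrt b * \<epsilon>)\<^sup>2" using \<kappa>b(1,2) by (simp add: power_mult_distrib)
        finally have "dist p (z, 0) \<le> sqrt b * \<epsilon>"
          by (rule power2_le_imp_le) (use \<kappa>b(2) \<epsilon> in simp)
        also have "\<dots> \<le> sqrt b * (\<delta> / (2 * sqrt b))" using \<epsilon>(3) \<kappa>b(2) by (intro mult_left_mono) auto
        also have "\<dots> < \<delta>" using \<kappa>b(2) \<delta>(1) by simp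
        finally show "dist p (z, 0) < \<delta>" .
      qed
      have "V * \<eta> ^ (n + 1) = measure lborel (ball (z, 0::real) \<eta>)"
        using content_ball[of \<eta> "(z, 0::real)"] \<eta> by (simp add: V_def n_def)
      then have "v0 / 2 * (V * \<eta> ^ (n + 1)) = (LINT p|lborel. v0 / 2 * indicator (ball (z, 0::real) \<eta>) p)" by simp
      also have "\<dots> \<le> I (\<epsilon>\<^sup>2)" unfolding I_def
      proof (rule integral_mono)
        show "integrable lborel (\<lambda>p. v0 / 2 * indicator (ball (z, 0::real) \<eta>) p)"
          by (intro integrable_mult_right integrable_real_indicator) (auto simp: emeasure_ball \<eta> less_imp_le)
        show "integrable lborel (\<lambda>p. indicator {p. q p \<le> \<epsilon>\<^sup>2} p * (v p)\<^sup>2)" by (rule int[OF \<epsilon>R(2)])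
        fix p :: "(real^'n) \<times> real"
        show "v0 / 2 * indicator (ball (z, 0) \<eta>) p \<le> indicator {p. q p \<le> \<epsilon>\<^sup>2} p * (v p)\<^sup>2"
          using ball[of p] small[of p] by (auto simp: indicator_def)
      qed
      finally have "c / \<epsilon> ^ (n + 1) * (v0 / 2 * (V * \<eta> ^ (n + 1))) \<le> c / \<epsilon> ^ (n + 1) * I (\<epsilon>\<^sup>2)"
        using c \<epsilon> by (intro mult_left_mono) auto
      moreover have "c / \<epsilon> ^ (n + 1) * (v0 / 2 * (V * \<eta> ^ (n + 1))) = v0 * c * V / (2 * sqrt \<kappa> ^ (n + 1))"
        using \<epsilon> by (simp add: \<eta>_def power_divide)
      ultimately show ?thesis using 1 by simp
    qed
    from mult_right_mono[OF this, of "2 * sqrt \<kappa> ^ (n + 1) / (c * V)"]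
    have "v0 \<le> 2 * C * sqrt \<kappa> ^ (n + 1) / (c * V) / R ^ (n + 1) * I (R\<^sup>2)"
      using c V \<kappa>b(1) by (simp add: mult_ac)
    also have "\<dots> \<le> C' / R ^ (n + 1) * I (R\<^sup>2)"
      using R by (intro mult_right_mono divide_right_mono)
        (auto simp: C'_def I_def intro!: Bochner_Integration.integral_nonneg)
    finally show "(v (z, 0))\<^sup>2 \<le> C' / R ^ (CARD('n) + 1) * (LINT p|lborel. indicator {p. q p \<le> R\<^sup>2} p * (v p)\<^sup>2)"
      by (simp add: v0_def I_def n_def)
  qed
qed

end

section \<open>Local coordinates\<close>

abbreviation C1_on :: "(real^'n::finite) set \<Rightarrow> (real^'n \<Rightarrow> 'b::real_normed_vector) \<Rightarrow> bool"
  where "C1_on \<equiv> Ck_on (Suc 0)"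

lemma partial_deriv_eq: "(f has_derivative f') (at x) \<Longrightarrow> partial_deriv i f x = f' (axis i 1)"
  using frechet_derivative_at[of f f' x] by (simp add: partial_deriv_def)

lemma C1_onI:
  assumes "\<And>x. x \<in> S \<Longrightarrow> (f has_derivative f' x) (at x)" "\<And>i. continuous_on S (\<lambda>x. f' x (axis i 1))"
  shows "C1_on S f"
proof -
  have "continuous_on S (partial_deriv i f)" for i
    by (rule continuous_on_eq[OF assms(2)]) (simp add: partial_deriv_eq[OF assms(1)])
  then show ?thesis using assms(1) by (auto simp: differentiable_def)
qed

lemma C1_onD:
  assumes "C1_on S f"
  shows "x \<in> S \<Longrightarrow> (f has_derivative frechet_derivative f (at x)) (at x)"
    "continuous_on S (\<lambda>x. frechet_derivative f (at x) (axis i 1))"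
    "continuous_on S f"
proof -
  have d: "\<And>x. x \<in> S \<Longrightarrow> f differentiable (at x)" using assms by simp
  then show "x \<in> S \<Longrightarrow> (f has_derivative frechet_derivative f (at x)) (at x)"
    by (simp add: frechet_derivative_works)
  show "continuous_on S (\<lambda>x. frechet_derivative f (at x) (axis i 1))"
  proof -
    have "continuous_on S (partial_deriv i f)" using assms by simp
    then show ?thesis unfolding partial_deriv_def[abs_def] .
  qed
  show "continuous_on S f"
    using d by (intro continuous_at_imp_continuous_on ballI differentiable_imp_continuous_within) auto
qed

lemma C1_on_cong:
  assumes "open S" "C1_on S f" "\<And>x. x \<in> S \<Longrightarrow> h x = f x"
  shows "C1_on S h"
proof (rule C1_onI)
  show "(h has_derivative frechet_derivative f (at x)) (at x)" if "x \<in> S" for x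
    by (rule has_derivative_transform_within_open[OF C1_onD(1)[OF assms(2) that] assms(1) that])
      (simp add: assms(3))
qed (rule C1_onD(2)[OF assms(2)])

lemma C1_on_const: "C1_on S (\<lambda>_. c)"
  by (rule C1_onI[where f' = "\<lambda>_ _. 0"]) auto

lemma C1_on_scaleR:
  assumes "C1_on S f" "C1_on S g"
  shows "C1_on S (\<lambda>x. f x *\<^sub>R g x)"
  by (rule C1_onI[OF has_derivative_scaleR[OF C1_onD(1)[OF assms(1)] C1_onD(1)[OF assms(2)]]])
    (assumption | intro continuous_intros C1_onD assms)+

lemma C1_on_mult: "C1_on S f \<Longrightarrow> C1_on S g \<Longrightarrow> C1_on S (\<lambda>x. f x * g x :: real)"
  using C1_on_scaleR[of S f g] by simp

lemma C1_on_sum: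
  assumes "\<And>i. i \<in> I \<Longrightarrow> C1_on S (f i)"
  shows "C1_on S (\<lambda>x. \<Sum>i\<in>I. f i x)"
  by (rule C1_onI[OF has_derivative_sum[OF C1_onD(1)[OF assms]]]) 
    (assumption | intro continuous_intros C1_onD assms)+

lemma C1_on_prod:
  fixes f :: "'i \<Rightarrow> real^'n \<Rightarrow> real"
  assumes "finite I" "\<And>i. i \<in> I \<Longrightarrow> C1_on S (f i)"
  shows "C1_on S (\<lambda>x. \<Prod>i\<in>I. f i x)"
  using assms by (induction I rule: finite_induct) (auto simp del: Ck_on.simps intro!: C1_on_mult C1_on_const)

lemma C1_on_linear:
  assumes "bounded_linear T" "C1_on S f"
  shows "C1_on S (\<lambda>x. T (f x))"
  by (rule C1_onI[OF bounded_linear.has_derivative[OF assms(1) C1_onD(1)[OF assms(2)]]])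
    (assumption | intro bounded_linear.continuous_on[OF assms(1)] C1_onD assms)+

lemma C1_on_compose_real:
  fixes f :: "real^'n \<Rightarrow> real"
  assumes "C1_on S f" "\<And>x. x \<in> S \<Longrightarrow> (h has_real_derivative h' (f x)) (at (f x))"
    "continuous_on S (\<lambda>x. h' (f x))"
  shows "C1_on S (\<lambda>x. h (f x))"
proof (rule C1_onI)
  show "((\<lambda>x. h (f x)) has_derivative (\<lambda>v. h' (f x) * frechet_derivative f (at x) v)) (at x)" if "x \<in> S" for x
    using has_derivative_compose[OF C1_onD(1)[OF assms(1) that], of h "(*) (h' (f x))"] assms(2)[OF that]
    by (simp add: has_field_derivative_def)
  show "continuous_on S (\<lambda>x. h' (f x) * frechet_derivative f (at x) (axis i 1))" for i
    by (intro continuous_intros assms C1_onD)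
qed

lemma partial_deriv_linear:
  assumes "bounded_linear T" "f differentiable (at x)"
  shows "partial_deriv i (\<lambda>x. T (f x)) x = T (partial_deriv i f x)"
  using partial_deriv_eq[OF bounded_linear.has_derivative[OF assms(1)], of f "frechet_derivative f (at x)" x] assms(2)
  by (simp add: frechet_derivative_works partial_deriv_def)

lemma has_partial_deriv:
  fixes f :: "real^'n::finite \<Rightarrow> real"
  assumes "f differentiable (at x)"
  shows "((\<lambda>s. f (x + s *\<^sub>R axis i 1)) has_real_derivative partial_deriv i f x) (at 0)"
proof -
  have d: "(f has_derivative frechet_derivative f (at x)) (at (x + 0 *\<^sub>R axis i 1))"
    using assms by (simp add: frechet_derivative_works)
  have "((\<lambda>s. x + s *\<^sub>R axis i 1) has_derivative (\<lambda>s. s *\<^sub>R axis i 1)) (at (0::real))"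
    by (auto intro!: derivative_eq_intros)
  from has_derivative_compose[OF this d]
  have "((\<lambda>s. f (x + s *\<^sub>R axis i 1)) has_derivative (\<lambda>s. frechet_derivative f (at x) (s *\<^sub>R axis i 1))) (at 0)" .
  moreover have "frechet_derivative f (at x) (s *\<^sub>R axis i 1) = partial_deriv i f x * s" for s
    using linear_cmul[OF linear_frechet_derivative[OF assms], of s "axis i 1"]
    by (simp add: partial_deriv_def)
  ultimately show ?thesis by (simp add: has_field_derivative_def)
qed

lemma C1_on_det:
  fixes A :: "real^'n \<Rightarrow> real^'m^'m"
  assumes "\<And>i j. C1_on S (\<lambda>x. A x $ i $ j)"
  shows "C1_on S (\<lambda>x. det (A x))"
  unfolding det_def
  by (intro C1_on_sum C1_on_mult C1_on_const C1_on_prod assms) simp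

section \<open>Determinants and inverses of positive definite matrices\<close>

lemma pos_def_invertible:
  fixes A :: "real^'n^'n"
  assumes "\<And>v. v \<noteq> 0 \<Longrightarrow> 0 < v \<bullet> (A *v v)"
  shows "det A \<noteq> 0"
proof -
  have "x = 0" if "A *v x = 0" for x using assms[of x] that by (cases "x = 0") auto
  then have "invertible A"
    unfolding invertible_left_inverse matrix_left_invertible_ker by blast
  then show ?thesis by (simp add: invertible_det_nz)
qed

text \<open>The segment from the identity to \<open>A\<close> consists of positive definite, hence
  invertible, matrices, so the determinant cannot change sign along it.\<close>

lemma pos_def_det_pos:
  fixes A :: "real^'n^'n"
  assumes A: "\<And>v. v \<noteq> 0 \<Longrightarrow> 0 < v \<bullet> (A *v v)"
  shows "0 < det A"
proof (rule ccontr)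
  define H where "H t = (1 - t) *\<^sub>R mat 1 + t *\<^sub>R A" for t :: real
  assume "\<not> 0 < det A"
  then have "det (H 1) \<le> 0" by (simp add: H_def)
  moreover have "0 \<le> det (H 0)" by (simp add: H_def)
  moreover have "continuous_on {0..1} (\<lambda>t. det (H t))"
    unfolding H_def det_def by (intro continuous_intros)
  ultimately obtain t where t: "0 \<le> t" "t \<le> 1" "det (H t) = 0"
    using IVT2'[of "\<lambda>t. det (H t)" 1 0 0] by auto
  have "det (H t) \<noteq> 0"
  proof (rule pos_def_invertible)
    fix v :: "real^'n" assume v: "v \<noteq> 0"
    have eq: "v \<bullet> (H t *v v) = (1 - t) * (v \<bullet> v) + t * (v \<bullet> (A *v v))"
      by (simp add: H_def matrix_vector_mult_add_rdistrib inner_add_right flip: scaleR_matrix_vector_assoc)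
    have pos: "0 < v \<bullet> v" "0 < v \<bullet> (A *v v)" using v A by auto
    show "0 < v \<bullet> (H t *v v)"
    proof (cases "t = 0")
      case False
      then show ?thesis unfolding eq using t pos by (intro add_nonneg_pos mult_pos_pos mult_nonneg_nonneg) auto
    qed (use eq pos in simp)
  qed
  then show False using t by simp
qed

lemma matrix_inv_works:
  fixes A :: "real^'n^'n"
  assumes "det A \<noteq> 0"
  shows "A ** matrix_inv A = mat 1" "matrix_inv A ** A = mat 1"
proof -
  have "\<exists>A'. A ** A' = mat 1 \<and> A' ** A = mat 1"
    using assms by (simp add: invertible_det_nz[symmetric] invertible_def)
  from someI_ex[OF this] show "A ** matrix_inv A = mat 1" "matrix_inv A ** A = mat 1"
    unfolding matrix_inv_def by auto
qed

lemma transpose_matrix_inv: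
  fixes A :: "real^'n^'n"
  assumes "det A \<noteq> 0" "transpose A = A"
  shows "transpose (matrix_inv A) = matrix_inv A"
proof -
  have "transpose (matrix_inv A) ** A = mat 1"
    using arg_cong[OF matrix_inv_works(1)[OF assms(1)], of transpose] assms(2)
    by (simp add: matrix_transpose_mul transpose_mat)
  then have "transpose (matrix_inv A) ** A ** matrix_inv A = matrix_inv A" by simp
  then show ?thesis by (simp add: matrix_mul_assoc[symmetric] matrix_inv_works[OF assms(1)])
qed

text \<open>Cramer's rule, used to see that the entries of the inverse metric are continuously
  differentiable: they are quotients of polynomials in the entries of the metric.\<close>

lemma matrix_inv_entry:
  fixes A :: "real^'n^'n"
  assumes "det A \<noteq> 0"
  shows "matrix_inv A $ i $ k = det (\<chi> r s. if s = i then axis k 1 $ r else A $ r $ s) / det A"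
proof -
  have "A *v (matrix_inv A *v axis k 1) = axis k 1"
    by (simp add: matrix_vector_mul_assoc matrix_inv_works[OF assms])
  then have "matrix_inv A *v axis k 1 = (\<chi> i. det (\<chi> r s. if s = i then axis k 1 $ r else A $ r $ s) / det A)"
    using cramer[OF assms] by blast
  moreover have "(matrix_inv A *v axis k 1) $ i = matrix_inv A $ i $ k"
    by (simp add: matrix_vector_mul_component inner_axis)
  ultimately show ?thesis by simp
qed

section \<open>The Laplacian in a chart as a divergence form operator\<close>

locale riemannian_chart =
  fixes c :: "('a::topological_space, 'n::finite) chart" and g :: "('a, 'n) chart \<Rightarrow> real^'n \<Rightarrow> real^'n^'n"
    and x0 :: 'a
  assumes chart: "is_chart c" and x0: "x0 \<in> fst c" and g_smooth: "smooth_on (chart_image c) (g c)"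
    and g_sym: "\<And>x. x \<in> chart_image c \<Longrightarrow> transpose (g c x) = g c x"
    and g_pos: "\<And>x y. x \<in> chart_image c \<Longrightarrow> y \<noteq> 0 \<Longrightarrow> 0 < y \<bullet> (g c x *v y)"
begin

definition \<Omega> :: "(real^'n) set" where "\<Omega> = chart_image c"
definition z :: "real^'n" where "z = snd c x0"
definition \<rho> :: "real^'n \<Rightarrow> real" where "\<rho> = volume_density g c"
definition \<alpha> :: "'n \<Rightarrow> 'n \<Rightarrow> real^'n \<Rightarrow> real" where "\<alpha> i k x = \<rho> x * matrix_inv (g c x) $ i $ k"
definition d\<alpha> :: "'n \<Rightarrow> 'n \<Rightarrow> real^'n \<Rightarrow> real" where "d\<alpha> i k = partial_deriv i (\<alpha> i k)"

lemma open_\<Omega>: "open \<Omega>" using chart by (simp add: is_chart_def \<Omega>_def)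
lemma z_\<Omega>: "z \<in> \<Omega>" using x0 by (simp add: z_def \<Omega>_def chart_image_def)

lemma chart_inv_in: "x \<in> \<Omega> \<Longrightarrow> chart_inv c x \<in> fst c" "x \<in> \<Omega> \<Longrightarrow> snd c (chart_inv c x) = x"
  unfolding \<Omega>_def chart_image_def chart_inv_def by (auto simp: inv_into_into f_inv_into_f)

lemma chart_inv_z: "chart_inv c z = x0"
proof -
  have "homeomorphism (fst c) (chart_image c) (snd c) (chart_inv c)" using chart by (simp add: is_chart_def)
  then show ?thesis using x0 unfolding z_def by (rule homeomorphism_apply1)
qed

lemma det_pos: "x \<in> \<Omega> \<Longrightarrow> 0 < det (g c x)"
  by (rule pos_def_det_pos) (simp add: g_pos \<Omega>_def)

lemma C1_g: "C1_on \<Omega> (\<lambda>x. g c x $ i $ j)"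
proof -
  have "C1_on \<Omega> (g c)" using g_smooth unfolding smooth_on_def \<Omega>_def by blast
  then show ?thesis
    by (intro C1_on_linear[of "\<lambda>A. A $ i $ j"] bounded_linear_compose[OF bounded_linear_vec_nth bounded_linear_vec_nth])
qed

lemma C1_\<rho>: "C1_on \<Omega> \<rho>"
proof -
  have det: "C1_on \<Omega> (\<lambda>x. det (g c x))" by (intro C1_on_det C1_g)
  show ?thesis unfolding \<rho>_def volume_density_def[abs_def]
  proof (rule C1_on_compose_real[OF det, of sqrt "\<lambda>y. inverse (sqrt y) / 2"])
    show "(sqrt has_real_derivative inverse (sqrt (det (g c x))) / 2) (at (det (g c x)))" if "x \<in> \<Omega>" for x
      by (rule DERIV_real_sqrt[OF det_pos[OF that]])
    show "continuous_on \<Omega> (\<lambda>x. inverse (sqrt (det (g c x))) / 2)"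
      using det_pos by (intro continuous_intros C1_onD(3)[OF det]) (auto simp: less_imp_neq[symmetric])
  qed
qed

lemma C1_\<alpha>: "C1_on \<Omega> (\<alpha> i k)"
proof -
  define d where "d x = det (\<chi> r s. if s = i then axis k 1 $ r else g c x $ r $ s)" for x
  have d: "C1_on \<Omega> d" unfolding d_def
  proof (rule C1_on_det)
    fix r s
    show "C1_on \<Omega> (\<lambda>x. (\<chi> r s. if s = i then axis k 1 $ r else g c x $ r $ s) $ r $ s)"
      using C1_g[of r s] C1_on_const[of \<Omega> "axis k 1 $ r :: real"] by (cases "s = i") (simp_all del: Ck_on.simps)
  qed
  have det: "C1_on \<Omega> (\<lambda>x. det (g c x))" by (intro C1_on_det C1_g)
  have inv: "C1_on \<Omega> (\<lambda>x. inverse (det (g c x)))"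
  proof (rule C1_on_compose_real[OF det, of inverse "\<lambda>y. - (inverse y * inverse y)"])
    show "(inverse has_real_derivative - (inverse (det (g c x)) * inverse (det (g c x)))) (at (det (g c x)))" if "x \<in> \<Omega>" for x
      using det_pos[OF that] by (auto intro!: derivative_eq_intros simp: power2_eq_square)
    show "continuous_on \<Omega> (\<lambda>x. - (inverse (det (g c x)) * inverse (det (g c x))))"
      using det_pos by (intro continuous_intros C1_onD(3)[OF det]) (auto simp: less_imp_neq[symmetric])
  qed
  have "C1_on \<Omega> (\<lambda>x. \<rho> x * (d x * inverse (det (g c x))))"
    by (intro C1_on_mult C1_\<rho> d inv)
  moreover have "\<alpha> i k x = \<rho> x * (d x * inverse (det (g c x)))" if "x \<in> \<Omega>" for x
    using matrix_inv_entry[of "g c x" i k] det_pos[OF that] by (simp add: \<alpha>_def d_def divide_inverse)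
  ultimately show ?thesis by (rule C1_on_cong[OF open_\<Omega>])
qed

lemma \<rho>_pos: "x \<in> \<Omega> \<Longrightarrow> 0 < \<rho> x"
  using det_pos by (simp add: \<rho>_def volume_density_def)

sublocale elliptic_coefficients \<Omega> z \<alpha> d\<alpha> \<rho> "g c z"
proof
  show "open \<Omega>" "z \<in> \<Omega>" by (fact open_\<Omega> z_\<Omega>)+
  show "transpose (g c z) = g c z" using z_\<Omega> by (simp add: g_sym \<Omega>_def)
  show "0 < y \<bullet> (g c z *v y)" if "y \<noteq> 0" for y using z_\<Omega> that by (simp add: g_pos \<Omega>_def)
  show "continuous_on \<Omega> (d\<alpha> i k)" for i k
    using C1_onD(2)[OF C1_\<alpha>[of i k], of i] by (simp add: d\<alpha>_def partial_deriv_def[abs_def])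
  show "(\<Sum>k\<in>UNIV. \<alpha> i k z * g c z $ k $ l) = (if i = l then \<rho> z else 0)" for i l
  proof -
    have "(\<Sum>k\<in>UNIV. \<alpha> i k z * g c z $ k $ l) = \<rho> z * (matrix_inv (g c z) ** g c z) $ i $ l"
      by (simp add: \<alpha>_def matrix_matrix_mult_def sum_distrib_left mult.assoc)
    then show ?thesis using det_pos[OF z_\<Omega>] by (simp add: matrix_inv_works mat_def)
  qed
  fix x assume x: "x \<in> \<Omega>"
  have dx: "det (g c x) \<noteq> 0" using det_pos[OF x] by simp
  show "0 < \<rho> x" by (rule \<rho>_pos[OF x])
  show "\<rho> differentiable (at x)" using C1_onD(1)[OF C1_\<rho> x] by (auto simp: differentiable_def)
  show \<alpha>d: "\<alpha> i k differentiable (at x)" for i k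
    using C1_onD(1)[OF C1_\<alpha> x] by (auto simp: differentiable_def)
  show "((\<lambda>s. \<alpha> i k (x + s *\<^sub>R axis i 1)) has_real_derivative d\<alpha> i k x) (at 0)" for i k
    unfolding d\<alpha>_def by (rule has_partial_deriv[OF \<alpha>d])
  have tr: "transpose (matrix_inv (g c x)) = matrix_inv (g c x)"
    using x by (intro transpose_matrix_inv dx g_sym) (simp add: \<Omega>_def)
  have "matrix_inv (g c x) $ i $ k = matrix_inv (g c x) $ k $ i" for i k
  proof -
    have "transpose (matrix_inv (g c x)) $ i $ k = matrix_inv (g c x) $ k $ i"
      by (simp add: transpose_def)
    then show ?thesis unfolding tr .
  qed
  then show "\<alpha> i k x = \<alpha> k i x" for i k by (simp add: \<alpha>_def)
  fix u :: "'n \<Rightarrow> real"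
  define U :: "real^'n" where "U = (\<chi> i. u i)"
  define N where "N = matrix_inv (g c x)"
  have "g c x *v (N *v U) = U" by (simp add: N_def matrix_vector_mul_assoc matrix_inv_works[OF dx])
  \<comment> \<open>Positivity of the inverse metric at \<open>U\<close> is positivity of the metric
    at \<open>N *v U\<close>.\<close>
  then have "U \<bullet> (N *v U) = (N *v U) \<bullet> (g c x *v (N *v U))" by (simp add: inner_commute)
  also have "\<dots> \<ge> 0"
    using g_pos[of x "N *v U"] x by (cases "N *v U = 0") (auto simp: \<Omega>_def less_imp_le)
  finally have "0 \<le> \<rho> x * (U \<bullet> (N *v U))" using \<rho>_pos[OF x] by simp
  also have "\<rho> x * (U \<bullet> (N *v U)) = (\<Sum>i\<in>UNIV. \<Sum>k\<in>UNIV. \<alpha> i k x * u i * u k)"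
    by (simp add: inner_vec_def matrix_vector_mult_def U_def N_def \<alpha>_def sum_distrib_left mult_ac)
  finally show "0 \<le> (\<Sum>i\<in>UNIV. \<Sum>k\<in>UNIV. \<alpha> i k x * u i * u k)" .
qed

text \<open>Each summand satisfies the equation because the Laplacian and two time derivatives both
  multiply it by the square of \<open>\<nu> j\<close>. The weights \<open>w\<close> stay arbitrary
  here; real parts are taken because the mean value inequality concerns real functions.\<close>

lemma harmonic_extension:
  fixes \<phi> :: "'j \<Rightarrow> 'a \<Rightarrow> complex" and w :: "'j \<Rightarrow> complex" and \<nu> :: "'j \<Rightarrow> real"
  assumes smooth: "\<And>j. j \<in> J \<Longrightarrow> smooth_on \<Omega> (\<phi> j \<circ> chart_inv c)"
    and eig: "\<And>j p. j \<in> J \<Longrightarrow> p \<in> fst c \<Longrightarrow> complex_of_real ((\<nu> j)\<^sup>2) * \<phi> j p = chart_laplacian g c (\<phi> j) p"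
  shows "\<exists>vt vtt vd Yd. harmonic_function \<Omega> z \<alpha> d\<alpha> \<rho> (g c z)
    (\<lambda>p. \<Sum>j\<in>J. Re (w j * \<phi> j (chart_inv c (fst p))) * exp (\<nu> j * snd p)) vt vtt vd Yd"
proof -
  \<comment> \<open>Real-linear, so it commutes with derivatives and with the real coefficients
    \<open>\<alpha>\<close>, which turns the complex equation into a real one.\<close>
  define T where "T j u = Re (w j * u)" for j u
  have T: "bounded_linear (T j)" for j
    unfolding T_def by (intro bounded_linear_compose[OF bounded_linear_Re] bounded_linear_mult_right)
  define F where "F j = \<phi> j \<circ> chart_inv c" for j
  define H where "H j i x = (\<Sum>k\<in>UNIV. \<alpha> i k x *\<^sub>R partial_deriv k (F j) x)" for j i x
  have F2: "Ck_on (Suc (Suc 0)) \<Omega> (F j)" if "j \<in> J" for j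
    using smooth[OF that] unfolding smooth_on_def F_def by blast
  have F1: "\<And>x. x \<in> \<Omega> \<Longrightarrow> F j differentiable (at x)" "\<And>k. C1_on \<Omega> (partial_deriv k (F j))" if "j \<in> J" for j
    using F2[OF that] by (auto simp only: Ck_on.simps(2)[of "Suc 0"])
  have cF: "continuous_on \<Omega> (F j)" if "j \<in> J" for j
    using F1(1)[OF that] by (intro continuous_at_imp_continuous_on ballI differentiable_imp_continuous_within)
  have H1: "C1_on \<Omega> (H j i)" if "j \<in> J" for j i
    unfolding H_def[abs_def] by (intro C1_on_sum C1_on_scaleR C1_\<alpha> F1 that)
  have Hd: "H j i differentiable (at x)" if "j \<in> J" "x \<in> \<Omega>" for j i x
    using H1[OF that(1)] that(2) by simp
  have cH: "continuous_on \<Omega> (\<lambda>x. partial_deriv i (H j i) x)" if "j \<in> J" for j i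
    using H1[OF that] by simp
  have TH: "T j (H j i x) = (\<Sum>k\<in>UNIV. \<alpha> i k x * T j (partial_deriv k (F j) x))" for j i x
    unfolding H_def by (simp add: linear_sum[OF bounded_linear.linear[OF T]] linear_cmul[OF bounded_linear.linear[OF T]])
  \<comment> \<open>The eigenvalue equation multiplied by \<open>\<rho>\<close>, which clears the
    factor \<open>1 / \<rho>\<close> of the Laplacian.\<close>
  have div: "(\<Sum>i\<in>UNIV. T j (partial_deriv i (H j i) x)) = - (\<rho> x * ((\<nu> j)\<^sup>2 * T j (F j x)))" if j: "j \<in> J" and x: "x \<in> \<Omega>" for j x
  proof -
    have "complex_of_real ((\<nu> j)\<^sup>2) * F j x = chart_laplacian g c (\<phi> j) (chart_inv c x)"
      using eig[OF j chart_inv_in(1)[OF x]] by (simp add: F_def)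
    also have "\<dots> = - ((1 / \<rho> x) *\<^sub>R (\<Sum>i\<in>UNIV. partial_deriv i (H j i) x))"
      unfolding chart_laplacian_def chart_inv_in(2)[OF x] H_def[abs_def] \<alpha>_def \<rho>_def F_def by simp
    finally have "\<rho> x *\<^sub>R ((\<nu> j)\<^sup>2 *\<^sub>R F j x) = - (\<Sum>i\<in>UNIV. partial_deriv i (H j i) x)"
      using \<rho>_pos[OF x] by (simp add: scaleR_conv_of_real)
    from arg_cong[OF this, of "T j"] show ?thesis
      by (simp add: linear_sum[OF bounded_linear.linear[OF T]] linear_cmul[OF bounded_linear.linear[OF T]]
          linear_neg[OF bounded_linear.linear[OF T]])
  qed
  define v where "v p = (\<Sum>j\<in>J. T j (F j (fst p)) * exp (\<nu> j * snd p))" for p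
  define vt where "vt p = (\<Sum>j\<in>J. T j (F j (fst p)) * (exp (\<nu> j * snd p) * \<nu> j))" for p
  define vtt where "vtt p = (\<Sum>j\<in>J. T j (F j (fst p)) * (exp (\<nu> j * snd p) * (\<nu> j)\<^sup>2))" for p
  define vd where "vd i p = (\<Sum>j\<in>J. T j (partial_deriv i (F j) (fst p)) * exp (\<nu> j * snd p))" for i p
  define Yd where "Yd i p = (\<Sum>j\<in>J. T j (partial_deriv i (H j i) (fst p)) * exp (\<nu> j * snd p))" for i p
  have cfst: "continuous_on (\<Omega> \<times> UNIV) (\<lambda>p. T j (f (fst p)))" if "continuous_on \<Omega> f"
    for f :: "real^'n \<Rightarrow> complex" and j
    by (intro bounded_linear.continuous_on[OF T] continuous_on_compose2[OF that] continuous_intros) auto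
  have dfst: "((\<lambda>s. T j (f (x + s *\<^sub>R axis i 1))) has_real_derivative T j (partial_deriv i f x)) (at 0)"
    if "f differentiable (at x)" for f :: "real^'n \<Rightarrow> complex" and j i x
  proof -
    have "(\<lambda>x. T j (f x)) differentiable (at x)"
      using that bounded_linear.has_derivative[OF T] unfolding differentiable_def by blast
    from has_partial_deriv[OF this, of i] show ?thesis
      by (simp add: partial_deriv_linear[OF T that])
  qed
  have "harmonic_function \<Omega> z \<alpha> d\<alpha> \<rho> (g c z) v vt vtt vd Yd"
  proof
    show "continuous_on (\<Omega> \<times> UNIV) v" "continuous_on (\<Omega> \<times> UNIV) vt" "continuous_on (\<Omega> \<times> UNIV) vtt"
      unfolding v_def vt_def vtt_def by (intro continuous_intros cfst cF; assumption)+
    show "continuous_on (\<Omega> \<times> UNIV) (vd i)" for i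
      unfolding vd_def by (intro continuous_intros cfst C1_onD(3)[OF F1(2)])
    show "continuous_on (\<Omega> \<times> UNIV) (Yd i)" for i
      unfolding Yd_def by (intro continuous_intros cfst cH)
    fix p :: "(real^'n) \<times> real" assume p: "fst p \<in> \<Omega>"
    show "((\<lambda>s. v (p + s *\<^sub>R (axis i 1, 0))) has_real_derivative vd i p) (at 0)" for i
      unfolding v_def vd_def
      by (rule DERIV_sum) (auto intro!: DERIV_cmult_right dfst F1(1) p)
    show "((\<lambda>s. v (p + s *\<^sub>R (0, 1))) has_real_derivative vt p) (at 0)"
      unfolding v_def vt_def
      by (rule DERIV_sum) (auto intro!: derivative_eq_intros)
    show "((\<lambda>s. vt (p + s *\<^sub>R (0, 1))) has_real_derivative vtt p) (at 0)"
      unfolding vt_def vtt_def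
      by (rule DERIV_sum) (auto intro!: derivative_eq_intros simp: power2_eq_square)
    show "((\<lambda>s. \<Sum>k\<in>UNIV. \<alpha> i k (fst p + s *\<^sub>R axis i 1) * vd k (p + s *\<^sub>R (axis i 1, 0))) has_real_derivative Yd i p) (at 0)" for i
    proof -
      have eq: "(\<Sum>k\<in>UNIV. \<alpha> i k (fst p') * vd k p') = (\<Sum>j\<in>J. T j (H j i (fst p')) * exp (\<nu> j * snd p'))" for p'
        unfolding vd_def TH sum_distrib_left sum_distrib_right
        by (subst sum.swap) (simp add: mult.assoc)
      have "((\<lambda>s. \<Sum>j\<in>J. T j (H j i (fst p + s *\<^sub>R axis i 1)) * exp (\<nu> j * snd p)) has_real_derivative Yd i p) (at 0)"
        unfolding Yd_def by (rule DERIV_sum) (auto intro!: DERIV_cmult_right dfst Hd p)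
      then show ?thesis using eq[of "p + _ *\<^sub>R (axis i 1, 0)"] by simp
    qed
    have "(\<Sum>i\<in>UNIV. Yd i p) = (\<Sum>j\<in>J. (\<Sum>i\<in>UNIV. T j (partial_deriv i (H j i) (fst p))) * exp (\<nu> j * snd p))"
      unfolding Yd_def sum_distrib_right by (rule sum.swap)
    also have "\<dots> = - (\<rho> (fst p) * vtt p)"
      unfolding vtt_def sum_distrib_left sum_negf[symmetric]
      by (intro sum.cong refl) (simp add: div p mult_ac)
    finally show "(\<Sum>i\<in>UNIV. Yd i p) + \<rho> (fst p) * vtt p = 0" by simp
  qed
  moreover have "v = (\<lambda>p. \<Sum>j\<in>J. Re (w j * \<phi> j (chart_inv c (fst p))) * exp (\<nu> j * snd p))"
    by (simp add: v_def T_def F_def fun_eq_iff)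
  ultimately show ?thesis by (intro exI) simp
qed

end

section \<open>The local Weyl bound\<close>

context riemannian_chart
begin

lemma measurable_density: "(\<lambda>x. indicator \<Omega> x * ennreal (\<rho> x)) \<in> borel_measurable lborel"
proof -
  have "(\<lambda>x. if x \<in> \<Omega> then \<rho> x else 0) \<in> borel_measurable borel"
    using open_\<Omega> C1_onD(3)[OF C1_\<rho>] by (intro borel_measurable_continuous_on_if) auto
  then have "(\<lambda>x. ennreal (if x \<in> \<Omega> then \<rho> x else 0)) \<in> borel_measurable borel" by measurable
  also have "(\<lambda>x. ennreal (if x \<in> \<Omega> then \<rho> x else 0)) = (\<lambda>x. indicator \<Omega> x * ennreal (\<rho> x))"
    by (auto simp: indicator_def)
  finally show ?thesis by simp
qed

lemma nn_integral_chart_measure: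
  assumes f: "f \<in> borel_measurable borel"
  shows "(\<integral>\<^sup>+ p. f p \<partial>chart_measure g c) = (\<integral>\<^sup>+ x. indicator \<Omega> x * ennreal (\<rho> x) * f (chart_inv c x) \<partial>lborel)"
proof -
  have inv: "chart_inv c \<in> borel_measurable borel" by (rule measurable_chart_inv[OF chart])
  have fi: "(\<lambda>x. f (chart_inv c x)) \<in> borel_measurable lborel"
    using measurable_compose[OF inv f] by simp
  have "(\<integral>\<^sup>+ p. f p \<partial>chart_measure g c)
      = (\<integral>\<^sup>+ x. f (chart_inv c x) \<partial>density lborel (\<lambda>x. indicator \<Omega> x * ennreal (\<rho> x)))"
    unfolding chart_measure_def \<Omega>_def[symmetric] \<rho>_def[symmetric]
    using inv f by (intro nn_integral_distr) auto
  also have "\<dots> = (\<integral>\<^sup>+ x. indicator \<Omega> x * ennreal (\<rho> x) * f (chart_inv c x) \<partial>lborel)"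
    by (rule nn_integral_density[OF measurable_density fi])
  finally show ?thesis .
qed

text \<open>With the weights \<open>cnj (\<phi> j x0)\<close> the same sum \<open>S\<close> is both
  the central value of \<open>v\<close> and, up to \<open>exp 2\<close>, a bound for the squared
  norm on each time slice. So the quadratic inequality for \<open>S\<close> can be divided by
  \<open>S\<close>. Finite sets \<open>J\<close> are used throughout, so no finiteness of the
  spectrum below \<open>\<Lambda>\<close> enters.\<close>

lemma local_weyl_bound:
  fixes \<mu> :: "'a measure" and \<phi> :: "'j \<Rightarrow> 'a \<Rightarrow> complex" and \<nu> :: "'j \<Rightarrow> real"
  assumes sets: "sets \<mu> = sets borel" and le: "chart_measure g c \<le> \<mu>"
    and sq: "\<And>j. square_integrable \<mu> (\<phi> j)"
    and on: "\<And>i j. L2_inner \<mu> (\<phi> i) (\<phi> j) = (if i = j then 1 else 0)"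
    and smooth: "\<And>j. smooth_on \<Omega> (\<phi> j \<circ> chart_inv c)"
    and eig: "\<And>j p. p \<in> fst c \<Longrightarrow> complex_of_real ((\<nu> j)\<^sup>2) * \<phi> j p = chart_laplacian g c (\<phi> j) p"
    and \<nu>: "\<And>j. 0 \<le> \<nu> j"
  shows "\<exists>C. \<forall>\<Lambda> J. 1 \<le> \<Lambda> \<longrightarrow> finite J \<longrightarrow> J \<subseteq> {j. \<nu> j < \<Lambda>} \<longrightarrow>
    (\<Sum>j\<in>J. (cmod (\<phi> j x0))\<^sup>2) \<le> C * \<Lambda> powr CARD('n)"
proof -
  define n where "n = CARD('n)"
  have "\<exists>R1 C. 0 < R1 \<and> R1 \<le> 1 \<and> 0 < C \<and> (\<forall>p. q p \<le> R1\<^sup>2 \<longrightarrow> fst p \<in> \<Omega>) \<and>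
    (\<forall>R v vt vtt vd Yd. harmonic_function \<Omega> z \<alpha> d\<alpha> \<rho> (g c z) v vt vtt vd Yd \<longrightarrow> 0 < R \<longrightarrow> R \<le> R1 \<longrightarrow>
      (v (z, 0))\<^sup>2 \<le> C / R ^ (n + 1) * (LINT p|lborel. indicator {p. q p \<le> R\<^sup>2} p * (v p)\<^sup>2))"
    unfolding n_def by (rule mean_value_inequality)
  then obtain R1 C where R1: "0 < R1" "R1 \<le> 1" and C: "0 < C" and \<Omega>1: "\<forall>p. q p \<le> R1\<^sup>2 \<longrightarrow> fst p \<in> \<Omega>"
    and mv: "\<forall>R v vt vtt vd Yd. harmonic_function \<Omega> z \<alpha> d\<alpha> \<rho> (g c z) v vt vtt vd Yd \<longrightarrow> 0 < R \<longrightarrow> R \<le> R1 \<longrightarrow>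
      (v (z, 0))\<^sup>2 \<le> C / R ^ (n + 1) * (LINT p|lborel. indicator {p. q p \<le> R\<^sup>2} p * (v p)\<^sup>2)"
    by blast
  \<comment> \<open>The projection of the largest ball to space. Being compact, it gives
    \<open>\<rho>\<close> a positive minimum, and Lebesgue measure on it is at most a multiple of
    the Riemannian measure.\<close>
  define U where "U = fst ` {p. q p \<le> R1\<^sup>2}"
  have U: "compact U" unfolding U_def by (intro compact_continuous_image compact_sublevel continuous_intros)
  have U\<Omega>: "U \<subseteq> \<Omega>" using \<Omega>1 by (auto simp: U_def)
  have "q (z, 0) \<le> R1\<^sup>2" by (simp add: q_def)
  then have "U \<noteq> {}" unfolding U_def by blast
  then obtain xm where xm: "xm \<in> U" "\<And>x. x \<in> U \<Longrightarrow> \<rho> xm \<le> \<rho> x"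
    using continuous_attains_inf[OF U _ continuous_on_subset[OF C1_onD(3)[OF C1_\<rho>] U\<Omega>]] by blast
  define \<rho>1 where "\<rho>1 = \<rho> xm"
  have \<rho>1: "0 < \<rho>1" using xm U\<Omega> \<rho>_pos by (auto simp: \<rho>1_def)
  have U_sets [measurable]: "U \<in> sets borel" using U by (simp add: borel_compact)
  have \<phi>m [measurable]: "\<phi> j \<in> borel_measurable borel" for j
    using sq[of j] measurable_cong_sets[OF sets refl] by (auto simp: square_integrable_def)
  have inv [measurable]: "chart_inv c \<in> borel_measurable borel" by (rule measurable_chart_inv[OF chart])
  define C' where "C' = C * 2 * exp 2 / \<rho>1 / R1 ^ n"
  have "(\<Sum>j\<in>J. (cmod (\<phi> j x0))\<^sup>2) \<le> C' * \<Lambda> powr n"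
    if \<Lambda>: "1 \<le> \<Lambda>" and J: "finite J" "J \<subseteq> {j. \<nu> j < \<Lambda>}" for \<Lambda> J
  proof -
    define S where "S = (\<Sum>j\<in>J. (cmod (\<phi> j x0))\<^sup>2)"
    have S0: "0 \<le> S" unfolding S_def by (intro sum_nonneg) simp
    define w where "w j = cnj (\<phi> j x0)" for j
    \<comment> \<open>With \<open>R1 \<le> 1\<close>, the products \<open>\<nu> j * t\<close> are at
      most \<open>1\<close> for \<open>\<bar>t\<bar> \<le> R\<close>; this is the origin of
      \<open>exp 2\<close>.\<close>
    define R where "R = R1 / \<Lambda>"
    have R: "0 < R" "R \<le> R1" using R1 \<Lambda> by (auto simp: R_def field_simps)
    have "R\<^sup>2 \<le> R1\<^sup>2" using R by (intro power_mono) auto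
    define v where "v p = (\<Sum>j\<in>J. Re (w j * \<phi> j (chart_inv c (fst p))) * exp (\<nu> j * snd p))" for p :: "(real^'n) \<times> real"
    obtain vt vtt vd Yd where harm: "harmonic_function \<Omega> z \<alpha> d\<alpha> \<rho> (g c z) v vt vtt vd Yd"
      using harmonic_extension[of J \<phi> \<nu> w, OF smooth eig] unfolding v_def by blast
    define e where "e t j = w j * complex_of_real (exp (\<nu> j * t))" for t j
    define G where "G t m = (cmod (\<Sum>j\<in>J. e t j * \<phi> j m))\<^sup>2" for t m
    have vG: "(v (x, t))\<^sup>2 \<le> G t (chart_inv c x)" for x t
    proof -
      have "v (x, t) = Re (\<Sum>j\<in>J. e t j * \<phi> j (chart_inv c x))"
        by (simp add: v_def e_def algebra_simps)
      then have "\<bar>v (x, t)\<bar> \<le> cmod (\<Sum>j\<in>J. e t j * \<phi> j (chart_inv c x))"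
        using abs_Re_le_cmod by metis
      then show ?thesis unfolding G_def by (metis power2_abs power_mono abs_ge_zero)
    qed
    have G_nn: "0 \<le> G t m" for t m by (simp add: G_def)
    have Gm: "(\<lambda>m. ennreal (G t m)) \<in> borel_measurable borel" for t
      unfolding G_def by measurable
    have inner: "(\<integral>\<^sup>+ x. indicator U x * ennreal (G t (chart_inv c x)) \<partial>lborel) \<le> ennreal (exp 2 * S / \<rho>1)"
      if t: "\<bar>t\<bar> \<le> R" for t
    proof -
      have "(\<integral>\<^sup>+ x. indicator U x * ennreal (G t (chart_inv c x)) \<partial>lborel)
        \<le> (\<integral>\<^sup>+ x. ennreal (1 / \<rho>1) * (indicator \<Omega> x * ennreal (\<rho> x) * ennreal (G t (chart_inv c x))) \<partial>lborel)"
      proof (intro nn_integral_mono)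
        fix x
        show "indicator U x * ennreal (G t (chart_inv c x))
          \<le> ennreal (1 / \<rho>1) * (indicator \<Omega> x * ennreal (\<rho> x) * ennreal (G t (chart_inv c x)))"
        proof (cases "x \<in> U")
          case True
          have "1 * G t (chart_inv c x) \<le> (1 / \<rho>1 * \<rho> x) * G t (chart_inv c x)"
            using xm(2)[OF True] \<rho>1 by (intro mult_right_mono G_nn) (simp add: \<rho>1_def field_simps)
          then have "ennreal (G t (chart_inv c x)) \<le> ennreal (1 / \<rho>1 * (\<rho> x * G t (chart_inv c x)))"
            by (intro ennreal_leI) (simp add: mult_ac)
          also have "\<dots> = ennreal (1 / \<rho>1) * (ennreal (\<rho> x) * ennreal (G t (chart_inv c x)))"
          proof -
            have nn: "0 \<le> 1 / \<rho>1" "0 \<le> \<rho> x" using \<rho>1 \<rho>_pos[of x] True U\<Omega> by (auto intro: less_imp_le)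
            show ?thesis
              by (simp only: ennreal_mult[OF nn(1) mult_nonneg_nonneg[OF nn(2) G_nn]] ennreal_mult[OF nn(2) G_nn])
          qed
          finally show ?thesis using True U\<Omega> by auto
        qed simp
      qed
      also have "\<dots> = ennreal (1 / \<rho>1) * (\<integral>\<^sup>+ x. indicator \<Omega> x * ennreal (\<rho> x) * ennreal (G t (chart_inv c x)) \<partial>lborel)"
      proof (rule nn_integral_cmult)
        have "(\<lambda>x. ennreal (G t (chart_inv c x))) \<in> borel_measurable lborel"
          using measurable_compose[OF inv Gm] by simp
        with measurable_density show "(\<lambda>x. indicator \<Omega> x * ennreal (\<rho> x) * ennreal (G t (chart_inv c x))) \<in> borel_measurable lborel"
          by (rule borel_measurable_times_ennreal)
      qed
      also have "(\<integral>\<^sup>+ x. indicator \<Omega> x * ennreal (\<rho> x) * ennreal (G t (chart_inv c x)) \<partial>lborel)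
        = (\<integral>\<^sup>+ m. ennreal (G t m) \<partial>chart_measure g c)"
        by (rule nn_integral_chart_measure[symmetric, OF Gm])
      \<comment> \<open>Enlarging the domain of integration to the whole manifold, where
        orthonormality can be applied.\<close>
      also have "ennreal (1 / \<rho>1) * \<dots> \<le> ennreal (1 / \<rho>1) * (\<integral>\<^sup>+ m. ennreal (G t m) \<partial>\<mu>)"
        using sets le by (intro mult_left_mono nn_integral_mono_measure) (auto simp: chart_measure_def)
      also have "(\<integral>\<^sup>+ m. ennreal (G t m) \<partial>\<mu>) = ennreal (\<Sum>j\<in>J. (cmod (e t j))\<^sup>2)"
        using cmod_squared_integral_orthonormal_sum[OF sq on J(1), of "e t"] G_nn
        unfolding G_def by (subst nn_integral_eq_integral) auto
      also have "(\<Sum>j\<in>J. (cmod (e t j))\<^sup>2) \<le> exp 2 * S"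
        unfolding S_def sum_distrib_left
      proof (intro sum_mono)
        fix j assume "j \<in> J"
        then have "\<nu> j \<le> \<Lambda>" using J(2) by auto
        have "\<nu> j * t \<le> \<nu> j * R" using \<nu>[of j] t by (intro mult_left_mono) auto
        also have "\<dots> \<le> \<Lambda> * R" using \<open>\<nu> j \<le> \<Lambda>\<close> R by (intro mult_right_mono) auto
        also have "\<dots> \<le> 1" using \<Lambda> R1 by (simp add: R_def)
        finally have "(exp (\<nu> j * t))\<^sup>2 \<le> (exp 1)\<^sup>2" by (intro power_mono) auto
        also have "(exp 1)\<^sup>2 = exp (2::real)" by (simp add: exp_double[symmetric])
        finally have "(exp (\<nu> j * t))\<^sup>2 * (cmod (\<phi> j x0))\<^sup>2 \<le> exp 2 * (cmod (\<phi> j x0))\<^sup>2"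
          by (rule mult_right_mono) simp
        then show "(cmod (e t j))\<^sup>2 \<le> exp 2 * (cmod (\<phi> j x0))\<^sup>2"
          by (simp add: e_def w_def norm_mult power_mult_distrib mult.commute)
      qed
      finally have "(\<integral>\<^sup>+ x. indicator U x * ennreal (G t (chart_inv c x)) \<partial>lborel)
          \<le> ennreal (1 / \<rho>1) * ennreal (exp 2 * S)"
        by (simp add: ennreal_leI mult_left_mono)
      then show ?thesis using \<rho>1 S0 by (simp add: ennreal_mult[symmetric])
    qed
    have vm [measurable]: "v \<in> borel_measurable borel"
      unfolding v_def
      by (intro borel_measurable_sum borel_measurable_times measurable_compose[OF _ borel_measurable_Re]
          borel_measurable_const measurable_compose[OF _ \<phi>m] measurable_compose[OF _ inv]
          borel_measurable_continuous_onI[of fst] borel_measurable_continuous_onI[of "\<lambda>p. exp (_ * snd p)"] continuous_intros)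
    have G2m: "(\<lambda>(x, t). indicator U x * ennreal (G t (chart_inv c x)) * indicator {-R..R} t) \<in> borel_measurable (lborel \<Otimes>\<^sub>M lborel)"
      unfolding G_def e_def by measurable
    have "(\<integral>\<^sup>+ p. ennreal (indicator {p. q p \<le> R\<^sup>2} p * (v p)\<^sup>2) \<partial>lborel)
      \<le> (\<integral>\<^sup>+ p. (\<lambda>(x, t). indicator U x * ennreal (G t (chart_inv c x)) * indicator {-R..R} t) p \<partial>lborel)"
    proof (intro nn_integral_mono)
      fix p :: "(real^'n) \<times> real"
      obtain x t where p: "p = (x, t)" by (cases p)
      show "ennreal (indicator {p. q p \<le> R\<^sup>2} p * (v p)\<^sup>2)
          \<le> (\<lambda>(x, t). indicator U x * ennreal (G t (chart_inv c x)) * indicator {-R..R} t) p"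
      proof (cases "q p \<le> R\<^sup>2")
        case True
        then have "q p \<le> R1\<^sup>2" using \<open>R\<^sup>2 \<le> R1\<^sup>2\<close> by simp
        then have "x \<in> U" unfolding U_def p by force
        have "0 \<le> q (x, 0)" by (rule q_nonneg)
        then have "t\<^sup>2 \<le> R\<^sup>2" using True by (simp add: q_def p)
        then have "\<bar>t\<bar> \<le> R" using R(1) by (metis abs_le_square_iff abs_of_pos)
        then have "t \<in> {-R..R}" by auto
        then show ?thesis using \<open>x \<in> U\<close> True vG[of x t] by (auto simp: p intro: ennreal_leI)
      qed simp
    qed
    also have "\<dots> = (\<integral>\<^sup>+ t. \<integral>\<^sup>+ x. indicator U x * ennreal (G t (chart_inv c x)) * indicator {-R..R} t \<partial>lborel \<partial>lborel)"
      using lborel_pair.nn_integral_snd[OF G2m] by (simp add: lborel_prod)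
    also have "\<dots> \<le> (\<integral>\<^sup>+ t. ennreal (exp 2 * S / \<rho>1) * indicator {-R..R} t \<partial>lborel)"
      using inner by (intro nn_integral_mono) (auto simp: indicator_def abs_le_iff)
    also have "\<dots> = ennreal (exp 2 * S / \<rho>1) * ennreal (2 * R)"
      using R by (simp add: nn_integral_cmult_indicator)
    also have "\<dots> = ennreal (exp 2 * S / \<rho>1 * (2 * R))"
      using R S0 \<rho>1 by (intro ennreal_mult[symmetric]) auto
    finally have "(LINT p|lborel. indicator {p. q p \<le> R\<^sup>2} p * (v p)\<^sup>2) \<le> exp 2 * S / \<rho>1 * (2 * R)"
      using R S0 \<rho>1 by (intro integral_real_bounded) auto
    then have "(v (z, 0))\<^sup>2 \<le> C / R ^ (n + 1) * (exp 2 * S / \<rho>1 * (2 * R))"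
      using C R mv[rule_format, OF harm R] by (elim order_trans) (intro mult_left_mono, auto)
    \<comment> \<open>The length \<open>2 * R\<close> of the time interval cancels one power of
      \<open>R\<close>, which reduces the exponent \<open>n + 1\<close> to \<open>n\<close>.\<close>
    also have "\<dots> = (C * 2 * exp 2 / \<rho>1 / R ^ n) * S" using R by (simp add: mult_ac)
    also have "C * 2 * exp 2 / \<rho>1 / R ^ n = C' * \<Lambda> ^ n"
      by (simp add: C'_def R_def power_divide)
    also have "v (z, 0) = S"
      unfolding v_def S_def cmod_power2 by (simp add: chart_inv_z w_def power2_eq_square)
    finally have "S * S \<le> C' * \<Lambda> ^ n * S" by (simp add: power2_eq_square)
    moreover have "0 \<le> C' * \<Lambda> ^ n" using C \<rho>1 R1 \<Lambda> by (simp add: C'_def)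
    ultimately have "S \<le> C' * \<Lambda> ^ n" using S0 by (cases "S = 0") auto
    then show ?thesis using \<Lambda> by (simp add: S_def powr_realpow)
  qed
  then show ?thesis unfolding n_def by blast
qed

end

section \<open>From prefix sums to the spectral function\<close>

theorem theorem1p1:
  fixes \<A> :: "('a::{t2_space, second_countable_topology}, 'n::finite) chart set"
    and g :: "('a, 'n) chart \<Rightarrow> real^'n \<Rightarrow> real^'n^'n"
    and \<phi> :: "nat \<Rightarrow> 'a \<Rightarrow> complex"
    and \<nu> :: "nat \<Rightarrow> real"
  assumes "closed_connected_riemannian_manifold \<A> g"
    and "laplace_eigenbasis \<A> g \<phi> \<nu>"
  shows "\<forall>x. \<exists>Z. UNIV - Z \<in> null_sets (riemannian_measure \<A> g) \<and>
           (\<forall>y\<in>Z. \<forall>\<epsilon>>0. \<exists>C>0. \<exists>\<Lambda>0. \<forall>\<Lambda>\<ge>\<Lambda>0.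
              cmod (spectral_function \<phi> \<nu> \<Lambda> x y)
                \<le> C * \<Lambda> powr (real CARD('n) / 2) * (ln \<Lambda>) powr (3/2)
                    * (ln (ln \<Lambda>)) powr (1/2 + \<epsilon>))"
proof
  fix x
  define \<mu> where "\<mu> = riemannian_measure \<A> g"
  have atlas: "smooth_atlas \<A>" and metric: "riemannian_metric \<A> g"
    using assms(1) by (auto simp: closed_connected_riemannian_manifold_def)
  have sets: "sets \<mu> = sets borel" unfolding \<mu>_def by (rule sets_riemannian_measure[OF atlas])
  have sq: "square_integrable \<mu> (\<phi> j)" and on: "L2_inner \<mu> (\<phi> i) (\<phi> j) = (if i = j then 1 else 0)"
    and lap: "has_laplacian \<A> g (\<phi> j) (\<lambda>p. complex_of_real ((\<nu> j)\<^sup>2) * \<phi> j p)"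
    and \<nu>0: "\<nu> 0 = 0" and inc: "incseq \<nu>" for i j
    using assms(2) unfolding laplace_eigenbasis_def L2_orthonormal_basis_def \<mu>_def by blast+
  have \<nu>_nn: "0 \<le> \<nu> j" for j using incseqD[OF inc, of 0 j] \<nu>0 by simp
  have weyl: "\<exists>C. \<forall>\<Lambda> J. 1 \<le> \<Lambda> \<longrightarrow> finite J \<longrightarrow> J \<subseteq> {j. \<nu> j < \<Lambda>} \<longrightarrow>
    (\<Sum>j\<in>J. (cmod (\<phi> j y))\<^sup>2) \<le> C * \<Lambda> powr CARD('n)" for y
  proof -
    obtain c where c: "c \<in> \<A>" "y \<in> fst c"
      using atlas unfolding smooth_atlas_def by blast
    interpret riemannian_chart c g y
      using c atlas metric by unfold_locales (auto simp: smooth_atlas_def riemannian_metric_def)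
    show ?thesis
    proof (rule local_weyl_bound[OF sets _ sq on])
      show "chart_measure g c \<le> \<mu>" unfolding \<mu>_def by (rule chart_measure_le_riemannian_measure[OF c(1)])
      show "smooth_on \<Omega> (\<phi> j \<circ> chart_inv c)" for j
        using lap[of j] c(1) by (simp add: has_laplacian_def smooth_function_def \<Omega>_def)
      show "complex_of_real ((\<nu> j)\<^sup>2) * \<phi> j p = chart_laplacian g c (\<phi> j) p" if "p \<in> fst c" for j p
        using lap[of j] c(1) that by (simp add: has_laplacian_def)
    qed (rule \<nu>_nn)
  qed
  \<comment> \<open>Zero coefficients remove the eigenvalue \<open>0\<close>, so that prefix sums
    can start at index \<open>0\<close>. The conjugation produces the conjugate of the spectral
    function, which has the same modulus.\<close>
  define a where "a j = (if 0 < \<nu> j then cnj (\<phi> j x) else 0)" for j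
  obtain A where A: "\<And>\<Lambda> J. 1 \<le> \<Lambda> \<Longrightarrow> finite J \<Longrightarrow> J \<subseteq> {j. \<nu> j < \<Lambda>} \<Longrightarrow>
    (\<Sum>j\<in>J. (cmod (\<phi> j x))\<^sup>2) \<le> A * \<Lambda> powr CARD('n)" using weyl[of x] by blast
  have "(\<Sum>j\<in>J. (cmod (a j))\<^sup>2) \<le> A * \<Lambda> powr CARD('n)"
    if "1 \<le> \<Lambda>" "finite J" "J \<subseteq> {j. \<nu> j < \<Lambda>}" for \<Lambda> J
    by (rule order_trans[OF sum_mono A[OF that]]) (simp add: a_def)
  note ab = this
  define good where "good y \<longleftrightarrow> (\<forall>\<epsilon>>0. \<exists>C>0. \<exists>\<Lambda>0. \<forall>\<Lambda>\<ge>\<Lambda>0. \<forall>N. (\<forall>j<N. \<nu> j < \<Lambda>) \<longrightarrow>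
     cmod (\<Sum>j<N. a j * \<phi> j y) \<le> C * \<Lambda> powr (real CARD('n) / 2) * (ln \<Lambda>) powr (3/2) * (ln (ln \<Lambda>)) powr (1/2 + \<epsilon>))" for y
  from orthonormal_sums_ae_bound[OF sq on _ ab weyl]
  have ae: "AE y in \<mu>. good y"
    unfolding good_def by simp
  \<comment> \<open>Since \<open>\<nu>\<close> is increasing, a finite nonempty index set ends at
    some index below which all frequencies are less than \<open>\<Lambda>\<close>. For an empty or
    infinite index set the sum is \<open>0\<close>, the latter by convention, and the empty prefix
    matches it.\<close>
  have partial_sum: "\<exists>N. (\<forall>j<N. \<nu> j < \<Lambda>) \<and> cmod (spectral_function \<phi> \<nu> \<Lambda> x y) = cmod (\<Sum>j<N. a j * \<phi> j y)" for \<Lambda> y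
  proof -
    define S where "S = {j. 0 < \<nu> j \<and> \<nu> j < \<Lambda>}"
    show ?thesis
    proof (cases "finite S \<and> S \<noteq> {}")
      case False
      then have "spectral_function \<phi> \<nu> \<Lambda> x y = 0"
        unfolding spectral_function_def S_def[symmetric] by (cases "finite S") auto
      then show ?thesis by (intro exI[of _ 0]) simp
    next
      case True
      define N where "N = Suc (Max S)"
      have "Max S \<in> S" using True by (intro Max_in) auto
      then have N: "\<nu> j < \<Lambda>" if "j < N" for j
        using incseqD[OF inc, of j "Max S"] that by (auto simp: S_def N_def)
      have "S \<subseteq> {..<N}" using True by (auto simp: N_def less_Suc_eq_le)
      then have "(\<Sum>j<N. a j * \<phi> j y) = (\<Sum>j\<in>S. a j * \<phi> j y)"
        using N by (intro sum.mono_neutral_right) (auto simp: S_def a_def)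
      also have "\<dots> = cnj (spectral_function \<phi> \<nu> \<Lambda> x y)"
        unfolding spectral_function_def S_def[symmetric] cnj_sum
        by (intro sum.cong refl) (simp add: a_def S_def)
      finally show ?thesis using N by (intro exI[of _ N]) simp
    qed
  qed
  obtain N where N: "N \<in> null_sets \<mu>" and sub: "{y \<in> space \<mu>. \<not> good y} \<subseteq> N"
    using ae unfolding eventually_ae_filter by blast
  have space: "space \<mu> = UNIV" using sets_eq_imp_space_eq[OF sets] by simp
  show "\<exists>Z. UNIV - Z \<in> null_sets (riemannian_measure \<A> g) \<and>
           (\<forall>y\<in>Z. \<forall>\<epsilon>>0. \<exists>C>0. \<exists>\<Lambda>0. \<forall>\<Lambda>\<ge>\<Lambda>0.
              cmod (spectral_function \<phi> \<nu> \<Lambda> x y)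
                \<le> C * \<Lambda> powr (real CARD('n) / 2) * (ln \<Lambda>) powr (3/2)
                    * (ln (ln \<Lambda>)) powr (1/2 + \<epsilon>))"
  proof (intro exI[of _ "- N"] conjI ballI allI impI)
    show "UNIV - - N \<in> null_sets (riemannian_measure \<A> g)" using N by (simp add: \<mu>_def Compl_eq_Diff_UNIV[symmetric])
    fix y and \<epsilon> :: real assume "y \<in> - N" "0 < \<epsilon>"
    then have "good y" using sub space by auto
    then obtain C \<Lambda>0 where "0 < C" and b: "\<forall>\<Lambda>\<ge>\<Lambda>0. \<forall>N. (\<forall>j<N. \<nu> j < \<Lambda>) \<longrightarrow>
      cmod (\<Sum>j<N. a j * \<phi> j y) \<le> C * \<Lambda> powr (real CARD('n) / 2) * (ln \<Lambda>) powr (3/2) * (ln (ln \<Lambda>)) powr (1/2 + \<epsilon>)"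
      using \<open>0 < \<epsilon>\<close> unfolding good_def by meson
    show "\<exists>C>0. \<exists>\<Lambda>0. \<forall>\<Lambda>\<ge>\<Lambda>0. cmod (spectral_function \<phi> \<nu> \<Lambda> x y)
                \<le> C * \<Lambda> powr (real CARD('n) / 2) * (ln \<Lambda>) powr (3/2) * (ln (ln \<Lambda>)) powr (1/2 + \<epsilon>)"
    proof (rule exI[of _ C], rule conjI[OF \<open>0 < C\<close>], rule exI[of _ \<Lambda>0], intro allI impI)
      fix \<Lambda> assume "\<Lambda>0 \<le> \<Lambda>"
      obtain N where "\<forall>j<N. \<nu> j < \<Lambda>" and eq: "cmod (spectral_function \<phi> \<nu> \<Lambda> x y) = cmod (\<Sum>j<N. a j * \<phi> j y)"
        using partial_sum[of \<Lambda> y] by blast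
      then show "cmod (spectral_function \<phi> \<nu> \<Lambda> x y)
                \<le> C * \<Lambda> powr (real CARD('n) / 2) * (ln \<Lambda>) powr (3/2) * (ln (ln \<Lambda>)) powr (1/2 + \<epsilon>)"
        unfolding eq using b \<open>\<Lambda>0 \<le> \<Lambda>\<close> by simp
    qed
  qed
qed

end
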